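(* Let $\mathbf{x}_1,\dots,\mathbf{x}_n$ be i.i.d. $N_p(\mathbf{0},\boldsymbol{\Sigma})$ with $\boldsymbol{\Sigma}=(r^{|i-j|})_{1\le i,j\le p}$, $r=r_n\in[0,1)$, $p=p_n\to\infty$, $\log p=o(n^{1/5})$, $\limsup_n r_n<1$, and $\lim_{n\to\infty} r\sqrt n/\sqrt{\log p}=2-\sqrt2$. Set $$\kappa_n=\frac{r\sqrt n}{\sqrt{\log p}}-(2-\sqrt2),\qquad \lambda_n=\sqrt2(\log p)\kappa_n+\Big(\tfrac{1}{\sqrt8}-\tfrac12\Big)\log\log p .$$ Let $a_n=2\sqrt{n\log p}$, $b_n=4\log p-\tfrac12[\log\log p+\log(4\pi)]$, $K_1=\tfrac1{2\sqrt2}$, $c_n=\frac{\sqrt{2n\log p}}{1-r^2}$, $d_n=\frac{r\sqrt{2n\log p}}{1-r^2}+2\log p-\tfrac12[\log\log p+\log(4\pi)]$, and $K_2=(\tfrac12-\tfrac1{\sqrt8})\log(4\pi)$. (i) If $\lambda_n\to-\infty$, then $a_n\mathcal{L}_n-b_n$ converges weakly to the distribution with cdf $\exp(-K_1e^{-x})$. (ii) If $\lambda_n\to\lambda\in\mathbb{R}$, then $a_n\mathcal{L}_n-b_n$ converges weakly to the distribution with cdf $$F(x)=\exp\big(-K_1e^{-x}\big)\cdot\exp\big(-e^{-x/\sqrt2-K_2+\lambda}\big).$$ (iii) If $\lambda_n\to\infty$, then $c_n\mathcal{L}_n-d_n$ converges weakly to the distribution with cdf $\exp(-e^{-x})$.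
   Context: Write $\mathbf{x}_k=(x_{k1},\dots,x_{kp})^T$. For $1\le i<j\le p$ define $$\hat\rho_{i,j}=\frac{\sum_{k=1}^n x_{ki}x_{kj}}{\sqrt{\sum_{k=1}^n x_{ki}^2\sum_{k=1}^n x_{kj}^2}},\qquad \mathcal{L}_n=\max_{1\le i<j\le p}\hat\rho_{i,j}.$$ All quantities $r,p$ may depend on $n$; limits are as $n\to\infty$. *)

theory Defs
  imports "HOL-Probability.Probability"
begin

definition ar_cov :: "real \<Rightarrow> nat \<Rightarrow> nat \<Rightarrow> real" where
  "ar_cov r i j = r ^ (if i \<le> j then j - i else i - j)"

definition centered_gaussian_vector ::
  "'a measure \<Rightarrow> nat \<Rightarrow> (nat \<Rightarrow> nat \<Rightarrow> real) \<Rightarrow> (nat \<Rightarrow> 'a \<Rightarrow> real) \<Rightarrow> bool" where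
  "centered_gaussian_vector M p S X \<longleftrightarrow>
     (\<forall>i<p. X i \<in> borel_measurable M) \<and>
     (\<forall>a::nat \<Rightarrow> real. (\<exists>i<p. a i \<noteq> 0) \<longrightarrow>
        distributed M lborel (\<lambda>\<omega>. \<Sum>i<p. a i * X i \<omega>)
          (normal_density 0 (sqrt (\<Sum>i<p. \<Sum>j<p. a i * S i j * a j))))"

definition rho_hat :: "nat \<Rightarrow> (nat \<Rightarrow> nat \<Rightarrow> real) \<Rightarrow> nat \<Rightarrow> nat \<Rightarrow> real" where
  "rho_hat n x i j = (\<Sum>k<n. x k i * x k j) /
      sqrt ((\<Sum>k<n. (x k i)\<^sup>2) * (\<Sum>k<n. (x k j)\<^sup>2))"

text \<open>L_n = max over 1 <= i < j <= p (here 0 <= i < j < p).\<close>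
definition L_stat :: "nat \<Rightarrow> nat \<Rightarrow> (nat \<Rightarrow> nat \<Rightarrow> real) \<Rightarrow> real" where
  "L_stat n p x = Max {rho_hat n x i j | i j. i < j \<and> j < p}"

definition kappa_n :: "nat \<Rightarrow> nat \<Rightarrow> real \<Rightarrow> real" where
  "kappa_n n p r = r * sqrt (real n) / sqrt (ln (real p)) - (2 - sqrt 2)"

definition lambda_n :: "nat \<Rightarrow> nat \<Rightarrow> real \<Rightarrow> real" where
  "lambda_n n p r = sqrt 2 * ln (real p) * kappa_n n p r
     + (1 / sqrt 8 - 1 / 2) * ln (ln (real p))"

definition a_n :: "nat \<Rightarrow> nat \<Rightarrow> real" where
  "a_n n p = 2 * sqrt (real n * ln (real p))"

definition b_n :: "nat \<Rightarrow> real" where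
  "b_n p = 4 * ln (real p) - 1 / 2 * (ln (ln (real p)) + ln (4 * pi))"

definition K1 :: real where "K1 = 1 / (2 * sqrt 2)"

definition c_n :: "nat \<Rightarrow> nat \<Rightarrow> real \<Rightarrow> real" where
  "c_n n p r = sqrt (2 * real n * ln (real p)) / (1 - r\<^sup>2)"

definition d_n :: "nat \<Rightarrow> nat \<Rightarrow> real \<Rightarrow> real" where
  "d_n n p r = r * sqrt (2 * real n * ln (real p)) / (1 - r\<^sup>2)
     + 2 * ln (real p) - 1 / 2 * (ln (ln (real p)) + ln (4 * pi))"

definition K2 :: real where "K2 = (1 / 2 - 1 / sqrt 8) * ln (4 * pi)"

end

theory Submission
  imports Defs
begin

text \<open>
The innovations $E_i = (Y_i - r Y_{i-1})/\sqrt{1-r^2}$ of the columns $Y_i \in \mathbb{R}^n$ are independent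
standard Gaussian vectors. With high probability the squared norms and the inner products of the $E_i$ are within
relative order $\sqrt{\log p/n}$ of their means, and since $r$ has the same order, uniformly in $i<j$
\[ \sqrt n\,\hat\rho_{i,j} = T_{ij} + \sqrt n\, r\, 1_{\{j=i+1\}} + O(\log p/\sqrt n),
   \qquad T_{ij} = \langle E_i/|E_i|, E_j\rangle . \]
The error is negligible because $(\log p)^{3/2}/\sqrt n \to 0$.

Given the first $j$ columns, every $T_{ij}$ with $i<j$ is exactly $N(0,1)$, and two of them are jointly Gaussian
with correlation $\langle E_i, E_k\rangle/(|E_i||E_k|) = O(\sqrt{\log p/n})$. Adding the columns one by one and
using the second Bonferroni inequality therefore multiplies the probability that no $T_{ij}$ exceeds its threshold by
$1-\pi_j$ up to a summable error, where $\pi_j$ is the sum of the Gaussian tails of the $j$ new pairs. The product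
$\prod_j (1-\pi_j)$ converges to $\exp(-\lim \sum_j \pi_j)$, and Mills' ratio evaluates the contributions of the $p-1$
adjacent pairs and of the remaining pairs in the three regimes.
\<close>

section \<open>Independence of uncorrelated Gaussian variables\<close>

text \<open>The hypotheses give the laws of linear combinations of one row and the independence of
  the rows, so joint independence of the innovations has to be extracted from a joint characteristic
  function. The constant 2 - sqrt 2 balances two maxima: about p^2/2 distant pairs peak near 2
  sqrt(log p); the p - 1 adjacent pairs peak near sqrt(2 log p) and are lifted by sqrt n r. At
  criticality the lift closes the gap to first order, and \<open>lambda_n\<close> is the next-order
  offset in the exponent of the adjacent tail. Normalizing only the earlier column in T_ij makes it
  exactly Gaussian given the past; a sample correlation would call for a moderate deviation estimate
  of its own law, whereas here Mills' ratio is enough. Conditioning column by column leaves only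
  double exceedances within one column to control, and crude bounds do: p^3 triples with two distant
  pairs cost about p^(-4) each, p^2 triples with an adjacent pair about p^(-3) each, so factors
  p^(o(1)) from the small correlations are harmless.\<close>

lemma (in prob_space) weighted_char_normal:
  fixes g Z :: "'a \<Rightarrow> real" and m :: real
  assumes [measurable]: "g \<in> borel_measurable M" "Z \<in> borel_measurable M"
    and g0: "\<And>x. 0 \<le> g x" and "0 < m" and [measurable]: "B \<in> sets borel"
    and ch: "\<And>b. (LINT x|M. g x *\<^sub>R iexp (b * Z x)) = of_real (m * exp (- b\<^sup>2 / 2))"
    and ig: "integrable M g"
  shows "(LINT x|M. g x * indicator B (Z x)) = m * measure std_normal_distribution B"
proof -
  \<comment> \<open>Tilting M by the weight g, normalized to mass one, gives a probability measure
    under which Z has characteristic function exp(-t^2/2). Uniqueness identifies the law of Z under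
    D, and the claim is that law evaluated on B.\<close>
  define D where "D = density M (\<lambda>x. ennreal (g x / m))"
  have [measurable_cong]: "sets D = sets M" by (simp add: D_def)
  have "of_real (LINT x|M. g x) = (of_real m :: complex)"
    using ch[of 0] by (simp add: scaleR_conv_of_real)
  then have m: "(LINT x|M. g x) = m" by (simp only: of_real_eq_iff)
  have em: "emeasure D A = ennreal (LINT x|M. g x / m * indicator A x)" if [measurable]: "A \<in> sets M" for A
  proof -
    have "emeasure D A = (\<integral>\<^sup>+ x. ennreal (g x / m * indicator A x) \<partial>M)"
      unfolding D_def using g0 \<open>0 < m\<close>
      by (subst emeasure_density) (auto intro!: nn_integral_cong simp: indicator_def)
    also have "\<dots> = ennreal (LINT x|M. g x / m * indicator A x)"
      using g0 \<open>0 < m\<close>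
      by (intro nn_integral_eq_integral) (auto intro!: integrable_real_mult_indicator ig integrable_divide)
    finally show ?thesis .
  qed
  have "emeasure D (space D) = 1"
  proof -
    have "emeasure D (space M) = ennreal (LINT x|M. g x / m * indicator (space M) x)"
      by (rule em) simp
    also have "(LINT x|M. g x / m * indicator (space M) x) = (LINT x|M. g x / m)"
      by (intro Bochner_Integration.integral_cong) auto
    also have "\<dots> = 1" using m \<open>0 < m\<close> by simp
    finally show ?thesis by (simp add: D_def)
  qed
  then interpret D: prob_space D by (rule prob_spaceI)
  have "distr D borel Z = std_normal_distribution"
  proof (rule Levy_uniqueness)
    show "real_distribution (distr D borel Z)" by (rule D.real_distribution_distr) measurable
    show "real_distribution std_normal_distribution" by (rule real_dist_normal_dist)
    show "char (distr D borel Z) = char std_normal_distribution"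
    proof
      fix t
      have "char (distr D borel Z) t = (LINT x|D. iexp (t * Z x))"
        unfolding char_def by (subst integral_distr) auto
      also have "\<dots> = (LINT x|M. (g x / m) *\<^sub>R iexp (t * Z x))"
        unfolding D_def using g0 \<open>0 < m\<close> by (subst integral_density) auto
      also have "\<dots> = (LINT x|M. (1 / m) *\<^sub>R (g x *\<^sub>R iexp (t * Z x)))"
        by (simp add: mult.commute)
      also have "\<dots> = (1 / m) *\<^sub>R (LINT x|M. g x *\<^sub>R iexp (t * Z x))"
        by (rule integral_scaleR_right)
      also have "\<dots> = char std_normal_distribution t"
        unfolding ch char_std_normal_distribution using \<open>0 < m\<close> by (simp add: scaleR_conv_of_real)
      finally show "char (distr D borel Z) t = char std_normal_distribution t" .
    qed
  qed
  then have "measure std_normal_distribution B = measure D (Z -` B \<inter> space M)"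
    by (subst \<open>distr D borel Z = _\<close>[symmetric], subst measure_distr) (auto simp: D_def)
  also have "\<dots> = (LINT x|M. g x / m * indicator (Z -` B \<inter> space M) x)"
    unfolding measure_def using g0 \<open>0 < m\<close>
    by (subst em) (auto intro!: enn2real_ennreal integral_nonneg_AE)
  also have "\<dots> = (LINT x|M. (g x * indicator B (Z x)) / m)"
    by (intro Bochner_Integration.integral_cong) (auto simp: indicator_def)
  also have "\<dots> = (LINT x|M. g x * indicator B (Z x)) / m" by simp
  finally show ?thesis using \<open>0 < m\<close> by simp
qed

text \<open>
Induction on the number of variables, peeling off one of them with the one-dimensional uniqueness theorem. That theorem
needs nonnegative weights: $1 + \mathrm{Re}(u\,e^{iS})$ with $|u| = 1$ is nonnegative, and the choices $u = 1$ and $u = -i$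
recover the characteristic function of the remaining variables.
\<close>

lemma (in prob_space) normal_rectangles:
  fixes Z :: "'i \<Rightarrow> 'a \<Rightarrow> real"
  assumes "finite I" "W \<in> events"
    and "\<And>i. i \<in> I \<Longrightarrow> Z i \<in> borel_measurable M"
    and "\<And>a. (LINT x|M. indicator W x *\<^sub>R iexp (\<Sum>i\<in>I. a i * Z i x)) = of_real (prob W * exp (- (\<Sum>i\<in>I. (a i)\<^sup>2) / 2))"
    and "\<And>i. i \<in> I \<Longrightarrow> B i \<in> sets borel"
  shows "prob (W \<inter> {x\<in>space M. \<forall>i\<in>I. Z i x \<in> B i}) = prob W * (\<Prod>i\<in>I. measure std_normal_distribution (B i))"
  using assms
proof (induction I arbitrary: W rule: finite_induct)
  case empty
  then have "W \<inter> {x \<in> space M. \<forall>i\<in>{}. Z i x \<in> B i} = W" using sets.sets_into_space by auto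
  then show ?case by simp
next
  case (insert d I)
  note [measurable] = insert.prems(1)
  have [measurable]: "Z d \<in> borel_measurable M" "\<And>i. i \<in> I \<Longrightarrow> Z i \<in> borel_measurable M"
    "B d \<in> sets borel" using insert.prems by auto
  let ?N = "measure std_normal_distribution"
  show ?case
  \<comment> \<open>Tilting divides by the mass of the weight, so the null event is treated
    apart.\<close>
  proof (cases "prob W = 0")
    case True
    have "prob (W \<inter> {x \<in> space M. \<forall>i\<in>insert d I. Z i x \<in> B i}) \<le> prob W"
      by (intro finite_measure_mono) auto
    then show ?thesis using True by (simp add: measure_le_0_iff)
  next
    case False
    then have pW: "prob W > 0" by (simp add: zero_less_measure_iff)
    \<comment> \<open>W' absorbs the condition on \<open>Z d\<close>. The induction hypothesis is
      applied to it, which is why the event is kept arbitrary in the induction.\<close>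
    define W' where "W' = W \<inter> {x\<in>space M. Z d x \<in> B d}"
    have [measurable]: "W' \<in> events" unfolding W'_def by measurable
    have joint: "(LINT x|M. indicator W x *\<^sub>R iexp (b * Z d x + (\<Sum>i\<in>I. a i * Z i x))) =
        of_real (prob W * (exp (- b\<^sup>2 / 2) * exp (- (\<Sum>i\<in>I. (a i)\<^sup>2) / 2)))" for a b
    proof -
      let ?a = "\<lambda>i. if i = d then b else a i"
      have "(\<Sum>i\<in>insert d I. ?a i * Z i x) = b * Z d x + (\<Sum>i\<in>I. a i * Z i x)" for x
        using insert.hyps by (simp add: if_distrib[of "\<lambda>c. c * _"] cong: if_cong) (auto intro!: sum.cong)
      moreover have "(\<Sum>i\<in>insert d I. (?a i)\<^sup>2) = b\<^sup>2 + (\<Sum>i\<in>I. (a i)\<^sup>2)"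
        using insert.hyps by simp (auto intro!: sum.cong)
      ultimately show ?thesis using insert.prems(3)[of ?a]
        by (simp add: exp_add[symmetric] add_divide_distrib diff_divide_distrib)
    qed
    have W'eq: "(LINT x|M. indicator W x * h x * indicator (B d) (Z d x)) = (LINT x|M. indicator W' x * h x)" for h :: "'a \<Rightarrow> real"
      by (intro Bochner_Integration.integral_cong) (auto simp: W'_def indicator_def)
    have S_meas: "(\<lambda>x. \<Sum>i\<in>I. a i * Z i x) \<in> borel_measurable M" for a by measurable
    \<comment> \<open>The mass of the weight must be positive; \<open>pos\<close> holds for u = 1
      and for u = -i, whatever a is.\<close>
    have weighted: "(LINT x|M. indicator W x * (1 + Re (u * iexp (\<Sum>i\<in>I. a i * Z i x))) * indicator (B d) (Z d x))
        = prob W * (1 + Re u * exp (- (\<Sum>i\<in>I. (a i)\<^sup>2) / 2)) * ?N (B d)"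
      if u: "cmod u = 1" and pos: "0 < 1 + Re u * exp (- (\<Sum>i\<in>I. (a i)\<^sup>2) / 2)" for a u
    proof (rule weighted_char_normal)
      define S where "S = (\<lambda>x. \<Sum>i\<in>I. a i * Z i x)"
      have [measurable]: "S \<in> borel_measurable M" unfolding S_def by measurable
      define q where "q = exp (- (\<Sum>i\<in>I. (a i)\<^sup>2) / 2)"
      fix b
      have 1: "(LINT x|M. indicator W x *\<^sub>R iexp (b * Z d x + S x)) = of_real (prob W * (exp (- b\<^sup>2 / 2) * q))"
        using joint[of b a] by (simp add: S_def q_def)
      have 2: "(LINT x|M. indicator W x *\<^sub>R iexp (b * Z d x - S x)) = of_real (prob W * (exp (- b\<^sup>2 / 2) * q))"
        using joint[of b "\<lambda>i. - a i"] by (simp add: S_def q_def sum_negf)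
      have 3: "(LINT x|M. indicator W x *\<^sub>R iexp (b * Z d x)) = of_real (prob W * exp (- b\<^sup>2 / 2))"
        using joint[of b "\<lambda>i. 0"] by simp
      have int: "integrable M (\<lambda>x. indicator W x *\<^sub>R iexp (f x))" if [measurable]: "f \<in> borel_measurable M" for f
        by (rule integrable_const_bound[where B=1]) (auto simp: indicator_def)
      \<comment> \<open>The real part brings in exp(iS) and its conjugate, so the joint
        characteristic function is used at a and at -a, where it has the same value.\<close>
      have expand: "(1 + Re (u * iexp s)) *\<^sub>R iexp t = iexp t + (u / 2) * iexp (t + s) + (cnj u / 2) * iexp (t - s)" for s t :: real
      proof -
        have 1: "iexp (t + s) = iexp t * iexp s" by (simp add: exp_add[symmetric] distrib_left)
        have 2: "iexp (t - s) = iexp t * cnj (iexp s)" by (simp add: exp_cnj exp_add[symmetric] right_diff_distrib)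
        have 3: "complex_of_real (1 + Re z) = 1 + z / 2 + cnj z / 2" for z by (simp add: complex_eq_iff)
        show ?thesis unfolding 1 2 3 scaleR_conv_of_real complex_cnj_mult by (simp only: ring_distribs) (simp add: mult_ac)
      qed
      have "(LINT x|M. (indicator W x * (1 + Re (u * iexp (S x)))) *\<^sub>R iexp (b * Z d x)) =
         (LINT x|M. indicator W x *\<^sub>R iexp (b * Z d x) + (u / 2) * (indicator W x *\<^sub>R iexp (b * Z d x + S x))
           + (cnj u / 2) * (indicator W x *\<^sub>R iexp (b * Z d x - S x)))"
        by (intro Bochner_Integration.integral_cong refl) (simp only: scaleR_scaleR[symmetric] expand scaleR_add_right mult_scaleR_right)
      also have "\<dots> = (LINT x|M. indicator W x *\<^sub>R iexp (b * Z d x) + (u / 2) * (indicator W x *\<^sub>R iexp (b * Z d x + S x)))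
           + (LINT x|M. (cnj u / 2) * (indicator W x *\<^sub>R iexp (b * Z d x - S x)))"
        by (intro Bochner_Integration.integral_add Bochner_Integration.integrable_add integrable_mult_right int) measurable
      also have "\<dots> = (LINT x|M. indicator W x *\<^sub>R iexp (b * Z d x)) + (LINT x|M. (u / 2) * (indicator W x *\<^sub>R iexp (b * Z d x + S x)))
           + (LINT x|M. (cnj u / 2) * (indicator W x *\<^sub>R iexp (b * Z d x - S x)))"
        by (intro arg_cong2[where f="(+)"] Bochner_Integration.integral_add integrable_mult_right int refl) measurable
      also have "\<dots> = of_real (prob W * (1 + Re u * q) * exp (- b\<^sup>2 / 2))"
        unfolding integral_mult_right_zero 1 2 3 by (simp add: complex_eq_iff algebra_simps)
      finally show "(LINT x|M. (indicator W x * (1 + Re (u * iexp (\<Sum>i\<in>I. a i * Z i x)))) *\<^sub>R iexp (b * Z d x)) =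
        of_real (prob W * (1 + Re u * exp (- (\<Sum>i\<in>I. (a i)\<^sup>2) / 2)) * exp (- b\<^sup>2 / 2))"
        by (simp add: S_def q_def)
    next
      have bound: "\<bar>Re (u * iexp t)\<bar> \<le> 1" for t :: real
        using abs_Re_le_cmod[of "u * iexp t"] u by (simp add: norm_mult)
      have le: "0 \<le> 1 + Re (u * iexp t)" "\<bar>1 + Re (u * iexp t)\<bar> \<le> 2" for t :: real
        using bound[of t] by (simp_all only: abs_le_iff) linarith+
      show "0 \<le> indicator W x * (1 + Re (u * iexp (\<Sum>i\<in>I. a i * Z i x)))" for x
        by (intro mult_nonneg_nonneg indicator_pos_le le)
      show "0 < prob W * (1 + Re u * exp (- (\<Sum>i\<in>I. (a i)\<^sup>2) / 2))" using pW pos by simp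
      show "integrable M (\<lambda>x. indicator W x * (1 + Re (u * iexp (\<Sum>i\<in>I. a i * Z i x))))"
      proof (rule integrable_const_bound[where B=2])
        show "AE x in M. norm (indicator W x * (1 + Re (u * iexp (\<Sum>i\<in>I. a i * Z i x)))) \<le> 2"
        proof (rule AE_I2)
          fix x
          show "norm (indicator W x * (1 + Re (u * iexp (\<Sum>i\<in>I. a i * Z i x)))) \<le> 2"
            using le(2)[of "\<Sum>i\<in>I. a i * Z i x"] by (cases "x \<in> W") simp_all
        qed
      qed (use S_meas[of a] in measurable)
    qed (use S_meas[of a] in measurable)
    have pW': "prob W' = prob W * ?N (B d)"
    proof -
      have "prob W * 2 * ?N (B d) = (LINT x|M. indicator W' x * 2)"
        using weighted[of 1 "\<lambda>_. 0"] W'eq[of "\<lambda>_. 2"] by simp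
      then show ?thesis by simp
    qed
    have int': "integrable M (\<lambda>x. indicator W' x * h x)" if [measurable]: "h \<in> borel_measurable M" and "\<And>x. \<bar>h x\<bar> \<le> 1" for h :: "'a \<Rightarrow> real"
      using that(2) by (intro integrable_const_bound[where B=1]) (auto simp: indicator_def)
    have "prob (W' \<inter> {x \<in> space M. \<forall>i\<in>I. Z i x \<in> B i}) = prob W' * (\<Prod>i\<in>I. ?N (B i))"
    proof (rule insert.IH)
      fix a
      define S where "S = (\<lambda>x. \<Sum>i\<in>I. a i * Z i x)"
      have [measurable]: "S \<in> borel_measurable M" unfolding S_def by measurable
      define q where "q = exp (- (\<Sum>i\<in>I. (a i)\<^sup>2) / 2)"
      have c: "(LINT x|M. indicator W' x * Re (u * iexp (S x))) = prob W' * (Re u * q)"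
        if u: "cmod u = 1" and pos: "0 < 1 + Re u * q" for u
      proof -
        have m: "\<bar>Re (u * iexp (S x))\<bar> \<le> 1" for x
          using abs_Re_le_cmod[of "u * iexp (S x)"] u by (simp add: norm_mult)
        have "(LINT x|M. indicator W' x * (1 + Re (u * iexp (S x)))) = (LINT x|M. indicator W' x * 1 + indicator W' x * Re (u * iexp (S x)))"
          by (simp add: distrib_left)
        also have "\<dots> = (LINT x|M. indicator W' x * 1) + (LINT x|M. indicator W' x * Re (u * iexp (S x)))"
          by (intro Bochner_Integration.integral_add int' m) simp_all
        moreover have "(LINT x|M. indicator W' x * (1 + Re (u * iexp (S x)))) = prob W * (1 + Re u * q) * ?N (B d)"
          using weighted[OF u, of a] pos unfolding W'eq S_def q_def by blast
        moreover have "(LINT x|M. indicator W' x * 1) = prob W'" by simp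
        ultimately show ?thesis unfolding pW' by argo
      qed
      have "0 < q" by (simp add: q_def)
      then have re: "(LINT x|M. indicator W' x * cos (S x)) = prob W' * q"
        and im: "(LINT x|M. indicator W' x * sin (S x)) = 0"
        using c[of 1] c[of "- \<i>"] by (simp_all add: Re_exp Im_exp)
      have ic: "integrable M (\<lambda>x. complex_of_real (indicator W' x * cos (S x)))"
        and ii: "integrable M (\<lambda>x. complex_of_real (indicator W' x * sin (S x)))"
        by (intro integrable_of_real int'; simp)+
      have "(LINT x|M. indicator W' x *\<^sub>R iexp (S x)) =
         (LINT x|M. complex_of_real (indicator W' x * cos (S x)) + \<i> * complex_of_real (indicator W' x * sin (S x)))"
        by (intro Bochner_Integration.integral_cong refl) (auto simp: complex_eq_iff Re_exp Im_exp indicator_def)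
      also have "\<dots> = of_real (prob W' * q)"
        unfolding Bochner_Integration.integral_add[OF ic integrable_mult_right[OF ii]] integral_mult_right_zero integral_complex_of_real re im
        by simp
      finally show "(LINT x|M. indicator W' x *\<^sub>R iexp (\<Sum>i\<in>I. a i * Z i x)) = of_real (prob W' * exp (- (\<Sum>i\<in>I. (a i)\<^sup>2) / 2))"
        unfolding S_def q_def .
    qed (use insert.prems in auto)
    moreover have "W' \<inter> {x \<in> space M. \<forall>i\<in>I. Z i x \<in> B i} = W \<inter> {x \<in> space M. \<forall>i\<in>insert d I. Z i x \<in> B i}"
      by (auto simp: W'_def)
    ultimately show ?thesis using insert.hyps by (simp add: pW' mult.assoc)
  qed
qed

text \<open>The rectangle formula with W the whole space. Marginals come from rectangles all of
  whose sides but one are \<open>UNIV\<close>, and then the formula is the product rule that defines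
  independence.\<close>

lemma (in prob_space) iid_normal_of_char:
  fixes Z :: "'i \<Rightarrow> 'a \<Rightarrow> real"
  assumes "finite I" "I \<noteq> {}"
    and meas: "\<And>i. i \<in> I \<Longrightarrow> Z i \<in> borel_measurable M"
    and ch: "\<And>a. (LINT x|M. iexp (\<Sum>i\<in>I. a i * Z i x)) = of_real (exp (- (\<Sum>i\<in>I. (a i)\<^sup>2) / 2))"
  shows "indep_vars (\<lambda>_. borel) Z I"
proof -
  let ?N = "measure std_normal_distribution"
  have N: "prob_space std_normal_distribution" by (rule prob_space_normal_density) simp
  have chW: "(LINT x|M. indicator (space M) x *\<^sub>R iexp (\<Sum>i\<in>I. a i * Z i x)) = of_real (prob (space M) * exp (- (\<Sum>i\<in>I. (a i)\<^sup>2) / 2))" for a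
  proof -
    have "(LINT x|M. indicator (space M) x *\<^sub>R iexp (\<Sum>i\<in>I. a i * Z i x)) = (LINT x|M. iexp (\<Sum>i\<in>I. a i * Z i x))"
      by (intro Bochner_Integration.integral_cong) (auto simp: indicator_def)
    then show ?thesis by (simp only: ch prob_space mult_1)
  qed
  have rect: "prob (\<Inter>j\<in>I. Z j -` A j \<inter> space M) = (\<Prod>i\<in>I. ?N (A i))"
    if "\<And>i. i \<in> I \<Longrightarrow> A i \<in> sets borel" for A
  proof -
    have "(\<Inter>j\<in>I. Z j -` A j \<inter> space M) = space M \<inter> {x\<in>space M. \<forall>i\<in>I. Z i x \<in> A i}"
      using \<open>I \<noteq> {}\<close> by auto
    then show ?thesis
      using normal_rectangles[OF \<open>finite I\<close> sets.top meas chW that] by (simp add: prob_space)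
  qed
  have single: "prob (Z i -` B \<inter> space M) = ?N B" if "i \<in> I" "B \<in> sets borel" for i B
  proof -
    have "Z j -` (if j = i then B else UNIV) \<inter> space M = (if j = i then Z i -` B \<inter> space M else space M)" for j
      by auto
    then have "(\<Inter>j\<in>I. Z j -` (if j = i then B else UNIV) \<inter> space M) = Z i -` B \<inter> space M"
      using that by auto
    moreover have "(\<Prod>j\<in>I. ?N (if j = i then B else UNIV)) = ?N B"
    proof -
      have "?N UNIV = 1" using prob_space.prob_space[OF N] by simp
      then have "(\<Prod>j\<in>I. ?N (if j = i then B else UNIV)) = (\<Prod>j\<in>I. if j = i then ?N B else 1)"
        by (intro prod.cong) auto
      then show ?thesis using that \<open>finite I\<close> by simp
    qed
    ultimately show ?thesis using rect[of "\<lambda>j. if j = i then B else UNIV"] that by auto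
  qed
  show ?thesis
  proof (subst indep_vars_finite[where E="\<lambda>_. sets borel"])
    show "\<forall>A\<in>I \<rightarrow> sets borel. prob (\<Inter>j\<in>I. Z j -` A j \<inter> space M) = (\<Prod>j\<in>I. prob (Z j -` A j \<inter> space M))"
    proof
      fix A assume A: "A \<in> I \<rightarrow> sets (borel :: real measure)"
      have "(\<Prod>j\<in>I. prob (Z j -` A j \<inter> space M)) = (\<Prod>j\<in>I. ?N (A j))"
        using A by (intro prod.cong refl single) auto
      with A show "prob (\<Inter>j\<in>I. Z j -` A j \<inter> space M) = (\<Prod>j\<in>I. prob (Z j -` A j \<inter> space M))"
        by (subst rect) auto
    qed
    show "sets borel = sigma_sets (space borel) (sets (borel :: real measure))" for i :: 'i
      by (metis sets.sigma_sets_eq)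
    show "Int_stable (sets (borel :: real measure))" by (rule sets.Int_stable)
  qed (use assms in auto)
qed

lemma (in prob_space) unit_combination_normal:
  fixes Z :: "'i \<Rightarrow> 'a \<Rightarrow> real"
  assumes "finite I" 
    and meas: "\<And>i. i \<in> I \<Longrightarrow> Z i \<in> borel_measurable M"
    and ch: "\<And>a. (LINT x|M. iexp (\<Sum>i\<in>I. a i * Z i x)) = of_real (exp (- (\<Sum>i\<in>I. (a i)\<^sup>2) / 2))"
    and w: "(\<Sum>i\<in>I. (w i)\<^sup>2) = 1"
  shows "distr M borel (\<lambda>x. \<Sum>i\<in>I. w i * Z i x) = std_normal_distribution"
proof (rule Levy_uniqueness)
  have [measurable]: "(\<lambda>x. \<Sum>i\<in>I. w i * Z i x) \<in> borel_measurable M" using meas by measurable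
  show "real_distribution (distr M borel (\<lambda>x. \<Sum>i\<in>I. w i * Z i x))" 
    by (rule real_distribution_distr) measurable
  show "real_distribution std_normal_distribution" by (rule real_dist_normal_dist)
  show "char (distr M borel (\<lambda>x. \<Sum>i\<in>I. w i * Z i x)) = char std_normal_distribution"
  proof
    fix t
    have "char (distr M borel (\<lambda>x. \<Sum>i\<in>I. w i * Z i x)) t = (LINT x|M. iexp (t * (\<Sum>i\<in>I. w i * Z i x)))"
      unfolding char_def by (subst integral_distr) auto
    also have "\<dots> = (LINT x|M. iexp (\<Sum>i\<in>I. (t * w i) * Z i x))"
      by (simp add: sum_distrib_left mult.assoc)
    also have "\<dots> = of_real (exp (- (\<Sum>i\<in>I. (t * w i)\<^sup>2) / 2))" by (rule ch)
    also have "\<dots> = char std_normal_distribution t"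
      by (simp add: char_std_normal_distribution power_mult_distrib sum_distrib_left[symmetric] w)
    finally show "char (distr M borel (\<lambda>x. \<Sum>i\<in>I. w i * Z i x)) t = char std_normal_distribution t" .
  qed
qed

lemma (in prob_space) expectation_iexp_normal:
  assumes "distributed M lborel U (normal_density 0 \<sigma>)" "\<sigma> > 0"
  shows "(LINT x|M. iexp (U x)) = of_real (exp (- \<sigma>\<^sup>2 / 2))"
proof -
  have D: "distributed M lborel (\<lambda>x. (U x - 0) / \<sigma>) std_normal_density"
    using assms normal_standard_normal_convert by metis
  then have eq: "distr M lborel (\<lambda>x. (U x - 0) / \<sigma>) = std_normal_distribution"
    by (rule distributed_distr_eq_density)
  have Um: "(\<lambda>x. (U x - 0) / \<sigma>) \<in> M \<rightarrow>\<^sub>M lborel" using D by (rule distributed_measurable)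
  have "(LINT x|M. iexp (U x)) = (LINT x|M. iexp (\<sigma> * ((U x - 0) / \<sigma>)))" using assms(2) by simp
  also have "\<dots> = (LINT y|distr M lborel (\<lambda>x. (U x - 0) / \<sigma>). iexp (\<sigma> * y))"
    by (subst integral_distr[OF Um]) auto
  also have "\<dots> = char std_normal_distribution \<sigma>" unfolding eq char_def ..
  finally show ?thesis by (simp add: char_std_normal_distribution)
qed

section \<open>Innovations of the autoregression\<close>

definition innovation :: "real \<Rightarrow> (nat \<Rightarrow> 'a \<Rightarrow> real) \<Rightarrow> nat \<Rightarrow> 'a \<Rightarrow> real" where
  "innovation r X i \<omega> = (if i = 0 then X 0 \<omega> else (X i \<omega> - r * X (i - 1) \<omega>) / sqrt (1 - r\<^sup>2))"

text \<open>Row j of the inverse Cholesky factor of \<open>ar_cov r\<close>, a bidiagonal matrix.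
  Row 0 is a unit vector because \<open>X 0\<close> already has variance 1.\<close>

definition innov_coeff :: "real \<Rightarrow> nat \<Rightarrow> nat \<Rightarrow> real" where
  "innov_coeff r j m = (if m = j then (if j = 0 then 1 else 1 / sqrt (1 - r\<^sup>2))
     else if j = Suc m then - r / sqrt (1 - r\<^sup>2) else 0)"

lemma sum_innov_coeff:
  assumes "j < p"
  shows "(\<Sum>m<p. innov_coeff r j m * f m) = (if j = 0 then f 0 else (f j - r * f (j - 1)) / sqrt (1 - r\<^sup>2))"
proof (cases j)
  case 0
  have "(\<Sum>m<p. innov_coeff r j m * f m) = (\<Sum>m<p. if m = 0 then f 0 else 0)"
    using 0 by (intro sum.cong) (auto simp: innov_coeff_def)
  then show ?thesis using assms 0 by simp
next
  case (Suc k)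
  have "(\<Sum>m<p. innov_coeff r j m * f m) = (\<Sum>m<p. (if m = j then f j / sqrt (1 - r\<^sup>2) else 0) + (if m = k then - r * f k / sqrt (1 - r\<^sup>2) else 0))"
    using Suc by (intro sum.cong) (auto simp: innov_coeff_def)
  then show ?thesis using assms Suc by (simp add: sum.distrib diff_divide_distrib)
qed

text \<open>With B the bidiagonal coefficient matrix this is B Sigma B^T = I. In the proof
  \<open>F l\<close> is the covariance of X_l with innovation j: it vanishes for l < j and is
  multiplied by r at every step after j, so the difference operator in row i annihilates it unless i
  = j.\<close>

lemma innov_coeff_orthonormal:
  assumes "0 \<le> r" "r < 1" "i < p" "j < p"
  shows "(\<Sum>l<p. innov_coeff r i l * (\<Sum>m<p. innov_coeff r j m * ar_cov r l m)) = (if i = j then 1 else 0)"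
proof -
  define s where "s = sqrt (1 - r\<^sup>2)"
  have "r * r < 1" using mult_strict_mono'[of r 1 r 1] assms by simp
  then have s2: "s * s = 1 - r * r" and s0: "s \<noteq> 0"
    by (auto simp: s_def power2_eq_square)
  have geo: "ar_cov r l m = r ^ (m - l)" if "l \<le> m" for l m using that by (simp add: ar_cov_def)
  have geo': "ar_cov r l m = r ^ (l - m)" if "m \<le> l" for l m using that by (simp add: ar_cov_def)
  define F where "F = (\<lambda>l. if j = 0 then ar_cov r l 0 else (ar_cov r l j - r * ar_cov r l (j - 1)) / s)"
  have F: "(\<Sum>m<p. innov_coeff r j m * ar_cov r l m) = F l" for l
    using sum_innov_coeff[OF assms(4)] by (simp add: F_def s_def)
  have F0: "F l = 0" if lj: "l < j" for l
  proof -
    obtain k where k: "j = Suc k" using lj by (cases j) auto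
    then have "l \<le> k" using lj by simp
    with k show ?thesis by (simp add: F_def geo Suc_diff_le)
  qed
  have F1: "F j = (if j = 0 then 1 else s)"
  proof (cases j)
    case (Suc k)
    then have "F j = s * s / s" unfolding s2 by (simp add: F_def geo')
    then show ?thesis using s0 Suc by simp
  qed (simp add: F_def geo)
  have F2: "F (Suc l) = r * F l" if "j \<le> l" for l
  proof (cases j)
    case 0 then show ?thesis by (simp add: F_def geo')
  next
    case (Suc k)
    have "ar_cov r (Suc l) j = r * ar_cov r l j" "ar_cov r (Suc l) k = r * ar_cov r l k"
      using that Suc Suc_diff_Suc[of k l] by (auto simp: geo' Suc_diff_le simp flip: power_Suc)
    then show ?thesis using Suc by (simp add: F_def right_diff_distrib diff_divide_distrib)
  qed
  have "(\<Sum>l<p. innov_coeff r i l * F l) = (if i = 0 then F 0 else (F i - r * F (i - 1)) / s)"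
    using sum_innov_coeff[OF assms(3)] by (simp add: s_def)
  also have "\<dots> = (if i = j then 1 else 0)"
  proof (cases i)
    case 0 then show ?thesis using F0[of 0] F1 by auto
  next
    case (Suc k)
    consider "i < j" | "i = j" | "j < i" by linarith
    then show ?thesis
    proof cases
      case 1 then show ?thesis using F0[of i] F0[of k] Suc by simp
    next
      case 2 then show ?thesis using F0[of k] F1 Suc s0 by auto
    next
      case 3 then show ?thesis using F2[of k] Suc by simp
    qed
  qed
  finally show ?thesis by (simp add: F)
qed

text \<open>A combination of innovations with coefficients a is a combination of the entries of X
  with coefficients c = B^T a, and its variance c^T Sigma c is the squared norm of a by
  orthonormality.\<close>

lemma (in prob_space) char_innovation:
  assumes "centered_gaussian_vector M p (ar_cov r) X" and r: "0 \<le> r" "r < 1"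
  shows "(LINT x|M. iexp (\<Sum>i<p. a i * innovation r X i x)) = of_real (exp (- (\<Sum>i<p. (a i)\<^sup>2) / 2))"
proof -
  define c where "c = (\<lambda>m. \<Sum>j<p. a j * innov_coeff r j m)"
  have lin: "(\<Sum>i<p. a i * innovation r X i x) = (\<Sum>m<p. c m * X m x)" for x
  proof -
    have "innovation r X i x = (\<Sum>m<p. innov_coeff r i m * X m x)" if "i < p" for i
      using sum_innov_coeff[OF that] by (simp add: innovation_def)
    then have "(\<Sum>i<p. a i * innovation r X i x) = (\<Sum>i<p. \<Sum>m<p. a i * innov_coeff r i m * X m x)"
      by (auto intro!: sum.cong simp: sum_distrib_left mult.assoc)
    also have "\<dots> = (\<Sum>m<p. c m * X m x)"
      by (subst sum.swap) (simp add: c_def sum_distrib_right)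
    finally show ?thesis .
  qed
  have quad: "(\<Sum>l<p. \<Sum>m<p. c l * ar_cov r l m * c m) = (\<Sum>i<p. (a i)\<^sup>2)"
  proof -
    have "(\<Sum>l<p. \<Sum>m<p. c l * ar_cov r l m * c m) =
      (\<Sum>l<p. c l * (\<Sum>j<p. a j * (\<Sum>m<p. innov_coeff r j m * ar_cov r l m)))"
    proof (rule sum.cong[OF refl])
      fix l
      have "(\<Sum>j<p. a j * (\<Sum>m<p. innov_coeff r j m * ar_cov r l m)) = (\<Sum>j<p. \<Sum>m<p. a j * innov_coeff r j m * ar_cov r l m)"
        by (simp add: sum_distrib_left mult.assoc)
      also have "\<dots> = (\<Sum>m<p. c m * ar_cov r l m)" by (subst sum.swap) (simp add: c_def sum_distrib_right)
      finally show "(\<Sum>m<p. c l * ar_cov r l m * c m) = c l * (\<Sum>j<p. a j * (\<Sum>m<p. innov_coeff r j m * ar_cov r l m))"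
        by (simp add: sum_distrib_left ac_simps)
    qed
    also have "\<dots> = (\<Sum>j<p. a j * (\<Sum>l<p. c l * (\<Sum>m<p. innov_coeff r j m * ar_cov r l m)))"
      by (simp add: sum_distrib_left, subst sum.swap) (simp add: ac_simps)
    also have "\<dots> = (\<Sum>j<p. a j * a j)"
    proof (intro sum.cong refl arg_cong2[where f="(*)"])
      fix j assume j: "j \<in> {..<p}"
      have "(\<Sum>l<p. c l * (\<Sum>m<p. innov_coeff r j m * ar_cov r l m)) =
        (\<Sum>i<p. a i * (\<Sum>l<p. innov_coeff r i l * (\<Sum>m<p. innov_coeff r j m * ar_cov r l m)))"
        unfolding c_def sum_distrib_right by (subst sum.swap) (simp add: sum_distrib_left mult.assoc)
      also have "\<dots> = (\<Sum>i<p. a i * (if i = j then 1 else 0))"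
        using j by (intro sum.cong refl) (simp add: innov_coeff_orthonormal[OF r])
      also have "\<dots> = a j" using j by (simp add: if_distrib cong: if_cong)
      finally show "(\<Sum>l<p. c l * (\<Sum>m<p. innov_coeff r j m * ar_cov r l m)) = a j" .
    qed
    finally show ?thesis by (simp add: power2_eq_square)
  qed
  show ?thesis
  \<comment> \<open>The Gaussian hypothesis speaks only of nonzero coefficient vectors. If c
    vanishes, \<open>quad\<close> forces a to vanish too and both sides equal 1.\<close>
  proof (cases "\<exists>i<p. c i \<noteq> 0")
    case True
    have "\<exists>i<p. a i \<noteq> 0"
    proof (rule ccontr)
      assume "\<not> (\<exists>i<p. a i \<noteq> 0)"
      then have "c m = 0" for m unfolding c_def by (intro sum.neutral) auto
      with True show False by simp
    qed
    then have pos: "(\<Sum>i<p. (a i)\<^sup>2) > 0" by (auto intro!: sum_pos2)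
    have "distributed M lborel (\<lambda>x. \<Sum>i<p. c i * X i x) (normal_density 0 (sqrt (\<Sum>i<p. (a i)\<^sup>2)))"
      using assms(1) True quad unfolding centered_gaussian_vector_def by auto
    from expectation_iexp_normal[OF this] pos show ?thesis by (simp add: lin)
  next
    case False
    then have "(\<Sum>m<p. c m * X m x) = 0" for x by (intro sum.neutral) auto
    moreover have "(\<Sum>i<p. (a i)\<^sup>2) = 0"
      unfolding quad[symmetric] using False by (intro sum.neutral) auto
    ultimately show ?thesis by (simp add: lin prob_space)
  qed
qed

lemma (in prob_space) char_innovation_array:
  fixes X :: "nat \<Rightarrow> nat \<Rightarrow> 'a \<Rightarrow> real" and n p :: nat
  assumes g: "\<And>k. k < n \<Longrightarrow> centered_gaussian_vector M p (ar_cov r) (X k)"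
    and r: "0 \<le> r" "r < 1"
    and ind: "indep_vars (\<lambda>_. PiM {..<p} (\<lambda>_. borel)) (\<lambda>k \<omega>. \<lambda>i\<in>{..<p}. X k i \<omega>) {..<n}"
  shows "(LINT x|M. iexp (\<Sum>(k, i)\<in>{..<n} \<times> {..<p}. a (k, i) * innovation r (X k) i x))
    = of_real (exp (- (\<Sum>z\<in>{..<n} \<times> {..<p}. (a z)\<^sup>2) / 2))"
proof -
  \<comment> \<open>The factor of row k as a function of the row restricted to {..<p}, the object
    about which \<open>ind\<close> speaks.\<close>
  define G where "G = (\<lambda>k (v :: nat \<Rightarrow> real). iexp (\<Sum>i<p. a (k, i) * innovation r (\<lambda>i v. v i) i v))"
  have comp: "(\<lambda>v. v i) \<in> borel_measurable (PiM {..<p} (\<lambda>_. borel))" if "i < p" for i :: nat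
    using that by (intro measurable_component_singleton) simp
  have "(\<lambda>v. innovation r (\<lambda>i v. v i) i v) \<in> borel_measurable (PiM {..<p} (\<lambda>_. borel))" if "i < p" for i :: nat
    using comp[OF that] comp[of 0] comp[of "i - 1"] that unfolding innovation_def by (cases "i = 0") simp_all
  then have [measurable]: "(\<lambda>v. \<Sum>i<p. a (k, i) * innovation r (\<lambda>i v. v i) i v) \<in> borel_measurable (PiM {..<p} (\<lambda>_. borel))" for k
    by (intro borel_measurable_sum borel_measurable_times borel_measurable_const) auto
  have Gm: "G k \<in> borel_measurable (PiM {..<p} (\<lambda>_. borel))" for k
    unfolding G_def by measurable
  have Geq: "G k (\<lambda>i\<in>{..<p}. X k i x) = iexp (\<Sum>i<p. a (k, i) * innovation r (X k) i x)" for k x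
    unfolding G_def by (intro arg_cong[where f=iexp] sum.cong) (auto simp: innovation_def)
  have iv: "indep_vars (\<lambda>_. borel) (\<lambda>k x. iexp (\<Sum>i<p. a (k, i) * innovation r (X k) i x)) {..<n}"
    using indep_vars_compose2[OF ind, of G "\<lambda>_. borel"] Gm by (simp add: Geq)
  have "(LINT x|M. iexp (\<Sum>(k, i)\<in>{..<n} \<times> {..<p}. a (k, i) * innovation r (X k) i x))
    = (LINT x|M. (\<Prod>k<n. iexp (\<Sum>i<p. a (k, i) * innovation r (X k) i x)))"
  proof (rule Bochner_Integration.integral_cong[OF refl])
    fix x
    have pe: "iexp (\<Sum>k<n. g k) = (\<Prod>k<n. iexp (g k))" for g :: "nat \<Rightarrow> real"
      by (simp add: sum_distrib_left exp_sum)
    show "iexp (\<Sum>(k, i)\<in>{..<n} \<times> {..<p}. a (k, i) * innovation r (X k) i x)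
      = (\<Prod>k<n. iexp (\<Sum>i<p. a (k, i) * innovation r (X k) i x))"
      by (simp only: sum.cartesian_product[symmetric] pe)
  qed
  also have "\<dots> = (\<Prod>k<n. LINT x|M. iexp (\<Sum>i<p. a (k, i) * innovation r (X k) i x))"
  proof (rule indep_vars_lebesgue_integral[OF _ iv])
    fix k assume k: "k \<in> {..<n}"
    have "(\<lambda>x. iexp (\<Sum>i<p. a (k, i) * innovation r (X k) i x)) \<in> borel_measurable M"
      using iv k unfolding indep_vars_def by auto
    then show "integrable M (\<lambda>x. iexp (\<Sum>i<p. a (k, i) * innovation r (X k) i x))"
      by (intro integrable_const_bound[where B=1]) auto
  qed simp
  also have "\<dots> = (\<Prod>k<n. of_real (exp (- (\<Sum>i<p. (a (k, i))\<^sup>2) / 2)))"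
    by (intro prod.cong refl char_innovation g r) auto
  also have "\<dots> = of_real (exp (- (\<Sum>z\<in>{..<n} \<times> {..<p}. (a z)\<^sup>2) / 2))"
    by (simp add: exp_sum[symmetric] sum_negf sum_divide_distrib sum.cartesian_product split_def flip: of_real_prod)
  finally show ?thesis .
qed

section \<open>Gaussian tails and conditioning on an independent variable\<close>

definition gauss_tail :: "real \<Rightarrow> real" where
  "gauss_tail y = measure std_normal_distribution {y<..}"

lemma prob_space_std_normal: "prob_space std_normal_distribution"
  by (rule prob_space_normal_density) simp

lemma gauss_tail_nonneg: "0 \<le> gauss_tail y" by (simp add: gauss_tail_def)

lemma gauss_tail_nn_integral:
  "ennreal (gauss_tail y) = (\<integral>\<^sup>+x. ennreal (std_normal_density x) * indicator {y..} x \<partial>lborel)"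
proof -
  interpret prob_space std_normal_distribution by (rule prob_space_std_normal)
  have "ennreal (gauss_tail y) = emeasure std_normal_distribution {y<..}"
    by (simp add: gauss_tail_def emeasure_eq_measure)
  also have "\<dots> = (\<integral>\<^sup>+x. ennreal (std_normal_density x) * indicator {y<..} x \<partial>lborel)"
    by (rule emeasure_density) auto
  also have "\<dots> = (\<integral>\<^sup>+x. ennreal (std_normal_density x) * indicator {y..} x \<partial>lborel)"
    using AE_lborel_singleton[of y] by (intro nn_integral_cong_AE) (auto simp: indicator_def)
  finally show ?thesis .
qed

text \<open>The integrand is the exact derivative of -\<phi>(x)/x, with \<phi> the normal density.
  On {y..} it lies between \<phi>(x) and (1 + 1/y^2) \<phi>(x), which yields both Mills bounds
  below.\<close>

lemma mills_integral:
  assumes "0 < y"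
  shows "(\<integral>\<^sup>+x. ennreal (std_normal_density x * (1 + 1 / x\<^sup>2)) * indicator {y..} x \<partial>lborel)
    = ennreal (std_normal_density y / y)"
proof -
  have lim: "((\<lambda>x. - (std_normal_density x / x)) \<longlongrightarrow> 0) at_top"
    unfolding std_normal_density_def by real_asymp
  have "(\<integral>\<^sup>+x. ennreal (std_normal_density x * (1 + 1 / x\<^sup>2)) * indicator {y..} x \<partial>lborel)
    = ennreal (0 - (- (std_normal_density y / y)))"
  proof (rule nn_integral_FTC_atLeast[OF _ _ _ lim])
    fix x assume x: "y \<le> x"
    have "((\<lambda>x. exp (- x\<^sup>2 / 2)) has_real_derivative - x * exp (- x\<^sup>2 / 2)) (at x)"
      by (auto intro!: derivative_eq_intros)
    then show "((\<lambda>x. - (std_normal_density x / x)) has_real_derivative std_normal_density x * (1 + 1 / x\<^sup>2)) (at x)"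
    proof -
      assume *: "((\<lambda>x. exp (- x\<^sup>2 / 2)) has_real_derivative - x * exp (- x\<^sup>2 / 2)) (at x)"
      define c where "c = 1 / sqrt (2 * pi)"
      have "((\<lambda>x. - (c * exp (- x\<^sup>2 / 2) / x)) has_real_derivative
          - ((c * (- x * exp (- x\<^sup>2 / 2)) * x - c * exp (- x\<^sup>2 / 2) * 1) / (x * x))) (at x)"
        using x assms by (intro DERIV_minus DERIV_divide DERIV_cmult * DERIV_ident) auto
      moreover have "- ((c * (- x * exp (- x\<^sup>2 / 2)) * x - c * exp (- x\<^sup>2 / 2) * 1) / (x * x)) = c * exp (- x\<^sup>2 / 2) * (1 + 1 / x\<^sup>2)"
        using x assms by (simp add: field_simps power2_eq_square)
      ultimately show ?thesis unfolding std_normal_density_def c_def by simp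
    qed
  qed (use assms in auto)
  then show ?thesis by simp
qed

lemma gauss_tail_upper:
  assumes "0 < y"
  shows "gauss_tail y \<le> std_normal_density y / y"
proof -
  have "ennreal (gauss_tail y) \<le> ennreal (std_normal_density y / y)"
    unfolding gauss_tail_nn_integral mills_integral[OF assms, symmetric]
    by (intro nn_integral_mono mult_right_mono ennreal_leI) (auto simp: algebra_simps)
  then show ?thesis using assms by (subst (asm) ennreal_le_iff) auto
qed

lemma gauss_tail_lower:
  assumes "0 < y"
  shows "std_normal_density y / y \<le> (1 + 1 / y\<^sup>2) * gauss_tail y"
proof -
  have "ennreal (std_normal_density y / y) \<le> (\<integral>\<^sup>+x. ennreal (1 + 1 / y\<^sup>2) * (ennreal (std_normal_density x) * indicator {y..} x) \<partial>lborel)"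
    unfolding mills_integral[OF assms, symmetric]
  proof (intro nn_integral_mono)
    fix x :: real
    have "std_normal_density x * (1 + 1 / x\<^sup>2) \<le> (1 + 1 / y\<^sup>2) * std_normal_density x" if "y \<le> x"
    proof -
      have "1 / x\<^sup>2 \<le> 1 / y\<^sup>2" using that assms by (intro divide_left_mono power_mono) auto
      then show ?thesis by (simp add: mult.commute mult_left_mono)
    qed
    then show "ennreal (std_normal_density x * (1 + 1 / x\<^sup>2)) * indicator {y..} x
      \<le> ennreal (1 + 1 / y\<^sup>2) * (ennreal (std_normal_density x) * indicator {y..} x)"
      by (auto simp: indicator_def ennreal_mult'[symmetric] simp del: ennreal_plus intro!: ennreal_leI)
  qed
  also have "\<dots> = ennreal (1 + 1 / y\<^sup>2) * ennreal (gauss_tail y)"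
    unfolding gauss_tail_nn_integral by (rule nn_integral_cmult) auto
  also have "\<dots> = ennreal ((1 + 1 / y\<^sup>2) * gauss_tail y)"
    by (intro ennreal_mult'[symmetric]) (simp add: gauss_tail_nonneg)
  finally show ?thesis by (subst (asm) ennreal_le_iff) (auto simp: gauss_tail_nonneg)
qed

lemma gauss_tail_exp_bound:
  assumes "1 \<le> y"
  shows "gauss_tail y \<le> exp (- y\<^sup>2 / 2)"
proof -
  have "gauss_tail y \<le> std_normal_density y / y" using assms by (intro gauss_tail_upper) auto
  also have "\<dots> \<le> std_normal_density y" using assms mult_left_mono[of 1 y "std_normal_density y"] by (simp add: divide_le_eq)
  also have "\<dots> \<le> exp (- y\<^sup>2 / 2)"
  proof -
    have "1 \<le> sqrt (2 * pi)" using pi_gt3 by simp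
    then show ?thesis unfolding std_normal_density_def by (simp add: divide_le_eq mult_left_le)
  qed
  finally show ?thesis .
qed

text \<open>The moment generating function of a chi-square variable: the tilted density is \<sigma>
  times the centered normal density with variance 1/(1 - 2s).\<close>

lemma nn_integral_exp_square_normal:
  assumes "s < 1 / 2"
  shows "(\<integral>\<^sup>+x. ennreal (exp (s * x\<^sup>2)) \<partial>std_normal_distribution) = ennreal (1 / sqrt (1 - 2 * s))"
proof -
  define \<sigma> where "\<sigma> = 1 / sqrt (1 - 2 * s)"
  have s: "0 < 1 - 2 * s" using assms by simp
  then have \<sigma>: "0 < \<sigma>" by (simp add: \<sigma>_def)
  have \<sigma>2: "\<sigma>\<^sup>2 = 1 / (1 - 2 * s)" using s by (simp add: \<sigma>_def power_divide)
  have eq: "std_normal_density x * exp (s * x\<^sup>2) = \<sigma> * normal_density 0 \<sigma> x" for x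
  proof -
    have "exp (- x\<^sup>2 / 2) * exp (s * x\<^sup>2) = exp (- x\<^sup>2 / (2 * \<sigma>\<^sup>2))"
      unfolding \<sigma>2 by (simp add: exp_add[symmetric] field_simps)
    moreover have "sqrt (2 * pi * \<sigma>\<^sup>2) = sqrt (2 * pi) * \<sigma>" using \<sigma> by (simp add: real_sqrt_mult)
    ultimately show ?thesis using \<sigma> by (simp add: std_normal_density_def normal_density_def)
  qed
  interpret N: prob_space "density lborel (normal_density 0 \<sigma>)" by (rule prob_space_normal_density[OF \<sigma>])
  have one: "(\<integral>\<^sup>+x. ennreal (normal_density 0 \<sigma> x) \<partial>lborel) = 1"
    using N.emeasure_space_1 by (simp add: emeasure_density)
  have "(\<integral>\<^sup>+x. ennreal (exp (s * x\<^sup>2)) \<partial>std_normal_distribution)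
    = (\<integral>\<^sup>+x. ennreal (std_normal_density x) * ennreal (exp (s * x\<^sup>2)) \<partial>lborel)"
    by (rule nn_integral_density) auto
  also have "\<dots> = (\<integral>\<^sup>+x. ennreal \<sigma> * ennreal (normal_density 0 \<sigma> x) \<partial>lborel)"
    using \<sigma> by (simp add: ennreal_mult'[symmetric] eq)
  also have "\<dots> = ennreal \<sigma>" by (subst nn_integral_cmult) (auto simp: one)
  finally show ?thesis by (simp add: \<sigma>_def)
qed

text \<open>Conditioning on A in the form of Tonelli: by independence the joint law is a product, so
  A may be frozen at a value and integrated out. G is kept apart from K so that the inner
  probability need only be known for values in G.\<close>

lemma (in prob_space) emeasure_indep_cond:
  assumes iv: "indep_var S A T B" and [measurable]: "G \<in> sets S" "K \<in> sets (S \<Otimes>\<^sub>M T)"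
  shows "emeasure M {x\<in>space M. A x \<in> G \<and> (A x, B x) \<in> K}
    = (\<integral>\<^sup>+a. indicator G a * emeasure M {x\<in>space M. (a, B x) \<in> K} \<partial>distr M S A)"
proof -
  have [measurable]: "A \<in> M \<rightarrow>\<^sub>M S" "B \<in> M \<rightarrow>\<^sub>M T"
    and eq: "distr M S A \<Otimes>\<^sub>M distr M T B = distr M (S \<Otimes>\<^sub>M T) (\<lambda>x. (A x, B x))"
    using iv unfolding indep_var_distribution_eq by auto
  interpret B: prob_space "distr M T B" by (rule prob_space_distr) measurable
  have Km: "K \<inter> (G \<times> space T) \<in> sets (S \<Otimes>\<^sub>M T)" by measurable
  have "emeasure M {x\<in>space M. A x \<in> G \<and> (A x, B x) \<in> K}
    = emeasure (distr M (S \<Otimes>\<^sub>M T) (\<lambda>x. (A x, B x))) (K \<inter> (G \<times> space T))"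
    using measurable_space[of B M T]
    by (subst emeasure_distr) (auto intro!: arg_cong[where f="emeasure M"] Km)
  also have "\<dots> = (\<integral>\<^sup>+a. emeasure (distr M T B) (Pair a -` (K \<inter> (G \<times> space T))) \<partial>distr M S A)"
    unfolding eq[symmetric] using Km by (intro B.emeasure_pair_measure_alt) simp
  also have "\<dots> = (\<integral>\<^sup>+a. indicator G a * emeasure M {x\<in>space M. (a, B x) \<in> K} \<partial>distr M S A)"
  proof (rule nn_integral_cong)
    fix a
    have "Pair a -` (K \<inter> (G \<times> space T)) \<in> sets T" by (rule sets_Pair1[OF Km])
    then have "emeasure (distr M T B) (Pair a -` (K \<inter> (G \<times> space T)))
      = emeasure M (B -` (Pair a -` (K \<inter> (G \<times> space T))) \<inter> space M)"
      by (subst emeasure_distr) auto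
    also have "B -` (Pair a -` (K \<inter> (G \<times> space T))) \<inter> space M = (if a \<in> G then {x\<in>space M. (a, B x) \<in> K} else {})"
      using measurable_space[of B M T] by auto
    finally show "emeasure (distr M T B) (Pair a -` (K \<inter> (G \<times> space T))) = indicator G a * emeasure M {x\<in>space M. (a, B x) \<in> K}"
      by simp
  qed
  finally show ?thesis .
qed

lemma (in prob_space) prob_indep_cond_eq:
  assumes iv: "indep_var S A T B" and [measurable]: "G \<in> sets S" "K \<in> sets (S \<Otimes>\<^sub>M T)"
    and q: "\<And>a. a \<in> G \<Longrightarrow> prob {x\<in>space M. (a, B x) \<in> K} = q" and "0 \<le> q"
  shows "prob {x\<in>space M. A x \<in> G \<and> (A x, B x) \<in> K} = prob {x\<in>space M. A x \<in> G} * q"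
proof -
  have [measurable]: "A \<in> M \<rightarrow>\<^sub>M S" using iv unfolding indep_var_distribution_eq by auto
  have "emeasure M {x\<in>space M. A x \<in> G \<and> (A x, B x) \<in> K}
    = (\<integral>\<^sup>+a. ennreal q * indicator G a \<partial>distr M S A)"
    unfolding emeasure_indep_cond[OF assms(1-3)]
    by (intro nn_integral_cong) (auto simp: indicator_def emeasure_eq_measure q)
  also have "\<dots> = ennreal q * emeasure (distr M S A) G"
    by (subst nn_integral_cmult_indicator) auto
  also have "emeasure (distr M S A) G = emeasure M {x\<in>space M. A x \<in> G}"
    by (subst emeasure_distr) (auto intro!: arg_cong[where f="emeasure M"])
  finally show ?thesis using \<open>0 \<le> q\<close>
    by (simp add: emeasure_eq_measure ennreal_mult'[symmetric] mult.commute)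
qed

lemma (in prob_space) prob_indep_cond_le:
  assumes iv: "indep_var S A T B" and [measurable]: "G \<in> sets S" "K \<in> sets (S \<Otimes>\<^sub>M T)"
    and q: "\<And>a. a \<in> G \<Longrightarrow> prob {x\<in>space M. (a, B x) \<in> K} \<le> q" and "0 \<le> q"
  shows "prob {x\<in>space M. A x \<in> G \<and> (A x, B x) \<in> K} \<le> q"
proof -
  have [measurable]: "A \<in> M \<rightarrow>\<^sub>M S" using iv unfolding indep_var_distribution_eq by auto
  interpret A: prob_space "distr M S A" by (rule prob_space_distr) measurable
  have "emeasure M {x\<in>space M. A x \<in> G \<and> (A x, B x) \<in> K} \<le> (\<integral>\<^sup>+a. ennreal q \<partial>distr M S A)"
    unfolding emeasure_indep_cond[OF assms(1-3)]
    by (intro nn_integral_mono) (auto simp: indicator_def emeasure_eq_measure q intro!: ennreal_leI)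
  also have "\<dots> = ennreal q" using A.emeasure_space_1 by simp
  finally show ?thesis using \<open>0 \<le> q\<close> by (simp add: emeasure_eq_measure)
qed

section \<open>Arrays of independent standard Gaussian variables\<close>

text \<open>
The zero vector gets the first unit vector as its direction, so that the conditional law of a projection is exactly
standard normal for every value of the conditioning column.
\<close>

definition unit_dir :: "nat \<Rightarrow> (nat \<Rightarrow> real) \<Rightarrow> nat \<Rightarrow> real" where
  "unit_dir n v k = (if (\<Sum>l<n. (v l)\<^sup>2) = 0 then (if k = 0 then 1 else 0) else v k / sqrt (\<Sum>l<n. (v l)\<^sup>2))"

lemma sum_unit_dir:
  assumes "0 < n"
  shows "(\<Sum>k<n. (unit_dir n v k)\<^sup>2) = 1"
proof (cases "(\<Sum>l<n. (v l)\<^sup>2) = 0")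
  case True
  then have "(\<Sum>k<n. (unit_dir n v k)\<^sup>2) = (\<Sum>k<n. if k = 0 then 1 else 0)"
    by (intro sum.cong) (auto simp: unit_dir_def)
  then show ?thesis using assms by simp
next
  case False
  have "0 \<le> (\<Sum>l<n. (v l)\<^sup>2)" by (intro sum_nonneg) auto
  then show ?thesis using False by (simp add: unit_dir_def power_divide flip: sum_divide_distrib)
qed

lemma unit_dir_inner:
  assumes "(\<Sum>l<n. (v l)\<^sup>2) \<noteq> 0"
  shows "(\<Sum>k<n. unit_dir n v k * w k) = (\<Sum>k<n. v k * w k) / sqrt (\<Sum>l<n. (v l)\<^sup>2)"
  using assms by (simp add: unit_dir_def sum_divide_distrib)

lemma unit_dir_measurable:
  assumes "\<And>k. k < n \<Longrightarrow> (\<lambda>x. f x k) \<in> borel_measurable N" "k < n"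
  shows "(\<lambda>x. unit_dir n (f x) k) \<in> borel_measurable N"
proof -
  note [measurable] = assms(1)
  have [measurable]: "(\<lambda>x. f x k) \<in> borel_measurable N" by (rule assms)+
  have [measurable]: "(\<lambda>x. \<Sum>l<n. (f x l)\<^sup>2) \<in> borel_measurable N"
    by (intro borel_measurable_sum borel_measurable_power assms) auto
  show ?thesis unfolding unit_dir_def by measurable
qed

text \<open>Independence and normality of the entries are encoded by the joint characteristic
  function, the form in which \<open>char_innovation_array\<close> delivers them. The first index is
  the observation, the second the column.\<close>

locale gaussian_array = prob_space M for M :: "'a measure" +
  fixes n p :: nat and Z :: "nat \<Rightarrow> nat \<Rightarrow> 'a \<Rightarrow> real"
  assumes n_pos: "0 < n"
    and meas: "\<And>k i. k < n \<Longrightarrow> i < p \<Longrightarrow> Z k i \<in> borel_measurable M"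
    and char: "\<And>a. (LINT x|M. iexp (\<Sum>(k, i)\<in>{..<n} \<times> {..<p}. a (k, i) * Z k i x))
        = of_real (exp (- (\<Sum>z\<in>{..<n} \<times> {..<p}. (a z)\<^sup>2) / 2))"
begin

definition proj :: "nat \<Rightarrow> nat \<Rightarrow> 'a \<Rightarrow> real" where
  "proj i j x = (\<Sum>k<n. unit_dir n (\<lambda>k. Z k i x) k * Z k j x)"

text \<open>Given the columns before j, this is the correlation of \<open>proj i j\<close> and
  \<open>proj l j\<close> when read with l in place of the second index.\<close>

definition cosine :: "nat \<Rightarrow> nat \<Rightarrow> 'a \<Rightarrow> real" where
  "cosine i j x = (\<Sum>k<n. unit_dir n (\<lambda>k. Z k i x) k * unit_dir n (\<lambda>k. Z k j x) k)"

definition sqnorm :: "nat \<Rightarrow> 'a \<Rightarrow> real" where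
  "sqnorm j x = (\<Sum>k<n. (Z k j x)\<^sup>2)"

text \<open>The columns before j, like the single column below, are a function on index pairs:
  restricting one independent family to disjoint index sets then gives independent blocks.\<close>

definition past :: "nat \<Rightarrow> 'a \<Rightarrow> nat \<times> nat \<Rightarrow> real" where
  "past j x = (\<lambda>z\<in>{..<n} \<times> {..<j}. Z (fst z) (snd z) x)"

abbreviation past_space :: "nat \<Rightarrow> (nat \<times> nat \<Rightarrow> real) measure" where
  "past_space j \<equiv> PiM ({..<n} \<times> {..<j}) (\<lambda>_. borel)"

definition column :: "nat \<Rightarrow> 'a \<Rightarrow> nat \<times> nat \<Rightarrow> real" where
  "column j x = (\<lambda>z\<in>{..<n} \<times> {j}. Z (fst z) (snd z) x)"

abbreviation column_space :: "nat \<Rightarrow> (nat \<times> nat \<Rightarrow> real) measure" where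
  "column_space j \<equiv> PiM ({..<n} \<times> {j}) (\<lambda>_. borel)"

lemma char': "(LINT x|M. iexp (\<Sum>z\<in>{..<n} \<times> {..<p}. a z * Z (fst z) (snd z) x))
        = of_real (exp (- (\<Sum>z\<in>{..<n} \<times> {..<p}. (a z)\<^sup>2) / 2))"
  using char[of a] by (simp only: split_def prod.collapse)

lemma indep_entries:
  assumes "0 < p"
  shows "indep_vars (\<lambda>_. borel) (\<lambda>z. Z (fst z) (snd z)) ({..<n} \<times> {..<p})"
  using n_pos assms meas by (intro iid_normal_of_char char') auto

lemma indep_past_column:
  assumes "j < p"
  shows "indep_var (past_space j) (past j) (column_space j) (column j)"
proof -
  have "indep_var (PiM ({..<n} \<times> {..<j}) (\<lambda>_. borel)) (\<lambda>x. restrict (\<lambda>z. Z (fst z) (snd z) x) ({..<n} \<times> {..<j}))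
    (PiM ({..<n} \<times> {j}) (\<lambda>_. borel)) (\<lambda>x. restrict (\<lambda>z. Z (fst z) (snd z) x) ({..<n} \<times> {j}))"
    using assms by (intro indep_var_restrict[OF indep_entries]) auto
  then show ?thesis unfolding past_def column_def .
qed

lemma past_measurable: "j < p \<Longrightarrow> past j \<in> M \<rightarrow>\<^sub>M past_space j"
  using indep_past_column unfolding indep_var_distribution_eq by blast

lemma unit_column_normal:
  assumes "j < p" "(\<Sum>k<n. (u k)\<^sup>2) = 1"
  shows "distr M borel (\<lambda>x. \<Sum>k<n. u k * Z k j x) = std_normal_distribution"
proof -
  define w where "w = (\<lambda>z::nat \<times> nat. if snd z = j then u (fst z) else 0)"
  have "distr M borel (\<lambda>x. \<Sum>z\<in>{..<n} \<times> {..<p}. w z * Z (fst z) (snd z) x) = std_normal_distribution"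
  proof (rule unit_combination_normal)
    have "(\<Sum>z\<in>{..<n} \<times> {..<p}. (w z)\<^sup>2) = (\<Sum>k<n. \<Sum>i<p. (w (k, i))\<^sup>2)"
      by (simp add: sum.cartesian_product)
    also have "\<dots> = (\<Sum>k<n. (u k)\<^sup>2)"
      using assms(1) by (simp add: w_def if_distrib[of "\<lambda>c. c\<^sup>2"] cong: if_cong)
    finally show "(\<Sum>z\<in>{..<n} \<times> {..<p}. (w z)\<^sup>2) = 1" using assms(2) by simp
  qed (use meas char' in auto)
  moreover have "(\<Sum>z\<in>{..<n} \<times> {..<p}. w z * Z (fst z) (snd z) x) = (\<Sum>k<n. u k * Z k j x)" for x
  proof -
    have "(\<Sum>z\<in>{..<n} \<times> {..<p}. w z * Z (fst z) (snd z) x) = (\<Sum>k<n. \<Sum>i<p. w (k, i) * Z k i x)"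
      by (simp add: sum.cartesian_product split_def)
    also have "\<dots> = (\<Sum>k<n. u k * Z k j x)"
      using assms(1) by (simp add: w_def if_distrib[of "\<lambda>c. c * _"] cong: if_cong)
    finally show ?thesis .
  qed
  ultimately show ?thesis by simp
qed

lemma unit_column_measurable: "j < p \<Longrightarrow> (\<lambda>x. \<Sum>k<n. u k * Z k j x) \<in> borel_measurable M"
  by (intro borel_measurable_sum borel_measurable_times borel_measurable_const meas) auto

lemma unit_column_tail:
  assumes "j < p" "(\<Sum>k<n. (u k)\<^sup>2) = 1"
  shows "prob {x\<in>space M. y < (\<Sum>k<n. u k * Z k j x)} = gauss_tail y"
proof -
  have "gauss_tail y = measure (distr M borel (\<lambda>x. \<Sum>k<n. u k * Z k j x)) {y<..}"
    unfolding unit_column_normal[OF assms] gauss_tail_def ..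
  also have "\<dots> = prob {x\<in>space M. y < (\<Sum>k<n. u k * Z k j x)}"
    by (subst measure_distr) (auto intro!: unit_column_measurable assms arg_cong[where f=prob])
  finally show ?thesis ..
qed

text \<open>A joint exceedance forces the single Gaussian variable with coefficients y u + y' v
  above S = y^2 + y'^2, while its variance V is at most S (1 + \<delta>). The one-dimensional tail
  at S / sqrt V then replaces a bivariate estimate; weights equal to the thresholds make the
  exponent sharp for small \<delta>.\<close>

lemma two_columns_tail:
  assumes j: "j < p" and u: "(\<Sum>k<n. (u k)\<^sup>2) = 1" and v: "(\<Sum>k<n. (v k)\<^sup>2) = 1"
    and c: "(\<Sum>k<n. u k * v k) \<le> \<delta>" and d: "0 \<le> \<delta>" "\<delta> \<le> 1" and y: "1 \<le> y" "1 \<le> y'"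
  shows "prob {x\<in>space M. y < (\<Sum>k<n. u k * Z k j x) \<and> y' < (\<Sum>k<n. v k * Z k j x)}
    \<le> exp (- (y\<^sup>2 + y'\<^sup>2) / (2 * (1 + \<delta>)))"
proof -
  define S where "S = y\<^sup>2 + y'\<^sup>2"
  define w where "w = (\<lambda>k. y * u k + y' * v k)"
  define V where "V = (\<Sum>k<n. (w k)\<^sup>2)"
  have "1 \<le> y\<^sup>2" "1 \<le> y'\<^sup>2" using y by auto
  then have S: "2 \<le> S" by (simp add: S_def)
  have "V = (\<Sum>k<n. y\<^sup>2 * (u k)\<^sup>2 + y'\<^sup>2 * (v k)\<^sup>2 + 2 * y * y' * (u k * v k))"
    unfolding V_def w_def by (intro sum.cong) (auto simp: power2_eq_square algebra_simps)
  also have "\<dots> = S + 2 * y * y' * (\<Sum>k<n. u k * v k)"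
    by (simp add: sum.distrib sum_distrib_left[symmetric] u v S_def)
  also have "\<dots> \<le> S + 2 * y * y' * \<delta>" using c y by (intro add_left_mono mult_left_mono) auto
  also have "\<dots> \<le> S + S * \<delta>"
    using d sum_squares_bound[of y y'] by (intro add_left_mono mult_right_mono) (auto simp: S_def)
  finally have V: "V \<le> S * (1 + \<delta>)" by (simp add: algebra_simps)
  have wZ: "S < (\<Sum>k<n. w k * Z k j x)"
    if "y < (\<Sum>k<n. u k * Z k j x)" "y' < (\<Sum>k<n. v k * Z k j x)" for x
  proof -
    have "S = y * y + y' * y'" by (simp add: S_def power2_eq_square)
    also have "\<dots> < y * (\<Sum>k<n. u k * Z k j x) + y' * (\<Sum>k<n. v k * Z k j x)"
      using that y by (intro add_strict_mono mult_strict_left_mono) auto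
    also have "\<dots> = (\<Sum>k<n. w k * Z k j x)"
      by (simp add: w_def sum_distrib_left sum.distrib[symmetric] algebra_simps)
    finally show ?thesis .
  qed
  have "0 \<le> V" unfolding V_def by (intro sum_nonneg) auto
  show ?thesis
  \<comment> \<open>The combination may degenerate, as for v = -u and y = y'. It is then identically
    0, while a joint exceedance would push it above S, so the event is empty.\<close>
  proof (cases "V = 0")
    case True
    then have "w k = 0" if "k < n" for k
      using that unfolding V_def by (subst (asm) sum_nonneg_eq_0_iff) auto
    then have "(\<Sum>k<n. w k * Z k j x) = 0" for x by (intro sum.neutral) auto
    then have "{x\<in>space M. y < (\<Sum>k<n. u k * Z k j x) \<and> y' < (\<Sum>k<n. v k * Z k j x)} = {}"
      using wZ S by force
    then show ?thesis unfolding \<open>_ = {}\<close> by simp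
  next
    case False
    then have V0: "0 < V" using \<open>0 \<le> V\<close> by simp
    define z where "z = S / sqrt V"
    have z2: "S / (1 + \<delta>) \<le> z\<^sup>2"
    proof -
      have "S * V \<le> S * (S * (1 + \<delta>))" using V S by (intro mult_left_mono) auto
      then show ?thesis using V0 d S by (simp add: z_def power_divide field_simps power2_eq_square)
    qed
    \<comment> \<open>Here S \<ge> 2 and \<delta> \<le> 1 meet: they place the normalized threshold
      z in the range where \<open>gauss_tail_exp_bound\<close> applies.\<close>
    moreover have "1 \<le> S / (1 + \<delta>)" using S d by (simp add: field_simps)
    ultimately have "1 \<le> z\<^sup>2" by linarith
    moreover have "0 \<le> z" using S V0 by (simp add: z_def)
    ultimately have z1: "1 \<le> z" using power2_le_imp_le[of 1 z] by simp
    have "prob {x\<in>space M. y < (\<Sum>k<n. u k * Z k j x) \<and> y' < (\<Sum>k<n. v k * Z k j x)}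
      \<le> prob {x\<in>space M. z < (\<Sum>k<n. w k / sqrt V * Z k j x)}"
    proof (intro finite_measure_mono)
      show "{x\<in>space M. z < (\<Sum>k<n. w k / sqrt V * Z k j x)} \<in> events"
        using unit_column_measurable[OF j, of "\<lambda>k. w k / sqrt V"] by measurable
      show "{x\<in>space M. y < (\<Sum>k<n. u k * Z k j x) \<and> y' < (\<Sum>k<n. v k * Z k j x)}
        \<subseteq> {x\<in>space M. z < (\<Sum>k<n. w k / sqrt V * Z k j x)}"
        using wZ V0 by (auto simp: z_def sum_divide_distrib[symmetric] divide_strict_right_mono)
    qed
    also have "\<dots> = gauss_tail z"
      using V0 by (intro unit_column_tail[OF j]) (auto simp: power_divide sum_divide_distrib[symmetric] V_def[symmetric])
    also have "\<dots> \<le> exp (- z\<^sup>2 / 2)" using z1 by (rule gauss_tail_exp_bound)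
    also have "\<dots> \<le> exp (- S / (2 * (1 + \<delta>)))"
    proof -
      have "S / (2 * (1 + \<delta>)) = S / (1 + \<delta>) / 2" by simp
      also have "\<dots> \<le> z\<^sup>2 / 2" using z2 by (rule divide_right_mono) simp
      finally show ?thesis by (simp only: exp_le_cancel_iff minus_divide_left[symmetric] neg_le_iff_le)
    qed
    finally show ?thesis by (simp add: S_def)
  qed
qed

lemma past_coordinate: "k < n \<Longrightarrow> i < j \<Longrightarrow> past j x (k, i) = Z k i x"
  by (simp add: past_def)

lemma column_coordinate: "k < n \<Longrightarrow> column j x (k, j) = Z k j x"
  by (simp add: column_def)

lemma unit_dir_cong: "(\<And>k. k < n \<Longrightarrow> f k = g k) \<Longrightarrow> k < n \<Longrightarrow> unit_dir n f k = unit_dir n g k"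
proof -
  assume eq: "\<And>k. k < n \<Longrightarrow> f k = g k" and k: "k < n"
  have "(\<Sum>l<n. (f l)\<^sup>2) = (\<Sum>l<n. (g l)\<^sup>2)" using eq by (intro sum.cong) auto
  then show ?thesis unfolding unit_dir_def using eq[OF k] by simp
qed

lemma past_coordinate_measurable:
  "k < n \<Longrightarrow> i < j \<Longrightarrow> (\<lambda>a. a (k, i)) \<in> borel_measurable (past_space j)"
  by (intro measurable_component_singleton) auto

lemma past_unit_dir_measurable:
  "k < n \<Longrightarrow> i < j \<Longrightarrow> (\<lambda>a. unit_dir n (\<lambda>k. a (k, i)) k) \<in> borel_measurable (past_space j)"
  by (intro unit_dir_measurable past_coordinate_measurable) auto

lemma past_proj_measurable:
  assumes "i < j"
  shows "(\<lambda>(a, b). \<Sum>k<n. unit_dir n (\<lambda>k. a (k, i)) k * b (k, j)) \<in> borel_measurable (past_space j \<Otimes>\<^sub>M column_space j)"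
  unfolding split_def
proof (intro borel_measurable_sum borel_measurable_times)
  fix k assume "k \<in> {..<n}"
  then show "(\<lambda>x. unit_dir n (\<lambda>k. fst x (k, i)) k) \<in> borel_measurable (past_space j \<Otimes>\<^sub>M column_space j)"
    using assms by (intro measurable_compose[OF measurable_fst past_unit_dir_measurable]) auto
  show "(\<lambda>x. snd x (k, j)) \<in> borel_measurable (past_space j \<Otimes>\<^sub>M column_space j)"
    using \<open>k \<in> {..<n}\<close> by (intro measurable_compose[OF measurable_snd measurable_component_singleton]) auto
qed

lemma proj_past:
  assumes "i < j"
  shows "(\<Sum>k<n. unit_dir n (\<lambda>k. past j x (k, i)) k * column j x (k, j)) = proj i j x"
  unfolding proj_def using assms
  by (intro sum.cong refl arg_cong2[where f="(*)"] unit_dir_cong) (auto simp: past_coordinate column_coordinate)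

lemma proj_column:
  assumes "i < j"
  shows "(\<Sum>k<n. unit_dir n (\<lambda>k. a (k, i)) k * column j x (k, j)) = (\<Sum>k<n. unit_dir n (\<lambda>k. a (k, i)) k * Z k j x)"
  by (intro sum.cong refl arg_cong2[where f="(*)"]) (auto simp: column_coordinate)

text \<open>Once the past is frozen the direction of column i is a fixed unit vector, so the signed
  projection is standard normal whatever the past was; hence an exact product. The sign c serves the
  two tails of the absolute value.\<close>

lemma prob_past_signed_proj:
  assumes "i < j" "j < p" and G: "G \<in> sets (past_space j)" and c: "c\<^sup>2 = 1"
  shows "prob {x\<in>space M. past j x \<in> G \<and> y < c * proj i j x} = prob {x\<in>space M. past j x \<in> G} * gauss_tail y"
proof -
  define F where "F = (\<lambda>ab :: (nat \<times> nat \<Rightarrow> real) \<times> (nat \<times> nat \<Rightarrow> real). \<Sum>k<n. unit_dir n (\<lambda>k. fst ab (k, i)) k * snd ab (k, j))"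
  have F: "F \<in> borel_measurable (past_space j \<Otimes>\<^sub>M column_space j)"
    using past_proj_measurable[OF assms(1)] by (simp add: F_def split_def)
  define K where "K = {ab\<in>space (past_space j \<Otimes>\<^sub>M column_space j). y < c * F ab}"
  have K: "K \<in> sets (past_space j \<Otimes>\<^sub>M column_space j)" unfolding K_def using F by measurable
  have iv: "indep_var (past_space j) (past j) (column_space j) (column j)" by (rule indep_past_column[OF assms(2)])
  have cm: "column j \<in> M \<rightarrow>\<^sub>M column_space j" using iv unfolding indep_var_distribution_eq by blast
  have sp: "(a, column j x) \<in> space (past_space j \<Otimes>\<^sub>M column_space j)" if "a \<in> space (past_space j)" "x \<in> space M" for a x
    using that measurable_space[OF cm] by (simp add: space_pair_measure)
  have "prob {x\<in>space M. past j x \<in> G \<and> (past j x, column j x) \<in> K} = prob {x\<in>space M. past j x \<in> G} * gauss_tail y"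
  proof (rule prob_indep_cond_eq[OF iv G K _ gauss_tail_nonneg])
    fix a assume "a \<in> G"
    then have a: "a \<in> space (past_space j)" using G sets.sets_into_space by blast
    have "{x\<in>space M. (a, column j x) \<in> K} = {x\<in>space M. y < (\<Sum>k<n. (c * unit_dir n (\<lambda>k. a (k, i)) k) * Z k j x)}"
    proof -
      have "c * F (a, column j x) = (\<Sum>k<n. (c * unit_dir n (\<lambda>k. a (k, i)) k) * Z k j x)" for x
        by (simp add: F_def proj_column[OF assms(1)]) (simp add: sum_distrib_left mult.assoc)
      then show ?thesis using sp[OF a] by (auto simp: K_def)
    qed
    moreover have "(\<Sum>k<n. (c * unit_dir n (\<lambda>k. a (k, i)) k)\<^sup>2) = 1"
      by (simp add: power_mult_distrib c sum_unit_dir[OF n_pos])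
    ultimately show "prob {x\<in>space M. (a, column j x) \<in> K} = gauss_tail y"
      using unit_column_tail[OF assms(2)] by simp
  qed
  moreover have "{x\<in>space M. past j x \<in> G \<and> (past j x, column j x) \<in> K} = {x\<in>space M. past j x \<in> G \<and> y < c * proj i j x}"
    using sp measurable_space[OF past_measurable[OF assms(2)]]
    by (auto simp: K_def F_def proj_past[OF assms(1)])
  ultimately show ?thesis by simp
qed

lemma prob_past_proj:
  assumes "i < j" "j < p" "G \<in> sets (past_space j)"
  shows "prob {x\<in>space M. past j x \<in> G \<and> y < proj i j x} = prob {x\<in>space M. past j x \<in> G} * gauss_tail y"
  using prob_past_signed_proj[OF assms, of 1] by simp

lemma cosine_measurable:
  assumes "i < p" "j < p"
  shows "cosine i j \<in> borel_measurable M"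
  unfolding cosine_def using assms
  by (intro borel_measurable_sum borel_measurable_times unit_dir_measurable meas) auto

lemma proj_measurable:
  assumes "i < p" "j < p"
  shows "proj i j \<in> borel_measurable M"
  unfolding proj_def using assms
  by (intro borel_measurable_sum borel_measurable_times unit_dir_measurable meas) auto

lemma sqnorm_measurable:
  assumes "j < p"
  shows "sqnorm j \<in> borel_measurable M"
  unfolding sqnorm_def using assms
  by (intro borel_measurable_sum borel_measurable_power meas) auto

text \<open>Whether the two directions have cosine at most \<delta> is decided by the past. On that
  event the two-column bound applies conditionally; the complement is paid for by its
  probability.\<close>

lemma prob_two_proj:
  assumes il: "i < j" "l < j" and j: "j < p"
    and d: "0 \<le> \<delta>" "\<delta> \<le> 1" and y: "1 \<le> y" "1 \<le> y'"
  shows "prob {x\<in>space M. y < proj i j x \<and> y' < proj l j x}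
    \<le> prob {x\<in>space M. \<delta> < cosine i l x} + exp (- (y\<^sup>2 + y'\<^sup>2) / (2 * (1 + \<delta>)))"
proof -
  define F where "F = (\<lambda>i (ab :: (nat \<times> nat \<Rightarrow> real) \<times> (nat \<times> nat \<Rightarrow> real)). \<Sum>k<n. unit_dir n (\<lambda>k. fst ab (k, i)) k * snd ab (k, j))"
  have F: "F i \<in> borel_measurable (past_space j \<Otimes>\<^sub>M column_space j)" if "i < j" for i
    using past_proj_measurable[OF that] by (simp add: F_def split_def)
  define C where "C = (\<lambda>a :: nat \<times> nat \<Rightarrow> real. \<Sum>k<n. unit_dir n (\<lambda>k. a (k, i)) k * unit_dir n (\<lambda>k. a (k, l)) k)"
  have C: "C \<in> borel_measurable (past_space j)"
    unfolding C_def using il by (intro borel_measurable_sum borel_measurable_times past_unit_dir_measurable) auto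
  have Ceq: "C (past j x) = cosine i l x" for x
    unfolding C_def cosine_def using il
    by (intro sum.cong refl arg_cong2[where f="(*)"] unit_dir_cong) (auto simp: past_coordinate)
  define G where "G = {a\<in>space (past_space j). C a \<le> \<delta>}"
  have G: "G \<in> sets (past_space j)" unfolding G_def using C by measurable
  define K where "K = {ab\<in>space (past_space j \<Otimes>\<^sub>M column_space j). y < F i ab \<and> y' < F l ab}"
  have K: "K \<in> sets (past_space j \<Otimes>\<^sub>M column_space j)" unfolding K_def using F[OF il(1)] F[OF il(2)] by measurable
  have iv: "indep_var (past_space j) (past j) (column_space j) (column j)" by (rule indep_past_column[OF j])
  have cm: "column j \<in> M \<rightarrow>\<^sub>M column_space j" using iv unfolding indep_var_distribution_eq by blast
  have sp: "(a, column j x) \<in> space (past_space j \<Otimes>\<^sub>M column_space j)" if "a \<in> space (past_space j)" "x \<in> space M" for a x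
    using that measurable_space[OF cm] by (simp add: space_pair_measure)
  have le: "prob {x\<in>space M. past j x \<in> G \<and> (past j x, column j x) \<in> K} \<le> exp (- (y\<^sup>2 + y'\<^sup>2) / (2 * (1 + \<delta>)))"
  proof (rule prob_indep_cond_le[OF iv G K])
    fix a assume a': "a \<in> G"
    then have a: "a \<in> space (past_space j)" using G sets.sets_into_space by blast
    have "{x\<in>space M. (a, column j x) \<in> K} = {x\<in>space M. y < (\<Sum>k<n. unit_dir n (\<lambda>k. a (k, i)) k * Z k j x)
        \<and> y' < (\<Sum>k<n. unit_dir n (\<lambda>k. a (k, l)) k * Z k j x)}"
      using sp[OF a] by (auto simp: K_def F_def proj_column[OF il(1)] proj_column[OF il(2)])
    then show "prob {x\<in>space M. (a, column j x) \<in> K} \<le> exp (- (y\<^sup>2 + y'\<^sup>2) / (2 * (1 + \<delta>)))"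
      using two_columns_tail[OF j sum_unit_dir[OF n_pos] sum_unit_dir[OF n_pos] _ d y, of "\<lambda>k. a (k, i)" "\<lambda>k. a (k, l)"] a'
      by (simp add: G_def C_def)
  qed simp
  have ev: "{x\<in>space M. past j x \<in> G \<and> (past j x, column j x) \<in> K} \<in> events"
    using past_measurable[OF j] cm G K by measurable
  have ev2: "{x\<in>space M. \<delta> < cosine i l x} \<in> events"
  proof -
    have [measurable]: "cosine i l \<in> borel_measurable M" using il j by (intro cosine_measurable) auto
    show ?thesis by measurable
  qed
  have "{x\<in>space M. y < proj i j x \<and> y' < proj l j x}
    \<subseteq> {x\<in>space M. \<delta> < cosine i l x} \<union> {x\<in>space M. past j x \<in> G \<and> (past j x, column j x) \<in> K}"
    using sp measurable_space[OF past_measurable[OF j]]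
    by (auto simp: K_def F_def G_def Ceq proj_past[OF il(1)] proj_past[OF il(2)])
  then have "prob {x\<in>space M. y < proj i j x \<and> y' < proj l j x}
    \<le> prob ({x\<in>space M. \<delta> < cosine i l x} \<union> {x\<in>space M. past j x \<in> G \<and> (past j x, column j x) \<in> K})"
    using ev ev2 by (intro finite_measure_mono) auto
  also have "\<dots> \<le> prob {x\<in>space M. \<delta> < cosine i l x} + prob {x\<in>space M. past j x \<in> G \<and> (past j x, column j x) \<in> K}"
    by (rule measure_Un_le[OF ev2 ev])
  finally show ?thesis using le by linarith
qed

section \<open>Concentration of the column norms and tails of the projections\<close>

lemma entry_normal:
  assumes "k < n" "j < p"
  shows "distr M borel (Z k j) = std_normal_distribution"
proof -
  have "(\<Sum>l<n. (if l = k then 1 else 0 :: real) * Z l j x) = Z k j x" for x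
    using assms(1) by (simp add: if_distrib[of "\<lambda>c. c * _"] cong: if_cong)
  moreover have "(\<Sum>l<n. (if l = k then 1 else 0 :: real)\<^sup>2) = 1"
    using assms(1) by (simp add: if_distrib[of "\<lambda>c. c\<^sup>2"] cong: if_cong)
  ultimately show ?thesis using unit_column_normal[OF assms(2), of "\<lambda>l. if l = k then 1 else 0"] by simp
qed

lemma nn_integral_exp_sqnorm:
  assumes "j < p" "s < 1 / 2"
  shows "(\<integral>\<^sup>+x. ennreal (exp (s * sqnorm j x)) \<partial>M) = ennreal ((1 / sqrt (1 - 2 * s)) ^ n)"
proof -
  have iv: "indep_vars (\<lambda>_. borel) (\<lambda>z. Z (fst z) (snd z)) ({..<n} \<times> {j})"
    using assms by (intro indep_vars_subset[OF indep_entries]) auto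
  have "(\<integral>\<^sup>+x. ennreal (exp (s * sqnorm j x)) \<partial>M)
    = (\<integral>\<^sup>+x. (\<Prod>z\<in>{..<n} \<times> {j}. ennreal (exp (s * (Z (fst z) (snd z) x)\<^sup>2))) \<partial>M)"
    by (simp add: sqnorm_def sum_distrib_left exp_sum prod_ennreal prod.cartesian_product')
  also have "\<dots> = (\<Prod>z\<in>{..<n} \<times> {j}. \<integral>\<^sup>+x. ennreal (exp (s * (Z (fst z) (snd z) x)\<^sup>2)) \<partial>M)"
    by (intro indep_vars_nn_integral indep_vars_compose2[OF iv]) auto
  also have "\<dots> = (\<Prod>k<n. \<integral>\<^sup>+x. ennreal (exp (s * (Z k j x)\<^sup>2)) \<partial>M)"
    by (simp add: prod.cartesian_product')
  also have "\<dots> = (\<Prod>k<n. ennreal (1 / sqrt (1 - 2 * s)))"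
  proof (rule prod.cong[OF refl])
    fix k assume "k \<in> {..<n}"
    then have k: "k < n" by simp
    have "(\<integral>\<^sup>+x. ennreal (exp (s * (Z k j x)\<^sup>2)) \<partial>M) = (\<integral>\<^sup>+y. ennreal (exp (s * y\<^sup>2)) \<partial>distr M borel (Z k j))"
      by (subst nn_integral_distr[OF meas[OF k assms(1)]]) auto
    then show "(\<integral>\<^sup>+x. ennreal (exp (s * (Z k j x)\<^sup>2)) \<partial>M) = ennreal (1 / sqrt (1 - 2 * s))"
      using nn_integral_exp_square_normal[OF assms(2)] by (simp add: entry_normal[OF k assms(1)])
  qed
  also have "\<dots> = ennreal ((1 / sqrt (1 - 2 * s)) ^ n)"
    using assms(2) by (simp add: prod_ennreal[symmetric] ennreal_power)
  finally show ?thesis .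
qed

lemma prob_exp_markov:
  assumes [measurable]: "U \<in> borel_measurable M"
  shows "ennreal (prob {x\<in>space M. t \<le> U x}) \<le> ennreal (exp (- t)) * (\<integral>\<^sup>+x. ennreal (exp (U x)) \<partial>M)"
proof -
  have "ennreal (prob {x\<in>space M. t \<le> U x}) = (\<integral>\<^sup>+x. indicator {x\<in>space M. t \<le> U x} x \<partial>M)"
    by (simp add: emeasure_eq_measure[symmetric])
  also have "\<dots> \<le> (\<integral>\<^sup>+x. ennreal (exp (- t)) * ennreal (exp (U x)) \<partial>M)"
    by (intro nn_integral_mono) (auto simp: indicator_def ennreal_mult'[symmetric] exp_add[symmetric])
  also have "\<dots> = ennreal (exp (- t)) * (\<integral>\<^sup>+x. ennreal (exp (U x)) \<partial>M)"
    by (rule nn_integral_cmult) measurable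
  finally show ?thesis .
qed

lemma prob_sqnorm_gt:
  assumes j: "j < p" and e: "0 < \<eta>" "\<eta> \<le> 1"
  shows "prob {x\<in>space M. real n * (1 + \<eta>) < sqnorm j x} \<le> exp (- (real n * \<eta>\<^sup>2 / 16))"
proof -
  note [measurable] = sqnorm_measurable[OF j]
  \<comment> \<open>Chernoff parameter: -ln(1 - 2s)/2 \<le> s + 4 s^2 leaves the exponent n (4 s^2 -
    s \<eta>), which is minimal at s = \<eta>/8.\<close>
  define s where "s = \<eta> / 8"
  have s: "0 < s" "s \<le> 1 / 4" using e by (auto simp: s_def)
  have "ennreal (prob {x\<in>space M. real n * (1 + \<eta>) < sqnorm j x})
    \<le> ennreal (prob {x\<in>space M. s * (real n * (1 + \<eta>)) \<le> s * sqnorm j x})"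
    using s by (intro ennreal_leI finite_measure_mono) auto
  also have "\<dots> \<le> ennreal (exp (- (s * (real n * (1 + \<eta>))))) * ennreal ((1 / sqrt (1 - 2 * s)) ^ n)"
    using s by (subst nn_integral_exp_sqnorm[OF j, symmetric], simp) (rule prob_exp_markov, measurable)
  also have "\<dots> = ennreal (exp (- (s * (real n * (1 + \<eta>)))) * (1 / sqrt (1 - 2 * s)) ^ n)"
    using s by (intro ennreal_mult'[symmetric]) auto
  also have "\<dots> \<le> ennreal (exp (- (s * (real n * (1 + \<eta>)))) * exp (s + 4 * s\<^sup>2) ^ n)"
  proof (intro ennreal_leI mult_left_mono power_mono)
    have "- (2 * s) - 2 * (2 * s)\<^sup>2 \<le> ln (1 - 2 * s)"
      using ln_one_minus_pos_lower_bound[of "2 * s"] s by (simp add: power2_eq_square)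
    then have "exp (- (2 * s) - 8 * s\<^sup>2) \<le> 1 - 2 * s"
      using s by (subst (asm) ln_ge_iff) (auto simp: power_mult_distrib)
    then have "1 / (1 - 2 * s) \<le> 1 / exp (- (2 * s) - 8 * s\<^sup>2)"
      using s by (intro divide_left_mono) auto
    also have "\<dots> = (exp (s + 4 * s\<^sup>2))\<^sup>2" by (simp add: exp_minus[symmetric] inverse_eq_divide[symmetric] power2_eq_square exp_add[symmetric])
    finally have "sqrt (1 / (1 - 2 * s)) \<le> exp (s + 4 * s\<^sup>2)"
      by (intro real_le_lsqrt) (use s in auto)
    then show "1 / sqrt (1 - 2 * s) \<le> exp (s + 4 * s\<^sup>2)" by (simp add: real_sqrt_divide)
  qed (use s in auto)
  also have "exp (- (s * (real n * (1 + \<eta>)))) * exp (s + 4 * s\<^sup>2) ^ n = exp (- (real n * \<eta>\<^sup>2 / 16))"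
    by (simp add: exp_of_nat_mult[symmetric] exp_add[symmetric] s_def power2_eq_square algebra_simps)
  finally show ?thesis by simp
qed

lemma prob_sqnorm_lt:
  assumes j: "j < p" and e: "0 < \<eta>" "\<eta> \<le> 1"
  shows "prob {x\<in>space M. sqnorm j x < real n * (1 - \<eta>)} \<le> exp (- (real n * \<eta>\<^sup>2 / 8))"
proof -
  note [measurable] = sqnorm_measurable[OF j]
  \<comment> \<open>For the lower tail ln(1 + 2s) \<ge> 2s - 4 s^2 leaves n (2 s^2 - s \<eta>),
    which is minimal at s = \<eta>/4.\<close>
  define s where "s = \<eta> / 4"
  have s: "0 < s" "s \<le> 1 / 4" using e by (auto simp: s_def)
  have "ennreal (prob {x\<in>space M. sqnorm j x < real n * (1 - \<eta>)})
    \<le> ennreal (prob {x\<in>space M. - s * (real n * (1 - \<eta>)) \<le> - s * sqnorm j x})"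
    using s by (intro ennreal_leI finite_measure_mono) auto
  also have "\<dots> \<le> ennreal (exp (- (- s * (real n * (1 - \<eta>))))) * ennreal ((1 / sqrt (1 - 2 * - s)) ^ n)"
    using s by (subst nn_integral_exp_sqnorm[OF j, symmetric], simp) (rule prob_exp_markov, measurable)
  also have "\<dots> = ennreal (exp (s * (real n * (1 - \<eta>))) * (1 / sqrt (1 + 2 * s)) ^ n)"
    using s by (subst ennreal_mult'[symmetric]) auto
  also have "\<dots> \<le> ennreal (exp (s * (real n * (1 - \<eta>))) * exp (- s + 2 * s\<^sup>2) ^ n)"
  proof (intro ennreal_leI mult_left_mono power_mono)
    have "2 * s - (2 * s)\<^sup>2 \<le> ln (1 + 2 * s)"
      using ln_one_plus_pos_lower_bound[of "2 * s"] s by simp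
    then have "exp (2 * s - 4 * s\<^sup>2) \<le> 1 + 2 * s"
      using s by (subst (asm) ln_ge_iff) (auto simp: power_mult_distrib)
    then have "1 / (1 + 2 * s) \<le> 1 / exp (2 * s - 4 * s\<^sup>2)"
      using s by (intro divide_left_mono) auto
    also have "\<dots> = (exp (- s + 2 * s\<^sup>2))\<^sup>2" by (simp add: exp_minus[symmetric] inverse_eq_divide[symmetric] power2_eq_square exp_add[symmetric])
    finally have "sqrt (1 / (1 + 2 * s)) \<le> exp (- s + 2 * s\<^sup>2)"
      by (intro real_le_lsqrt) (use s in auto)
    then show "1 / sqrt (1 + 2 * s) \<le> exp (- s + 2 * s\<^sup>2)" by (simp add: real_sqrt_divide)
  qed (use s in auto)
  also have "exp (s * (real n * (1 - \<eta>))) * exp (- s + 2 * s\<^sup>2) ^ n = exp (- (real n * \<eta>\<^sup>2 / 8))"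
    by (simp add: exp_of_nat_mult[symmetric] exp_add[symmetric] s_def power2_eq_square algebra_simps)
  finally show ?thesis by simp
qed

lemma prob_abs_proj:
  assumes "i < j" "j < p"
  shows "prob {x\<in>space M. t < \<bar>proj i j x\<bar>} \<le> 2 * gauss_tail t"
proof -
  note [measurable] = proj_measurable[of i j]
  have [measurable]: "proj i j \<in> borel_measurable M" using assms by (intro proj_measurable) auto
  have up: "prob {x\<in>space M. t < proj i j x} = gauss_tail t"
    using prob_past_proj[OF assms sets.top, of t] past_measurable[OF assms(2)]
    by (simp add: measurable_space prob_space cong: conj_cong)
  have dn: "prob {x\<in>space M. t < - proj i j x} = gauss_tail t"
    using prob_past_signed_proj[OF assms sets.top, of "- 1" t] past_measurable[OF assms(2)]
    by (simp add: measurable_space prob_space cong: conj_cong)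
  have "{x\<in>space M. t < \<bar>proj i j x\<bar>} \<subseteq> {x\<in>space M. t < proj i j x} \<union> {x\<in>space M. t < - proj i j x}"
    by auto
  then have "prob {x\<in>space M. t < \<bar>proj i j x\<bar>} \<le> prob ({x\<in>space M. t < proj i j x} \<union> {x\<in>space M. t < - proj i j x})"
    by (intro finite_measure_mono) auto
  also have "\<dots> \<le> prob {x\<in>space M. t < proj i j x} + prob {x\<in>space M. t < - proj i j x}"
    by (intro measure_Un_le) auto
  finally show ?thesis using up dn by simp
qed

end

section \<open>Poisson approximation\<close>

text \<open>Adding an event gains its probability minus its overlap with the earlier union, and that
  overlap is at most the sum of the pairwise intersections.\<close>

lemma (in prob_space) bonferroni_lower:
  fixes B :: "nat \<Rightarrow> 'a set"
  assumes "\<And>i. i < m \<Longrightarrow> B i \<in> events"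
  shows "(\<Sum>i<m. prob (B i)) - (\<Sum>k<m. \<Sum>i<k. prob (B i \<inter> B k)) \<le> prob (\<Union>i<m. B i)"
  using assms
proof (induction m)
  case (Suc m)
  have ev: "(\<Union>i<m. B i) \<in> events" "B m \<in> events" "\<And>i. i < m \<Longrightarrow> B i \<in> events" using Suc.prems by auto
  have "prob ((\<Union>i<m. B i) \<inter> B m) = prob (\<Union>i<m. B i \<inter> B m)" by (rule arg_cong[where f=prob]) auto
  also have "\<dots> \<le> (\<Sum>i<m. prob (B i \<inter> B m))"
    using ev by (intro finite_measure_subadditive_finite) auto
  finally have "prob ((\<Union>i<m. B i) \<inter> B m) \<le> (\<Sum>i<m. prob (B i \<inter> B m))" .
  moreover have "prob (\<Union>i<Suc m. B i) = prob (\<Union>i<m. B i) + prob (B m) - prob ((\<Union>i<m. B i) \<inter> B m)"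
  proof -
    have "(\<Union>i<Suc m. B i) = (\<Union>i<m. B i) \<union> B m" by (auto simp: less_Suc_eq)
    then show ?thesis using finite_measure_Union'[OF ev(1,2)] finite_measure_Diff'[OF ev(2,1)] by (simp add: Int_commute)
  qed
  ultimately show ?case using Suc.IH Suc.prems by auto
qed simp

text \<open>Errors only add up: every factor 1 - \<pi> j lies in [0,1], so an earlier error is never
  amplified.\<close>

lemma abs_prod_recursion:
  fixes g \<pi> \<epsilon> :: "nat \<Rightarrow> real"
  assumes "g 0 = 1" and "\<And>j. j < m \<Longrightarrow> \<bar>g (Suc j) - (1 - \<pi> j) * g j\<bar> \<le> \<epsilon> j"
    and "\<And>j. j < m \<Longrightarrow> 0 \<le> \<pi> j \<and> \<pi> j \<le> 1"
  shows "\<bar>g m - (\<Prod>j<m. 1 - \<pi> j)\<bar> \<le> (\<Sum>j<m. \<epsilon> j)"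
  using assms
proof (induction m)
  case (Suc m)
  have "\<bar>g (Suc m) - (\<Prod>j<Suc m. 1 - \<pi> j)\<bar>
    = \<bar>(g (Suc m) - (1 - \<pi> m) * g m) + (1 - \<pi> m) * (g m - (\<Prod>j<m. 1 - \<pi> j))\<bar>"
    by (simp add: algebra_simps)
  also have "\<dots> \<le> \<bar>g (Suc m) - (1 - \<pi> m) * g m\<bar> + \<bar>1 - \<pi> m\<bar> * \<bar>g m - (\<Prod>j<m. 1 - \<pi> j)\<bar>"
    unfolding abs_mult[symmetric] by (rule abs_triangle_ineq)
  also have "\<dots> \<le> \<epsilon> m + 1 * (\<Sum>j<m. \<epsilon> j)"
    using Suc.prems Suc.IH by (intro add_mono mult_mono) auto
  finally show ?case by simp
qed simp

text \<open>The lower bound uses ln(1 - x) \<ge> -x - 2 x^2 for x \<le> 1/2 together with x^2 \<le>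
  b x. The two bounds merge as b tends to 0.\<close>

lemma prod_one_minus_bounds:
  fixes \<pi> :: "nat \<Rightarrow> real"
  assumes "\<And>j. j < m \<Longrightarrow> 0 \<le> \<pi> j \<and> \<pi> j \<le> b" and b: "b \<le> 1 / 2"
  shows "(\<Prod>j<m. 1 - \<pi> j) \<le> exp (- (\<Sum>j<m. \<pi> j))"
    and "exp (- ((1 + 2 * b) * (\<Sum>j<m. \<pi> j))) \<le> (\<Prod>j<m. 1 - \<pi> j)"
proof -
  have "1 - \<pi> j \<le> exp (- \<pi> j)" if "j < m" for j
    using exp_ge_add_one_self[of "- \<pi> j"] by simp
  then have "(\<Prod>j<m. 1 - \<pi> j) \<le> (\<Prod>j<m. exp (- \<pi> j))"
    using assms by (intro prod_mono) force
  then show "(\<Prod>j<m. 1 - \<pi> j) \<le> exp (- (\<Sum>j<m. \<pi> j))" by (simp add: exp_sum sum_negf[symmetric])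
  have "exp (- ((1 + 2 * b) * \<pi> j)) \<le> 1 - \<pi> j" if "j < m" for j
  proof -
    have p: "0 \<le> \<pi> j" "\<pi> j \<le> b" using assms that by auto
    have "- ((1 + 2 * b) * \<pi> j) \<le> - \<pi> j - 2 * (\<pi> j)\<^sup>2"
      using mult_right_mono[OF p(2) p(1)] by (simp add: power2_eq_square algebra_simps)
    also have "\<dots> \<le> ln (1 - \<pi> j)" using p b by (intro ln_one_minus_pos_lower_bound) auto
    finally show ?thesis using p b by (subst (asm) ln_ge_iff) auto
  qed
  then have "(\<Prod>j<m. exp (- ((1 + 2 * b) * \<pi> j))) \<le> (\<Prod>j<m. 1 - \<pi> j)"
    by (intro prod_mono) force
  then show "exp (- ((1 + 2 * b) * (\<Sum>j<m. \<pi> j))) \<le> (\<Prod>j<m. 1 - \<pi> j)"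
    by (simp add: exp_sum sum_distrib_left sum_negf[symmetric])
qed

text \<open>Adjacent pairs carry the deterministic shift sqrt n r, so they get a threshold of their
  own.\<close>

definition cutoff :: "real \<Rightarrow> real \<Rightarrow> nat \<Rightarrow> nat \<Rightarrow> real" where
  "cutoff y1 y2 i j = (if j = Suc i then y2 else y1)"

lemma sum_cutoff_tails:
  "(\<Sum>i<j. gauss_tail (cutoff y1 y2 i j)) = (if j = 0 then 0 else real (j - 1) * gauss_tail y1 + gauss_tail y2)"
proof (cases j)
  case (Suc m)
  have "(\<Sum>i<m. gauss_tail (cutoff y1 y2 i j)) = (\<Sum>i<m. gauss_tail y1)"
    using Suc by (intro sum.cong) (auto simp: cutoff_def)
  then show ?thesis using Suc by (simp add: cutoff_def)
qed simp

context gaussian_array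
begin

text \<open>By symmetry the cosine is the projection divided by the norm of column l. If that
  squared norm is at least n/4, a projection of size at most t gives a cosine of at most 2t / sqrt
  n. The constant 9/128 is (3/4)^2 / 8 from the lower norm tail.\<close>

lemma prob_cosine_gt:
  assumes "i < l" "l < p" "0 < t"
  shows "prob {x\<in>space M. 2 * t / sqrt n < cosine i l x} \<le> 2 * gauss_tail t + exp (- (9 / 128 * real n))"
proof -
  have [measurable]: "proj i l \<in> borel_measurable M" "cosine i l \<in> borel_measurable M" "sqnorm l \<in> borel_measurable M"
    using assms by (auto intro: proj_measurable cosine_measurable sqnorm_measurable)
  have "x \<in> {x\<in>space M. t < \<bar>proj i l x\<bar>} \<union> {x\<in>space M. sqnorm l x < real n * (1 - 3 / 4)}"
    if x: "x \<in> space M" "2 * t / sqrt n < cosine i l x" for x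
  proof (rule ccontr)
    assume *: "\<not> ?thesis"
    then have a: "\<bar>proj i l x\<bar> \<le> t" "real n / 4 \<le> sqnorm l x" using x by auto
    have pos: "0 < sqnorm l x" using a(2) n_pos by (smt (verit) divide_pos_pos of_nat_0_less_iff)
    have "cosine i l x = (\<Sum>k<n. unit_dir n (\<lambda>k. Z k l x) k * unit_dir n (\<lambda>k. Z k i x) k)"
      by (simp add: cosine_def mult.commute)
    also have "\<dots> = proj i l x / sqrt (sqnorm l x)"
      using pos by (subst unit_dir_inner) (auto simp: sqnorm_def proj_def mult.commute)
    also have "\<dots> \<le> t / sqrt (sqnorm l x)" using a pos by (intro divide_right_mono) auto
    also have "\<dots> \<le> t / sqrt (real n / 4)"
      using a n_pos assms pos by (intro divide_left_mono) (auto intro!: real_sqrt_le_mono)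
    also have "\<dots> = 2 * t / sqrt n" by (simp add: real_sqrt_divide)
    finally show False using x by simp
  qed
  then have "prob {x\<in>space M. 2 * t / sqrt n < cosine i l x}
    \<le> prob ({x\<in>space M. t < \<bar>proj i l x\<bar>} \<union> {x\<in>space M. sqnorm l x < real n * (1 - 3 / 4)})"
    by (intro finite_measure_mono) auto
  also have "\<dots> \<le> prob {x\<in>space M. t < \<bar>proj i l x\<bar>} + prob {x\<in>space M. sqnorm l x < real n * (1 - 3 / 4)}"
    by (intro measure_Un_le) auto
  also have "\<dots> \<le> 2 * gauss_tail t + exp (- (real n * (3 / 4)\<^sup>2 / 8))"
    using assms by (intro add_mono prob_abs_proj prob_sqnorm_lt) auto
  finally show ?thesis by (simp add: power2_eq_square mult.commute)
qed

section \<open>Adding the columns one by one\<close>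

definition below :: "(nat \<Rightarrow> nat \<Rightarrow> real) \<Rightarrow> nat \<Rightarrow> 'a set" where
  "below thr j = {x\<in>space M. \<forall>l<j. \<forall>i<l. proj i l x \<le> thr i l}"

lemma below_event:
  assumes "j \<le> p"
  shows "below thr j \<in> events"
proof -
  have "below thr j = {x\<in>space M. \<forall>l\<in>{..<j}. \<forall>i\<in>{..<l}. proj i l x \<le> thr i l}" by (auto simp: below_def)
  also have "\<dots> \<in> events"
    using assms by (intro sets.sets_Collect_finite_All borel_measurable_le proj_measurable) auto
  finally show ?thesis .
qed

text \<open>Projections among the first j columns are functions of the past, so
  \<open>below thr j\<close> can be the conditioning event in \<open>prob_past_proj\<close>.\<close>

lemma below_past:
  assumes "j < p"
  obtains G where "G \<in> sets (past_space j)" "below thr j = {x\<in>space M. past j x \<in> G}"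
proof
  define F where "F = (\<lambda>i l (a :: nat \<times> nat \<Rightarrow> real). \<Sum>k<n. unit_dir n (\<lambda>k. a (k, i)) k * a (k, l))"
  have F: "F i l \<in> borel_measurable (past_space j)" if "i < l" "l < j" for i l
    unfolding F_def using that
    by (intro borel_measurable_sum borel_measurable_times past_unit_dir_measurable past_coordinate_measurable) auto
  have Feq: "F i l (past j x) = proj i l x" if "i < l" "l < j" for i l x
    unfolding F_def proj_def using that
    by (intro sum.cong refl arg_cong2[where f="(*)"] unit_dir_cong) (auto simp: past_coordinate)
  show "{a\<in>space (past_space j). \<forall>l\<in>{..<j}. \<forall>i\<in>{..<l}. F i l a \<le> thr i l} \<in> sets (past_space j)"
    by (intro sets.sets_Collect_finite_All borel_measurable_le F borel_measurable_const) auto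
  show "below thr j = {x\<in>space M. past j x \<in> {a\<in>space (past_space j). \<forall>l\<in>{..<j}. \<forall>i\<in>{..<l}. F i l a \<le> thr i l}}"
    using measurable_space[OF past_measurable[OF assms]] by (auto simp: below_def Feq)
qed

text \<open>Passing to j + 1 columns removes the events that pair (i, j) exceeds while the earlier
  pairs do not. Each has an exactly known probability; the union bound and Bonferroni bracket their
  union, and the condition on the earlier pairs is dropped only in the error term.\<close>

lemma below_step:
  assumes j: "j < p"
  shows "\<bar>prob (below thr (Suc j)) - (1 - (\<Sum>i<j. gauss_tail (thr i j))) * prob (below thr j)\<bar>
    \<le> (\<Sum>k<j. \<Sum>i<k. prob {x\<in>space M. thr i j < proj i j x \<and> thr k j < proj k j x})"
    (is "_ \<le> ?err")
proof -
  define A where "A = (\<lambda>i. {x\<in>space M. thr i j < proj i j x})"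
  have A: "A i \<in> events" if "i < j" for i
  proof -
    have [measurable]: "proj i j \<in> borel_measurable M" using that j by (intro proj_measurable) auto
    show ?thesis unfolding A_def by measurable
  qed
  define B where "B = (\<lambda>i. below thr j \<inter> A i)"
  have B: "B i \<in> events" if "i < j" for i
    using A[OF that] below_event[of j thr] j by (auto simp: B_def)
  obtain G where G: "G \<in> sets (past_space j)" "below thr j = {x\<in>space M. past j x \<in> G}"
    using below_past[OF j] .
  have pB: "prob (B i) = prob (below thr j) * gauss_tail (thr i j)" if "i < j" for i
    using prob_past_proj[OF that j G(1), of "thr i j"]
    by (simp add: G(2) B_def A_def) (simp add: Collect_conj_eq[symmetric] Int_def conj_ac cong: conj_cong)
  have split: "prob (below thr (Suc j)) = prob (below thr j) - prob (\<Union>i<j. B i)"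
  proof -
    have "below thr (Suc j) = below thr j - (\<Union>i<j. B i)"
    proof (intro equalityI subsetI)
      fix x assume "x \<in> below thr (Suc j)"
      then have "x \<in> below thr j" "\<And>i. i < j \<Longrightarrow> \<not> thr i j < proj i j x"
        by (auto simp: below_def not_less)
      then show "x \<in> below thr j - (\<Union>i<j. B i)" by (auto simp: B_def A_def)
    next
      fix x assume x: "x \<in> below thr j - (\<Union>i<j. B i)"
      then have "proj i j x \<le> thr i j" if "i < j" for i
        using that by (auto simp: below_def B_def A_def not_less[symmetric])
      then show "x \<in> below thr (Suc j)" using x by (auto simp: below_def less_Suc_eq)
    qed
    moreover have "(\<Union>i<j. B i) \<subseteq> below thr j" by (auto simp: B_def)
    ultimately show ?thesis using B below_event[of j thr] j
      by (simp add: finite_measure_Diff sets.finite_UN)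
  qed
  have up: "prob (\<Union>i<j. B i) \<le> (\<Sum>i<j. prob (B i))"
    using B by (intro finite_measure_subadditive_finite) auto
  have "(\<Sum>k<j. \<Sum>i<k. prob (B i \<inter> B k)) \<le> ?err"
  proof (intro sum_mono finite_measure_mono)
    fix k i assume "k \<in> {..<j}" "i \<in> {..<k}"
    then have "A i \<inter> A k \<in> events" by (intro sets.Int A) auto
    moreover have "A i \<inter> A k = {x\<in>space M. thr i j < proj i j x \<and> thr k j < proj k j x}" by (auto simp: A_def)
    ultimately show "{x\<in>space M. thr i j < proj i j x \<and> thr k j < proj k j x} \<in> events" by simp
  qed (auto simp: B_def A_def)
  then have lo: "(\<Sum>i<j. prob (B i)) - ?err \<le> prob (\<Union>i<j. B i)"
    using bonferroni_lower[of j B] B by auto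
  have "(\<Sum>i<j. prob (B i)) = (\<Sum>i<j. gauss_tail (thr i j)) * prob (below thr j)"
    by (simp add: pB sum_distrib_right mult.commute)
  then show ?thesis using up lo unfolding split by (simp add: algebra_simps abs_le_iff)
qed

text \<open>The error sums double exceedances over triples i < k < j. There are at most p^3 of them,
  and at most p^2 contain an adjacent pair. The hypothesis \<open>small\<close> keeps the factors of
  the product in [0,1].\<close>

lemma prob_below_cutoff:
  fixes y1 y2 t :: real
  defines "\<delta> \<equiv> 2 * t / sqrt n"
  assumes y: "1 \<le> y1" "1 \<le> y2" and t: "0 < t" and d: "\<delta> \<le> 1"
    and small: "real p * gauss_tail y1 + gauss_tail y2 \<le> 1"
  shows "\<bar>prob (below (cutoff y1 y2) p) - (\<Prod>j<p. 1 - (if j = 0 then 0 else real (j - 1) * gauss_tail y1 + gauss_tail y2))\<bar>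
    \<le> real p ^ 3 * (2 * gauss_tail t + exp (- (9 / 128 * real n)) + exp (- (y1\<^sup>2 / (1 + \<delta>))))
      + real p ^ 2 * exp (- ((y1\<^sup>2 + y2\<^sup>2) / (2 * (1 + \<delta>))))"
proof -
  define \<beta> where "\<beta> = 2 * gauss_tail t + exp (- (9 / 128 * real n))"
  define e1 where "e1 = exp (- (y1\<^sup>2 / (1 + \<delta>)))"
  define e2 where "e2 = exp (- ((y1\<^sup>2 + y2\<^sup>2) / (2 * (1 + \<delta>))))"
  have d0: "0 \<le> \<delta>" using t by (simp add: \<delta>_def)
  have nn: "0 \<le> \<beta>" "0 \<le> e1" "0 \<le> e2" by (auto simp: \<beta>_def e1_def e2_def gauss_tail_nonneg)
  let ?T = "cutoff y1 y2"
  have pair: "prob {x\<in>space M. ?T i j < proj i j x \<and> ?T k j < proj k j x} \<le> \<beta> + e1 + (if k = j - 1 then e2 else 0)"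
    if "i < k" "k < j" "j < p" for i k j
  proof -
    have "prob {x\<in>space M. ?T i j < proj i j x \<and> ?T k j < proj k j x}
      \<le> prob {x\<in>space M. \<delta> < cosine i k x} + exp (- ((?T i j)\<^sup>2 + (?T k j)\<^sup>2) / (2 * (1 + \<delta>)))"
      using that y d d0 by (intro prob_two_proj) (auto simp: cutoff_def)
    moreover have "prob {x\<in>space M. \<delta> < cosine i k x} \<le> \<beta>"
      unfolding \<delta>_def \<beta>_def using that t by (intro prob_cosine_gt) auto
    \<comment> \<open>Since i < k < j, only the pair (k, j) can be adjacent.\<close>
    moreover have "exp (- ((?T i j)\<^sup>2 + (?T k j)\<^sup>2) / (2 * (1 + \<delta>))) \<le> e1 + (if k = j - 1 then e2 else 0)"
    proof (cases "k = j - 1")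
      case True
      then have "?T i j = y1" "?T k j = y2" using that by (auto simp: cutoff_def)
      then have "exp (- ((?T i j)\<^sup>2 + (?T k j)\<^sup>2) / (2 * (1 + \<delta>))) = e2"
        by (simp only: e2_def minus_divide_left)
      then show ?thesis using True nn by simp
    next
      case False
      then have "?T i j = y1" "?T k j = y1" using that by (auto simp: cutoff_def)
      moreover have "- (y1\<^sup>2 + y1\<^sup>2) / (2 * (1 + \<delta>)) = - (y1\<^sup>2 / (1 + \<delta>))" using d0 by (simp add: field_simps)
      ultimately show ?thesis using False by (simp add: e1_def)
    qed
    ultimately show ?thesis by linarith
  qed
  define \<pi> where "\<pi> = (\<lambda>j. if j = 0 then 0 else real (j - 1) * gauss_tail y1 + gauss_tail y2)"
  have "\<bar>prob (below ?T p) - (\<Prod>j<p. 1 - \<pi> j)\<bar>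
    \<le> (\<Sum>j<p. \<Sum>k<j. \<Sum>i<k. prob {x\<in>space M. ?T i j < proj i j x \<and> ?T k j < proj k j x})"
  proof (rule abs_prod_recursion)
    show "prob (below ?T 0) = 1" by (simp add: below_def prob_space)
    show "\<bar>prob (below ?T (Suc j)) - (1 - \<pi> j) * prob (below ?T j)\<bar>
      \<le> (\<Sum>k<j. \<Sum>i<k. prob {x\<in>space M. ?T i j < proj i j x \<and> ?T k j < proj k j x})" if "j < p" for j
      using below_step[OF that, of ?T] by (simp add: sum_cutoff_tails \<pi>_def)
    show "0 \<le> \<pi> j \<and> \<pi> j \<le> 1" if "j < p" for j
    proof -
      have "real (j - 1) * gauss_tail y1 \<le> real p * gauss_tail y1"
        using that by (intro mult_right_mono gauss_tail_nonneg) auto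
      then show ?thesis using small by (auto simp: \<pi>_def gauss_tail_nonneg)
    qed
  qed
  also have "\<dots> \<le> (\<Sum>j<p. \<Sum>k<j. \<Sum>i<k. \<beta> + e1 + (if k = j - 1 then e2 else 0))"
    by (intro sum_mono pair) auto
  also have "\<dots> \<le> (\<Sum>j<p. real p ^ 2 * (\<beta> + e1) + real p * e2)"
  proof (intro sum_mono)
    fix j assume "j \<in> {..<p}"
    then have j: "j < p" by simp
    have "(\<Sum>k<j. \<Sum>i<k. \<beta> + e1 + (if k = j - 1 then e2 else 0)) \<le> (\<Sum>k<j. real p * (\<beta> + e1) + (if k = j - 1 then real p * e2 else 0))"
    proof (intro sum_mono)
      fix k assume "k \<in> {..<j}"
      then have "real k \<le> real p" using j by auto
      then have "real k * (\<beta> + e1) \<le> real p * (\<beta> + e1)" "real k * e2 \<le> real p * e2"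
        using nn by (auto intro!: mult_right_mono)
      then show "(\<Sum>i<k. \<beta> + e1 + (if k = j - 1 then e2 else 0)) \<le> real p * (\<beta> + e1) + (if k = j - 1 then real p * e2 else 0)"
        by (auto simp: algebra_simps)
    qed
    also have "\<dots> = real j * (real p * (\<beta> + e1)) + (\<Sum>k<j. if k = j - 1 then real p * e2 else 0)"
      by (simp add: sum.distrib)
    also have "\<dots> \<le> real p * (real p * (\<beta> + e1)) + real p * e2"
    proof (intro add_mono mult_right_mono)
      show "(\<Sum>k<j. if k = j - 1 then real p * e2 else 0) \<le> real p * e2" using nn by (cases j) auto
    qed (use nn j in auto)
    finally show "(\<Sum>k<j. \<Sum>i<k. \<beta> + e1 + (if k = j - 1 then e2 else 0)) \<le> real p ^ 2 * (\<beta> + e1) + real p * e2"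
      by (simp add: power2_eq_square mult.assoc)
  qed
  also have "\<dots> = real p ^ 3 * (\<beta> + e1) + real p ^ 2 * e2"
    by (simp add: power2_eq_square power3_eq_cube algebra_simps)
  finally show ?thesis by (simp add: \<pi>_def \<beta>_def e1_def e2_def)
qed

end

section \<open>Sample correlations of an autoregression\<close>

text \<open>Purely deterministic. The products \<open>m\<close> of Y with E and \<open>g\<close> of
  Y with Y satisfy linear recursions with coefficient r. As r \<le> c \<le> 1/8 these contract, so
  bounds of order N c hold uniformly in the indices; feeding them once more through the recursion
  gains a factor c. This second pass gives errors of order N c^2, that is sqrt N c^2 after
  scaling.\<close>

lemma rho_hat_approximation:
  fixes E Y :: "nat \<Rightarrow> nat \<Rightarrow> real" and r c s :: real and n p :: nat
  defines "N \<equiv> real n" and "a \<equiv> (\<lambda>i j. \<Sum>k<n. E k i * E k j)"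
  assumes n: "0 < n" and Y0: "\<And>k. Y k 0 = E k 0"
    and YS: "\<And>k i. Suc i < p \<Longrightarrow> Y k (Suc i) = r * Y k i + s * E k (Suc i)"
    and s: "s = sqrt (1 - r\<^sup>2)" and r: "0 \<le> r" "r \<le> c" and c: "c \<le> 1 / 8"
    and diag: "\<And>i. i < p \<Longrightarrow> \<bar>a i i - N\<bar> \<le> N * c"
    and off: "\<And>i j. i < j \<Longrightarrow> j < p \<Longrightarrow> \<bar>a i j\<bar> \<le> N * c"
    and ij: "i < j" "j < p"
  shows "\<bar>sqrt N * rho_hat n Y i j - (a i j / sqrt (a i i) + (if j = Suc i then sqrt N * r else 0))\<bar>
    \<le> 26 * sqrt N * c\<^sup>2"
proof -
  define m where "m = (\<lambda>i j. \<Sum>k<n. Y k i * E k j)"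
  define g where "g = (\<lambda>i j. \<Sum>k<n. Y k i * Y k j)"
  have N: "0 < N" using n by (simp add: N_def)
  have c0: "0 \<le> c" using r by simp
  define d where "d = N * c"
  have d0: "0 \<le> d" using N c0 by (simp add: d_def)
  have dN: "d \<le> N / 8" using mult_left_mono[OF c, of N] N by (simp add: d_def)
  have r2: "r\<^sup>2 \<le> c\<^sup>2" using r by (intro power_mono) auto
  have c2: "c\<^sup>2 \<le> c / 8" using mult_right_mono[OF c c0] by (simp add: power2_eq_square)
  have s2: "s\<^sup>2 = 1 - r\<^sup>2" using r2 c2 c c0 by (simp add: s)
  have s01: "0 \<le> s" "s \<le> 1" using r2 c2 c c0 by (auto simp: s)
  have s1: "1 - s \<le> c\<^sup>2"
  proof -
    have "1 - s \<le> (1 - s) * (1 + s)" using s01 mult_left_mono[of 1 "1 + s" "1 - s"] by simp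
    also have "\<dots> = r\<^sup>2" using s2 by (simp add: algebra_simps power2_eq_square)
    finally show ?thesis using r2 by simp
  qed
  have rb: "\<bar>r * x\<bar> \<le> c * b" if "\<bar>x\<bar> \<le> b" for x b
    unfolding abs_mult using that r by (intro mult_mono) auto
  have sb: "\<bar>s * x\<bar> \<le> b" if "\<bar>x\<bar> \<le> b" for x b
    unfolding abs_mult using that s01 mult_mono[of "\<bar>s\<bar>" 1 "\<bar>x\<bar>" b] by auto
  have sb1: "\<bar>s * x - x\<bar> \<le> c * d" if "\<bar>x\<bar> \<le> 2 * d" for x
  proof -
    have "\<bar>s * x - x\<bar> = \<bar>s - 1\<bar> * \<bar>x\<bar>" unfolding abs_mult[symmetric] by (simp add: left_diff_distrib)
    also have "\<dots> = (1 - s) * \<bar>x\<bar>" using s01 by simp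
    also have "\<dots> \<le> (c / 8) * (2 * d)" using s1 c2 that s01 c0 by (intro mult_mono) auto
    also have "\<dots> \<le> c * d" using c0 d0 by simp
    finally show ?thesis .
  qed
  have cd: "c * d \<le> d / 8" using mult_right_mono[OF c d0] by simp
  have cN: "c * N = d" by (simp add: d_def)
  have m0: "m 0 j = a 0 j" for j by (simp add: m_def a_def Y0)
  have mS: "m (Suc i) j = r * m i j + s * a (Suc i) j" if "Suc i < p" for i j
    by (simp add: m_def a_def YS[OF that] sum.distrib sum_distrib_left algebra_simps)
  have gS: "g i (Suc j) = r * g i j + s * m i (Suc j)" if "Suc j < p" for i j
    by (simp add: m_def g_def YS[OF that] sum.distrib sum_distrib_left algebra_simps)
  have gSS: "g (Suc i) (Suc i) = r\<^sup>2 * g i i + 2 * r * s * m i (Suc i) + s\<^sup>2 * a (Suc i) (Suc i)" if "Suc i < p" for i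
    by (simp add: m_def g_def a_def YS[OF that] sum.distrib sum_distrib_left algebra_simps power2_eq_square)
  have off': "\<bar>a i j\<bar> \<le> d" if "i < j" "j < p" for i j using off[OF that] by (simp add: d_def)
  \<comment> \<open>The contraction: a bound 2d becomes at most 2d/8 + d, again below 2d, so the
    constant does not grow with i. The bounds on \<open>g\<close> below follow the same
    pattern.\<close>
  have mb: "\<bar>m i j\<bar> \<le> 2 * d" if "i < j" "j < p" for i j
    using that
  proof (induction i)
    case 0 then show ?case using off'[of 0 j] d0 by (simp add: m0)
  next
    case (Suc i)
    then have "\<bar>r * m i j\<bar> \<le> c * (2 * d)" "\<bar>s * a (Suc i) j\<bar> \<le> d"
      by (auto intro!: rb sb off')
    then show ?case using mS[of i j] Suc.prems cd d0 by auto
  qed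
  have ma: "\<bar>m i j - a i j\<bar> \<le> 3 * (c * d)" if "i < j" "j < p" for i j
  proof (cases i)
    case 0 then show ?thesis using m0 c0 d0 by simp
  next
    case (Suc l)
    then have "\<bar>r * m l j\<bar> \<le> c * (2 * d)" using mb[of l j] that by (intro rb) auto
    moreover have "\<bar>s * a i j - a i j\<bar> \<le> c * d" using off'[OF that] d0 by (intro sb1) auto
    ultimately show ?thesis using mS[of l j] Suc that by auto
  qed
  have gd: "\<bar>g i i - N\<bar> \<le> 2 * d" if "i < p" for i
    using that
  proof (induction i)
    case 0
    have "g 0 0 = a 0 0" by (simp add: g_def a_def Y0)
    then show ?case using diag[OF 0] d0 by (simp add: d_def)
  next
    case (Suc i)
    have IH: "\<bar>g i i - N\<bar> \<le> 2 * d" using Suc by auto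
    have "g (Suc i) (Suc i) - N = r * (r * (g i i - N)) + s * (2 * (r * m i (Suc i))) + s * (s * (a (Suc i) (Suc i) - N))"
    proof -
      have "N = (r * r + s * s) * N" using s2 by (simp add: power2_eq_square)
      then show ?thesis unfolding gSS[OF Suc.prems] by (simp add: algebra_simps power2_eq_square)
    qed
    moreover have "\<bar>r * (r * (g i i - N))\<bar> \<le> c * (c * (2 * d))" by (intro rb IH)
    moreover have "c * (c * (2 * d)) \<le> 1 * (c * (2 * d))" using c c0 d0 by (intro mult_right_mono) auto
    moreover have "\<bar>s * (2 * (r * m i (Suc i)))\<bar> \<le> 2 * (c * (2 * d))"
      using rb[OF mb[of i "Suc i"]] Suc.prems by (intro sb) (auto simp: abs_mult[of 2])
    moreover have "\<bar>s * (s * (a (Suc i) (Suc i) - N))\<bar> \<le> d"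
      using diag[OF Suc.prems] by (intro sb) (simp add: d_def)
    ultimately show ?case using cd d0 by (simp only: abs_le_iff) linarith
  qed
  have goff: "\<bar>g i j\<bar> \<le> 4 * d" if "i < j" "j < p" for i j
    using that
  proof (induction j)
    case (Suc j)
    have m: "\<bar>s * m i (Suc j)\<bar> \<le> 2 * d" using Suc.prems by (intro sb mb) auto
    show ?case
    proof (cases "i = j")
      case True
      have "\<bar>g i i\<bar> \<le> 2 * N" using gd[of i] dN N Suc.prems by auto
      then have "\<bar>r * g i i\<bar> \<le> c * (2 * N)" by (rule rb)
      then show ?thesis using m gS[of j i] Suc.prems cN True by auto
    next
      case False
      then have "\<bar>r * g i j\<bar> \<le> c * (4 * d)" using Suc by (intro rb) auto
      then show ?thesis using m gS[of j i] Suc.prems cd d0 by auto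
    qed
  qed simp
  \<comment> \<open>Replacing s by 1 costs c d, replacing m by a costs 3 c d, and the term with
    factor r costs at most 4 c d beyond r N, which is present exactly for adjacent indices.\<close>
  have gap: "\<bar>g i j - (a i j + (if j = Suc i then r * N else 0))\<bar> \<le> 8 * (c * d)"
  proof (cases j)
    case (Suc l)
    have m: "\<bar>s * m i j - m i j\<bar> \<le> c * d" using mb[OF ij] by (intro sb1)
    have g: "g i j = r * g i l + s * m i j" using gS[of l i] Suc ij by simp
    show ?thesis
    proof (cases "i = l")
      case True
      have "\<bar>r * (g i i - N)\<bar> \<le> c * (2 * d)" using ij by (intro rb gd) auto
      then have "\<bar>r * g i l - r * N\<bar> \<le> c * (2 * d)" using True by (simp add: right_diff_distrib)
      then show ?thesis using m ma[OF ij] True Suc g c0 d0 mult_nonneg_nonneg[OF c0 d0] by (simp add: abs_le_iff)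
    next
      case False
      have "\<bar>r * g i l\<bar> \<le> c * (4 * d)" using False Suc ij by (intro rb goff) auto
      then show ?thesis using m ma[OF ij] False Suc g mult_nonneg_nonneg[OF c0 d0] by (simp add: abs_le_iff)
    qed
  qed (use ij in simp)
  define q where "q = sqrt (g i i * g j j)"
  have gi: "N - 2 * d \<le> g i i" "g i i \<le> N + 2 * d" "N - 2 * d \<le> g j j" "g j j \<le> N + 2 * d"
    using gd[of i] gd[of j] ij by auto
  have pos: "0 < N - 2 * d" using dN N by linarith
  have qlo: "N - 2 * d \<le> q"
    unfolding q_def using pos gi by (intro real_le_rsqrt) (auto simp: power2_eq_square intro!: mult_mono)
  have qhi: "q \<le> N + 2 * d"
    unfolding q_def using pos gi by (intro real_le_lsqrt) (auto simp: power2_eq_square intro!: mult_mono mult_nonneg_nonneg)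
  have q0: "0 < q" "N / 2 \<le> q" using qlo pos dN N by auto
  have rho: "rho_hat n Y i j = g i j / q"
    unfolding rho_hat_def q_def g_def by (simp add: power2_eq_square)
  have sN: "sqrt N * sqrt N = N" "0 < sqrt N" using N by auto
  have 1: "\<bar>sqrt N * rho_hat n Y i j - g i j / sqrt N\<bar> \<le> 16 * sqrt N * c\<^sup>2"
  proof -
    have "sqrt N * rho_hat n Y i j - g i j / sqrt N = g i j * (N - q) / (sqrt N * q)"
      using q0 sN by (simp add: rho field_simps)
    also have "\<bar>\<dots>\<bar> = \<bar>g i j\<bar> * \<bar>N - q\<bar> / (sqrt N * q)" using q0 N by (simp add: abs_mult)
    also have "\<dots> \<le> (4 * d) * (2 * d) / (sqrt N * (N / 2))"
      using q0 N goff[OF ij] qlo qhi d0 by (intro frac_le mult_mono mult_pos_pos mult_nonneg_nonneg) auto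
    also have "\<dots> = 16 * sqrt N * c\<^sup>2"
      using N sN by (simp add: d_def power2_eq_square field_simps; simp add: mult.assoc[symmetric])
    finally show ?thesis .
  qed
  have 2: "\<bar>g i j / sqrt N - (a i j / sqrt N + (if j = Suc i then sqrt N * r else 0))\<bar> \<le> 8 * sqrt N * c\<^sup>2"
  proof -
    have "g i j / sqrt N - (a i j / sqrt N + (if j = Suc i then sqrt N * r else 0)) = (g i j - (a i j + (if j = Suc i then r * N else 0))) / sqrt N"
      using sN by (simp add: field_simps; simp add: mult.assoc[symmetric])
    also have "\<bar>\<dots>\<bar> \<le> 8 * (c * d) / sqrt N"
      using gap sN by (simp only: abs_divide) (intro frac_le, auto)
    also have "\<dots> = 8 * sqrt N * c\<^sup>2"
      using N sN by (simp add: d_def power2_eq_square field_simps; simp add: mult.assoc[symmetric])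
    finally show ?thesis .
  qed
  \<comment> \<open>The projection divides by the actual norm of column i, whereas the previous two
    comparisons divide by sqrt N.\<close>
  have 3: "\<bar>a i j / sqrt N - a i j / sqrt (a i i)\<bar> \<le> 2 * sqrt N * c\<^sup>2"
  proof -
    define e where "e = sqrt (a i i)"
    have ai: "\<bar>a i i - N\<bar> \<le> d" using diag[of i] ij by (simp add: d_def)
    then have "N / 4 \<le> a i i" using dN N by auto
    then have e: "sqrt N / 2 \<le> e" "e * e = a i i"
      using N real_sqrt_le_mono[of "N / 4" "a i i"] by (auto simp: e_def real_sqrt_divide)
    then have e0: "0 < e" using sN by linarith
    have "\<bar>e - sqrt N\<bar> * sqrt N \<le> \<bar>e - sqrt N\<bar> * (e + sqrt N)" using e0 by (intro mult_left_mono) auto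
    also have "\<dots> = \<bar>(e - sqrt N) * (e + sqrt N)\<bar>" using e0 sN by (simp add: abs_mult)
    also have "(e - sqrt N) * (e + sqrt N) = a i i - N" using e(2) sN by (simp add: algebra_simps)
    finally have eN: "\<bar>e - sqrt N\<bar> * sqrt N \<le> d" using ai by simp
    have "a i j / sqrt N - a i j / e = a i j * ((e - sqrt N) * sqrt N) / (N * e)"
      using e0 sN by (simp add: field_simps; simp add: mult.assoc[symmetric])
    also have "\<bar>\<dots>\<bar> = \<bar>a i j\<bar> * (\<bar>e - sqrt N\<bar> * sqrt N) / (N * e)" using e0 N sN by (simp add: abs_mult)
    also have "\<dots> \<le> d * d / (N * (sqrt N / 2))"
      using e0 e N sN off'[OF ij] eN d0 by (intro frac_le mult_mono mult_pos_pos mult_nonneg_nonneg) auto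
    also have "\<dots> = 2 * sqrt N * c\<^sup>2"
      using N sN by (simp add: d_def power2_eq_square field_simps; simp add: mult.assoc[symmetric])
    finally show ?thesis by (simp add: e_def)
  qed
  \<comment> \<open>The constant is 26 = 16 + 8 + 2.\<close>
  show ?thesis using 1 2 3 by (simp only: abs_le_iff) linarith
qed

section \<open>Asymptotics of Gaussian tails\<close>

text \<open>W is exp A times the Mills approximation, written as one exponential so that the growth
  of A can cancel against y^2/2 inside the exponent.\<close>

lemma gauss_tail_scaled_bounds:
  fixes A y :: real
  assumes "0 < y"
  defines "W \<equiv> exp (A - y\<^sup>2 / 2 - ln y - ln (2 * pi) / 2)"
  shows "W * (1 / (1 + 1 / y\<^sup>2)) \<le> exp A * gauss_tail y" "exp A * gauss_tail y \<le> W"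
proof -
  have "exp (ln (2 * pi) / 2) = sqrt (2 * pi)" by (simp add: ln_sqrt[symmetric])
  moreover have "exp (- y\<^sup>2 / 2) = 1 / exp (y\<^sup>2 / 2)" by (simp add: exp_minus inverse_eq_divide)
  ultimately have W: "exp A * (std_normal_density y / y) = W"
    using assms(1) by (simp add: W_def exp_diff std_normal_density_def)
  have "0 < 1 + 1 / y\<^sup>2" using assms(1) by (simp add: add_pos_pos)
  moreover have "v * (1 / u) \<le> g" if "0 < u" "v \<le> u * g" for u v g :: real
    using that by (simp add: field_simps)
  ultimately have "std_normal_density y / y * (1 / (1 + 1 / y\<^sup>2)) \<le> gauss_tail y"
    using gauss_tail_lower[OF assms(1)] by blast
  then have "exp A * (std_normal_density y / y * (1 / (1 + 1 / y\<^sup>2))) \<le> exp A * gauss_tail y"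
    by (intro mult_left_mono) auto
  then show "W * (1 / (1 + 1 / y\<^sup>2)) \<le> exp A * gauss_tail y" by (simp only: W[symmetric] mult.assoc)
  have "exp A * gauss_tail y \<le> exp A * (std_normal_density y / y)"
    using gauss_tail_upper[OF assms(1)] by (intro mult_left_mono) auto
  then show "exp A * gauss_tail y \<le> W" by (simp only: W)
qed

lemma gauss_tail_scaled_tendsto:
  fixes A y :: "nat \<Rightarrow> real"
  assumes y: "filterlim y at_top sequentially"
    and W: "(\<lambda>n. exp (A n - (y n)\<^sup>2 / 2 - ln (y n) - ln (2 * pi) / 2)) \<longlonglongrightarrow> w"
  shows "(\<lambda>n. exp (A n) * gauss_tail (y n)) \<longlonglongrightarrow> w"
proof (rule tendsto_sandwich)
  have ev: "\<forall>\<^sub>F n in sequentially. 0 < y n" using y by (simp add: filterlim_at_top_dense)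
  show "\<forall>\<^sub>F n in sequentially. exp (A n - (y n)\<^sup>2 / 2 - ln (y n) - ln (2 * pi) / 2) * (1 / (1 + 1 / (y n)\<^sup>2))
      \<le> exp (A n) * gauss_tail (y n)"
    using ev by eventually_elim (rule gauss_tail_scaled_bounds)
  show "\<forall>\<^sub>F n in sequentially. exp (A n) * gauss_tail (y n) \<le> exp (A n - (y n)\<^sup>2 / 2 - ln (y n) - ln (2 * pi) / 2)"
    using ev by eventually_elim (rule gauss_tail_scaled_bounds)
  have "((\<lambda>z::real. 1 / (1 + 1 / z\<^sup>2)) \<longlongrightarrow> 1) at_top" by real_asymp
  from tendsto_mult[OF W filterlim_compose[OF this y]]
  show "(\<lambda>n. exp (A n - (y n)\<^sup>2 / 2 - ln (y n) - ln (2 * pi) / 2) * (1 / (1 + 1 / (y n)\<^sup>2))) \<longlonglongrightarrow> w" by simp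
qed (rule W)

text \<open>The common form of the four thresholds used later. The coefficient a is 2 for distant
  and sqrt 2 for adjacent pairs, so that exp(a^2/2 * L) is p^2 or p; b is 2 under the normalization
  \<open>a_n\<close>, \<open>b_n\<close> and sqrt 2 under \<open>c_n\<close>, \<open>d_n\<close>;
  \<kappa> is 0 or, up to sign, the deviation of r from criticality; \<epsilon> is of smaller order
  than 1 / sqrt L and so changes y^2 by o(1).\<close>

locale threshold_expansion =
  fixes L \<kappa> \<epsilon> y :: "nat \<Rightarrow> real" and a b b0 :: real
  assumes L: "filterlim L at_top sequentially"
    and k: "\<kappa> \<longlonglongrightarrow> 0"
    and e: "(\<lambda>n. \<epsilon> n * sqrt (L n)) \<longlonglongrightarrow> 0"
    and ab: "0 < a" "0 < b"
    and y: "\<forall>\<^sub>F n in sequentially. y n = (a + \<kappa> n) * sqrt (L n) + (b0 - ln (L n) / 2) / (b * sqrt (L n)) + \<epsilon> n"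
begin

text \<open>What remains of a^2 L / 2 - y^2 / 2 - ln y apart from constants and o(1). The last term
  comes from ln y = ln a + ln L / 2 + o(1), all others from the square.\<close>

definition excess :: "nat \<Rightarrow> real" where
  "excess n = - a * \<kappa> n * L n - (\<kappa> n)\<^sup>2 * L n / 2 - (a + \<kappa> n) * (b0 - ln (L n) / 2) / b - ln (L n) / 2"

lemma L_pos: "\<forall>\<^sub>F n in sequentially. 1 < L n"
  using L by (simp add: filterlim_at_top_dense)

lemma ratio: "(\<lambda>n. y n / sqrt (L n)) \<longlonglongrightarrow> a"
proof -
  have "((\<lambda>z::real. (b0 - ln z / 2) / (b * z)) \<longlongrightarrow> 0) at_top" using ab by real_asymp
  then have 1: "(\<lambda>n. (b0 - ln (L n) / 2) / (b * L n)) \<longlonglongrightarrow> 0" using L by (rule filterlim_compose)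
  have "((\<lambda>z::real. 1 / z) \<longlongrightarrow> 0) at_top" by real_asymp
  then have "(\<lambda>n. 1 / L n) \<longlonglongrightarrow> 0" using L by (rule filterlim_compose)
  from tendsto_mult[OF e this] have 2: "(\<lambda>n. \<epsilon> n * sqrt (L n) * (1 / L n)) \<longlonglongrightarrow> 0" by simp
  have "(\<lambda>n. (a + \<kappa> n) + (b0 - ln (L n) / 2) / (b * L n) + \<epsilon> n * sqrt (L n) * (1 / L n)) \<longlonglongrightarrow> (a + 0) + 0 + 0"
    by (intro tendsto_intros k 1 2)
  moreover have "\<forall>\<^sub>F n in sequentially. (a + \<kappa> n) + (b0 - ln (L n) / 2) / (b * L n) + \<epsilon> n * sqrt (L n) * (1 / L n) = y n / sqrt (L n)"
    using L_pos y
  proof eventually_elim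
    case (elim n)
    then have s: "sqrt (L n) * sqrt (L n) = L n" "0 < sqrt (L n)" by auto
    have "(a + \<kappa> n) + (b0 - ln (L n) / 2) / (b * (s * s)) + \<epsilon> n * s * (1 / (s * s))
      = ((a + \<kappa> n) * s + (b0 - ln (L n) / 2) / (b * s) + \<epsilon> n) / s" if "0 < s" for s
      using that ab by (simp add: add_divide_distrib)
    from this[OF s(2)] show ?case unfolding s(1) elim(2) .
  qed
  ultimately show ?thesis using Lim_transform_eventually by fastforce
qed

lemma y_at_top: "filterlim y at_top sequentially"
proof -
  have "filterlim (\<lambda>n. sqrt (L n)) at_top sequentially" by (rule filterlim_compose[OF sqrt_at_top L])
  then have "filterlim (\<lambda>n. y n / sqrt (L n) * sqrt (L n)) at_top sequentially"
    by (rule filterlim_tendsto_pos_mult_at_top[OF ratio ab(1)])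
  moreover have "\<forall>\<^sub>F n in sequentially. y n / sqrt (L n) * sqrt (L n) = y n"
    using L_pos by eventually_elim simp
  ultimately show ?thesis by (simp cong: filterlim_cong)
qed

text \<open>In y^2 every term outside \<open>excess\<close> contains \<epsilon> sqrt L or B^2 / L
  with B = b0 - ln L / 2, and these vanish; the logarithm is handled by y / sqrt L tending to
  a.\<close>

lemma exponent_expansion:
  "(\<lambda>n. (a\<^sup>2 / 2 * L n - (y n)\<^sup>2 / 2 - ln (y n) - ln (2 * pi) / 2) - (excess n - ln a - ln (2 * pi) / 2)) \<longlonglongrightarrow> 0"
proof -
  let ?B = "\<lambda>n. b0 - ln (L n) / 2"
  have "((\<lambda>z::real. (b0 - ln z / 2) / z) \<longlongrightarrow> 0) at_top" by real_asymp
  then have B1: "(\<lambda>n. ?B n / L n) \<longlonglongrightarrow> 0" using L by (rule filterlim_compose)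
  have "((\<lambda>z::real. (b0 - ln z / 2)\<^sup>2 / z) \<longlongrightarrow> 0) at_top" by real_asymp
  then have B2: "(\<lambda>n. (?B n)\<^sup>2 / L n) \<longlonglongrightarrow> 0" using L by (rule filterlim_compose)
  have "((\<lambda>z::real. 1 / z) \<longlongrightarrow> 0) at_top" by real_asymp
  then have L1: "(\<lambda>n. 1 / L n) \<longlonglongrightarrow> 0" using L by (rule filterlim_compose)
  have rem: "(\<lambda>n. (?B n)\<^sup>2 / L n / (2 * b\<^sup>2) + \<epsilon> n * sqrt (L n) * (a + \<kappa> n) + \<epsilon> n * sqrt (L n) * (?B n / L n) / b
      + (\<epsilon> n * sqrt (L n))\<^sup>2 * (1 / L n) / 2) \<longlonglongrightarrow> 0 / (2 * b\<^sup>2) + 0 * (a + 0) + 0 * 0 / b + 0\<^sup>2 * 0 / 2"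
    using ab by (intro tendsto_intros B1 B2 e k L1) auto
  have lnr: "(\<lambda>n. ln (y n / sqrt (L n))) \<longlonglongrightarrow> ln a" using ab by (intro tendsto_ln ratio) auto
  have ypos: "\<forall>\<^sub>F n in sequentially. 0 < y n" using y_at_top by (simp add: filterlim_at_top_dense)
  have "(\<lambda>n. - ((?B n)\<^sup>2 / L n / (2 * b\<^sup>2) + \<epsilon> n * sqrt (L n) * (a + \<kappa> n) + \<epsilon> n * sqrt (L n) * (?B n / L n) / b
      + (\<epsilon> n * sqrt (L n))\<^sup>2 * (1 / L n) / 2) - (ln (y n / sqrt (L n)) - ln a)) \<longlonglongrightarrow> 0"
    using tendsto_diff[OF tendsto_minus[OF rem] tendsto_diff[OF lnr tendsto_const[of "ln a"]]] by simp
  moreover have "\<forall>\<^sub>F n in sequentially. - ((?B n)\<^sup>2 / L n / (2 * b\<^sup>2) + \<epsilon> n * sqrt (L n) * (a + \<kappa> n) + \<epsilon> n * sqrt (L n) * (?B n / L n) / b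
      + (\<epsilon> n * sqrt (L n))\<^sup>2 * (1 / L n) / 2) - (ln (y n / sqrt (L n)) - ln a)
      = (a\<^sup>2 / 2 * L n - (y n)\<^sup>2 / 2 - ln (y n) - ln (2 * pi) / 2) - (excess n - ln a - ln (2 * pi) / 2)"
    using L_pos y ypos
  proof eventually_elim
    case (elim n)
    define s where "s = sqrt (L n)"
    have s: "L n = s * s" "0 < s" using elim by (auto simp: s_def)
    define B where "B = ?B n"
    define R where "R = B\<^sup>2 / L n / (2 * b\<^sup>2)
      + \<epsilon> n * sqrt (L n) * (a + \<kappa> n) + \<epsilon> n * sqrt (L n) * (B / L n) / b + (\<epsilon> n * sqrt (L n))\<^sup>2 * (1 / L n) / 2"
    have "ln (y n / sqrt (L n)) = ln (y n) - ln (L n) / 2"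
      using elim by (simp add: ln_div ln_sqrt)
    moreover have "(y n)\<^sup>2 / 2 = (a + \<kappa> n)\<^sup>2 * L n / 2 + (a + \<kappa> n) * B / b + R"
    proof -
      have "((a + \<kappa> n) * s + B / (b * s) + \<epsilon> n)\<^sup>2 / 2 = (a + \<kappa> n)\<^sup>2 * (s * s) / 2 + (a + \<kappa> n) * B / b + (B\<^sup>2 / (s * s) / (2 * b\<^sup>2)
        + \<epsilon> n * s * (a + \<kappa> n) + \<epsilon> n * s * (B / (s * s)) / b + (\<epsilon> n * s)\<^sup>2 * (1 / (s * s)) / 2)"
        using s ab by (simp add: field_simps power2_eq_square)
      then show ?thesis by (simp only: elim(2) s_def[symmetric] s(1)[symmetric] B_def R_def)
    qed
    ultimately show ?case
      unfolding B_def[symmetric] R_def[symmetric] excess_def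
      by (simp add: power2_eq_square add_divide_distrib distrib_left distrib_right)
  qed
  ultimately show ?thesis by (rule Lim_transform_eventually)
qed

lemma tail_tendsto:
  assumes "excess \<longlonglongrightarrow> \<phi>"
  shows "(\<lambda>n. exp (a\<^sup>2 / 2 * L n) * gauss_tail (y n)) \<longlonglongrightarrow> exp (\<phi> - ln a - ln (2 * pi) / 2)"
proof (rule gauss_tail_scaled_tendsto[OF y_at_top])
  have "(\<lambda>n. ((a\<^sup>2 / 2 * L n - (y n)\<^sup>2 / 2 - ln (y n) - ln (2 * pi) / 2) - (excess n - ln a - ln (2 * pi) / 2))
      + (excess n - ln a - ln (2 * pi) / 2)) \<longlonglongrightarrow> 0 + (\<phi> - ln a - ln (2 * pi) / 2)"
    by (intro tendsto_intros exponent_expansion assms)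
  then show "(\<lambda>n. exp (a\<^sup>2 / 2 * L n - (y n)\<^sup>2 / 2 - ln (y n) - ln (2 * pi) / 2)) \<longlonglongrightarrow> exp (\<phi> - ln a - ln (2 * pi) / 2)"
    by (intro tendsto_exp) (simp only: diff_add_cancel add_0)
qed

lemma tail_tendsto_0:
  assumes "filterlim excess at_bot sequentially"
  shows "(\<lambda>n. exp (a\<^sup>2 / 2 * L n) * gauss_tail (y n)) \<longlonglongrightarrow> 0"
proof (rule gauss_tail_scaled_tendsto[OF y_at_top])
  have "filterlim (\<lambda>n. (((a\<^sup>2 / 2 * L n - (y n)\<^sup>2 / 2 - ln (y n) - ln (2 * pi) / 2) - (excess n - ln a - ln (2 * pi) / 2))
      + (- ln a - ln (2 * pi) / 2)) + excess n) at_bot sequentially"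
    by (rule filterlim_tendsto_add_at_bot_iff[OF tendsto_add[OF exponent_expansion tendsto_const], THEN iffD2, OF assms])
  then have "filterlim (\<lambda>n. a\<^sup>2 / 2 * L n - (y n)\<^sup>2 / 2 - ln (y n) - ln (2 * pi) / 2) at_bot sequentially"
    by (simp add: algebra_simps)
  then show "(\<lambda>n. exp (a\<^sup>2 / 2 * L n - (y n)\<^sup>2 / 2 - ln (y n) - ln (2 * pi) / 2)) \<longlonglongrightarrow> 0"
    by (rule filterlim_compose[OF exp_at_bot])
qed

end

section \<open>Comparison of the maximal correlation with the innovations\<close>

text \<open>Two columns make the set of correlations nonempty, which the characterization of
  \<open>Max\<close> requires.\<close>

lemma L_stat_le_iff:
  assumes "2 \<le> p"
  shows "L_stat n p x \<le> v \<longleftrightarrow> (\<forall>j<p. \<forall>i<j. rho_hat n x i j \<le> v)"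
proof -
  let ?S = "{rho_hat n x i j | i j. i < j \<and> j < p}"
  have "?S \<subseteq> (\<lambda>(i, j). rho_hat n x i j) ` ({..<p} \<times> {..<p})" by force
  then have "finite ?S" by (rule finite_subset) auto
  moreover have "rho_hat n x 0 1 \<in> ?S" using assms by force
  ultimately show ?thesis unfolding L_stat_def by (subst Max_le_iff) auto
qed

lemma rho_hat_measurable:
  fixes Y :: "nat \<Rightarrow> nat \<Rightarrow> 'a \<Rightarrow> real"
  assumes "\<And>k l. k < n \<Longrightarrow> l < p \<Longrightarrow> Y k l \<in> borel_measurable N" "i < p" "j < p"
  shows "(\<lambda>x. rho_hat n (\<lambda>k i. Y k i x) i j) \<in> borel_measurable N"
proof -
  have [measurable]: "(\<lambda>x. \<Sum>k<n. Y k i x * Y k j x) \<in> borel_measurable N" "(\<lambda>x. \<Sum>k<n. (Y k i x)\<^sup>2) \<in> borel_measurable N"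
    "(\<lambda>x. \<Sum>k<n. (Y k j x)\<^sup>2) \<in> borel_measurable N"
    using assms by (auto intro!: borel_measurable_sum borel_measurable_times borel_measurable_power)
  show ?thesis unfolding rho_hat_def by measurable
qed

lemma L_stat_le_event:
  assumes "\<And>k l. k < n \<Longrightarrow> l < p \<Longrightarrow> Y k l \<in> borel_measurable N" "2 \<le> p"
  shows "{x\<in>space N. L_stat n p (\<lambda>k i. Y k i x) \<le> v} \<in> sets N"
proof -
  have "{x\<in>space N. L_stat n p (\<lambda>k i. Y k i x) \<le> v}
    = {x\<in>space N. \<forall>j\<in>{..<p}. \<forall>i\<in>{..<j}. rho_hat n (\<lambda>k i. Y k i x) i j \<le> v}"
    using L_stat_le_iff[OF assms(2)] by auto
  also have "\<dots> \<in> sets N"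
    by (intro sets.sets_Collect_finite_All borel_measurable_le rho_hat_measurable[OF assms(1)] borel_measurable_const) auto
  finally show ?thesis .
qed

context gaussian_array
begin

text \<open>The event on which \<open>rho_hat_approximation\<close> is applied: norms control the
  diagonal products, projections the off-diagonal ones.\<close>

definition typical :: "real \<Rightarrow> real \<Rightarrow> 'a set" where
  "typical \<eta> t = {x\<in>space M. (\<forall>i<p. \<bar>sqnorm i x - real n\<bar> \<le> real n * \<eta>) \<and> (\<forall>j<p. \<forall>i<j. \<bar>proj i j x\<bar> \<le> t)}"

lemma typical_event: "typical \<eta> t \<in> events"
proof -
  have "typical \<eta> t = {x\<in>space M. (\<forall>i\<in>{..<p}. \<bar>sqnorm i x - real n\<bar> \<le> real n * \<eta>) \<and> (\<forall>j\<in>{..<p}. \<forall>i\<in>{..<j}. \<bar>proj i j x\<bar> \<le> t)}"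
    by (auto simp: typical_def)
  also have "\<dots> \<in> events"
    by (intro sets.sets_Collect_finite_All sets.sets_Collect_conj borel_measurable_le borel_measurable_abs
        borel_measurable_diff sqnorm_measurable proj_measurable borel_measurable_const) auto
  finally show ?thesis .
qed

lemma prob_not_typical:
  assumes e: "0 < \<eta>" "\<eta> \<le> 1"
  shows "prob (space M - typical \<eta> t) \<le> real p * (2 * exp (- (real n * \<eta>\<^sup>2 / 16))) + (real p)\<^sup>2 * (2 * gauss_tail t)"
proof -
  define A where "A = (\<lambda>i. {x\<in>space M. real n * (1 + \<eta>) < sqnorm i x} \<union> {x\<in>space M. sqnorm i x < real n * (1 - \<eta>)})"
  define B where "B = (\<lambda>(j, i). if i < j then {x\<in>space M. t < \<bar>proj i j x\<bar>} else {})"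
  have A1: "{x\<in>space M. real n * (1 + \<eta>) < sqnorm i x} \<in> events"
    and A2: "{x\<in>space M. sqnorm i x < real n * (1 - \<eta>)} \<in> events" if "i < p" for i
    using sqnorm_measurable[OF that] by measurable
  have A: "A i \<in> events" if "i < p" for i unfolding A_def using A1[OF that] A2[OF that] by auto
  have B: "B (j, i) \<in> events" if "j < p" for i j
  proof (cases "i < j")
    case True
    then have [measurable]: "proj i j \<in> borel_measurable M" using that by (intro proj_measurable) auto
    show ?thesis unfolding B_def using True by simp
  qed (auto simp: B_def)
  have pA: "prob (A i) \<le> 2 * exp (- (real n * \<eta>\<^sup>2 / 16))" if "i < p" for i
  proof -
    have "prob (A i) \<le> prob {x\<in>space M. real n * (1 + \<eta>) < sqnorm i x} + prob {x\<in>space M. sqnorm i x < real n * (1 - \<eta>)}"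
      unfolding A_def by (intro measure_Un_le A1 A2 that)
    also have "\<dots> \<le> exp (- (real n * \<eta>\<^sup>2 / 16)) + exp (- (real n * \<eta>\<^sup>2 / 8))"
      using that e by (intro add_mono prob_sqnorm_gt prob_sqnorm_lt)
    also have "exp (- (real n * \<eta>\<^sup>2 / 8)) \<le> exp (- (real n * \<eta>\<^sup>2 / 16))" by simp
    finally show ?thesis by simp
  qed
  have pB: "prob (B z) \<le> 2 * gauss_tail t" if "z \<in> {..<p} \<times> {..<p}" for z
    using that prob_abs_proj[of "snd z" "fst z" t] gauss_tail_nonneg[of t] by (auto simp: B_def)
  have "space M - typical \<eta> t \<subseteq> (\<Union>i<p. A i) \<union> (\<Union>z\<in>{..<p} \<times> {..<p}. B z)"
  proof
    fix x assume x: "x \<in> space M - typical \<eta> t"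
    then consider i where "i < p" "\<not> \<bar>sqnorm i x - real n\<bar> \<le> real n * \<eta>" | i j where "j < p" "i < j" "\<not> \<bar>proj i j x\<bar> \<le> t"
      by (auto simp: typical_def)
    then show "x \<in> (\<Union>i<p. A i) \<union> (\<Union>z\<in>{..<p} \<times> {..<p}. B z)"
    proof cases
      case 1
      then have "x \<in> A i" using x by (auto simp: A_def algebra_simps abs_le_iff)
      then show ?thesis using 1 by auto
    next
      case 2
      then have "x \<in> B (j, i)" "(j, i) \<in> {..<p} \<times> {..<p}" using x by (auto simp: B_def)
      then show ?thesis by blast
    qed
  qed
  moreover have eA: "(\<Union>i<p. A i) \<in> events" using A by auto
  moreover have eB: "(\<Union>z\<in>{..<p} \<times> {..<p}. B z) \<in> events" using B by (intro sets.finite_UN) auto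
  ultimately have "prob (space M - typical \<eta> t) \<le> prob ((\<Union>i<p. A i) \<union> (\<Union>z\<in>{..<p} \<times> {..<p}. B z))"
    by (intro finite_measure_mono) auto
  also have "\<dots> \<le> prob (\<Union>i<p. A i) + prob (\<Union>z\<in>{..<p} \<times> {..<p}. B z)" using eA eB by (rule measure_Un_le)
  also have "\<dots> \<le> (\<Sum>i<p. prob (A i)) + (\<Sum>z\<in>{..<p} \<times> {..<p}. prob (B z))"
    using A B by (intro add_mono finite_measure_subadditive_finite) auto
  also have "\<dots> \<le> (\<Sum>i<p. 2 * exp (- (real n * \<eta>\<^sup>2 / 16))) + (\<Sum>z\<in>{..<p} \<times> {..<p}. 2 * gauss_tail t)"
    using pA pB by (intro add_mono sum_mono) auto
  finally show ?thesis by (simp add: power2_eq_square)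
qed

lemma typical_approximation:
  assumes x: "x \<in> typical c t" and c: "c \<le> 1 / 8" and t: "2 * t \<le> sqrt n * c" and r: "0 \<le> r" "r \<le> c"
    and Y0: "\<And>k. Y k 0 = Z k 0 x"
    and YS: "\<And>k i. Suc i < p \<Longrightarrow> Y k (Suc i) = r * Y k i + sqrt (1 - r\<^sup>2) * Z k (Suc i) x"
    and ij: "i < j" "j < p"
  shows "\<bar>sqrt n * rho_hat n Y i j - (proj i j x + (if j = Suc i then sqrt n * r else 0))\<bar> \<le> 26 * sqrt n * c\<^sup>2"
proof -
  have sq: "sqnorm l x = (\<Sum>k<n. Z k l x * Z k l x)" for l by (simp add: sqnorm_def power2_eq_square)
  have sqb: "\<bar>sqnorm l x - real n\<bar> \<le> real n * c" if "l < p" for l using x that by (simp add: typical_def)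
  have nc: "real n * c \<le> real n / 8" using mult_left_mono[OF c, of "real n"] by simp
  have sqpos: "0 < sqnorm l x" "sqnorm l x \<le> 4 * real n" if "l < p" for l
  proof -
    have "0 < real n" using n_pos by simp
    then show "0 < sqnorm l x" "sqnorm l x \<le> 4 * real n"
      using sqb[OF that] nc by (simp_all only: abs_le_iff) linarith+
  qed
  have pr: "proj l m x = (\<Sum>k<n. Z k l x * Z k m x) / sqrt (sqnorm l x)" if "l < p" for l m
    using sqpos[OF that] unfolding proj_def sqnorm_def by (subst unit_dir_inner) auto
  have off: "\<bar>\<Sum>k<n. Z k l x * Z k m x\<bar> \<le> real n * c" if "l < m" "m < p" for l m
  proof -
    have "(\<Sum>k<n. Z k l x * Z k m x) = proj l m x * sqrt (sqnorm l x)"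
      using pr[of l m] sqpos[of l] that by auto
    then have "\<bar>\<Sum>k<n. Z k l x * Z k m x\<bar> = \<bar>proj l m x\<bar> * sqrt (sqnorm l x)"
      using sqpos[of l] that by (simp add: abs_mult)
    \<comment> \<open>The crude bound 4n on the squared norm is enough; the hypothesis on t then
      turns 2 t sqrt n into n c.\<close>
    also have "\<dots> \<le> t * sqrt (4 * real n)"
      using x that sqpos[of l] by (intro mult_mono) (auto simp: typical_def intro!: order_trans[OF abs_ge_zero, of "proj l m x" t])
    also have "\<dots> = 2 * t * sqrt n" by (simp add: real_sqrt_mult)
    also have "\<dots> \<le> sqrt n * c * sqrt n" using t by (intro mult_right_mono) auto
    finally show ?thesis by (simp add: mult.commute mult.left_commute)
  qed
  have "\<bar>sqrt n * rho_hat n Y i j - ((\<Sum>k<n. Z k i x * Z k j x) / sqrt (\<Sum>k<n. Z k i x * Z k i x) + (if j = Suc i then sqrt n * r else 0))\<bar>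
    \<le> 26 * sqrt n * c\<^sup>2"
    by (rule rho_hat_approximation[where p=p and s="sqrt (1 - r\<^sup>2)" and E="\<lambda>k i. Z k i x"])
      (use n_pos Y0 YS r c sqb off ij in \<open>auto simp: sq\<close>)
  then show ?thesis using pr[of i j] ij by (simp add: sq)
qed

text \<open>On the typical event every scaled correlation is within e of its projection plus shift.
  Moving the shift into the adjacent cutoff and widening or narrowing all cutoffs by e gives two
  inclusions, each up to atypical outcomes.\<close>

lemma L_stat_sandwich:
  fixes Y :: "nat \<Rightarrow> nat \<Rightarrow> 'a \<Rightarrow> real"
  assumes p: "2 \<le> p" and c: "0 < c" "c \<le> 1 / 8" and t: "2 * t \<le> sqrt n * c" and r: "0 \<le> r" "r \<le> c"
    and Y0: "\<And>k x. Y k 0 x = Z k 0 x"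
    and YS: "\<And>k i x. Suc i < p \<Longrightarrow> Y k (Suc i) x = r * Y k i x + sqrt (1 - r\<^sup>2) * Z k (Suc i) x"
    and Ym: "\<And>k i. k < n \<Longrightarrow> i < p \<Longrightarrow> Y k i \<in> borel_measurable M"
  defines "e \<equiv> 26 * sqrt n * c\<^sup>2"
  shows "prob {x\<in>space M. L_stat n p (\<lambda>k i. Y k i x) \<le> y / sqrt n}
      \<le> prob (below (cutoff (y + e) (y - sqrt n * r + e)) p) + prob (space M - typical c t)"
    and "prob (below (cutoff (y - e) (y - sqrt n * r - e)) p) - prob (space M - typical c t)
      \<le> prob {x\<in>space M. L_stat n p (\<lambda>k i. Y k i x) \<le> y / sqrt n}"
proof -
  define S where "S = {x\<in>space M. L_stat n p (\<lambda>k i. Y k i x) \<le> y / sqrt n}"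
  have Seq: "S = {x\<in>space M. \<forall>j\<in>{..<p}. \<forall>i\<in>{..<j}. rho_hat n (\<lambda>k i. Y k i x) i j \<le> y / sqrt n}"
    unfolding S_def using L_stat_le_iff[OF p] by auto
  have S: "S \<in> events" unfolding S_def by (rule L_stat_le_event[OF Ym p])
  have sn: "0 < sqrt (real n)" using n_pos by simp
  have app: "\<bar>sqrt n * rho_hat n (\<lambda>k i. Y k i x) i j - (proj i j x + (if j = Suc i then sqrt n * r else 0))\<bar> \<le> e"
    if "x \<in> typical c t" "i < j" "j < p" for x i j
    unfolding e_def using typical_approximation[OF that(1) c(2) t r _ _ that(2,3), of "\<lambda>k i. Y k i x"] Y0 YS by auto
  have rho_le: "rho_hat n (\<lambda>k i. Y k i x) i j \<le> y / sqrt n \<longleftrightarrow> sqrt n * rho_hat n (\<lambda>k i. Y k i x) i j \<le> y" for x i j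
    using sn by (simp add: pos_le_divide_eq mult.commute)
  have T: "typical c t \<in> events" "space M - typical c t \<in> events" using typical_event by auto
  have b: "below thr p \<in> events" for thr by (rule below_event) simp
  have "S \<subseteq> below (cutoff (y + e) (y - sqrt n * r + e)) p \<union> (space M - typical c t)"
  proof
    fix x assume xS: "x \<in> S"
    show "x \<in> below (cutoff (y + e) (y - sqrt n * r + e)) p \<union> (space M - typical c t)"
    proof (cases "x \<in> typical c t")
      case True
      have "proj i j x \<le> cutoff (y + e) (y - sqrt n * r + e) i j" if "i < j" "j < p" for i j
        using app[OF True that] xS that rho_le[of x i j] by (auto simp: Seq cutoff_def abs_le_iff split: if_splits)
      then show ?thesis using xS by (auto simp: below_def S_def)
    qed (use xS in \<open>auto simp: S_def\<close>)
  qed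
  then have "prob S \<le> prob (below (cutoff (y + e) (y - sqrt n * r + e)) p \<union> (space M - typical c t))"
    using b T by (intro finite_measure_mono) auto
  also have "\<dots> \<le> prob (below (cutoff (y + e) (y - sqrt n * r + e)) p) + prob (space M - typical c t)"
    by (rule measure_Un_le[OF b T(2)])
  finally show "prob {x\<in>space M. L_stat n p (\<lambda>k i. Y k i x) \<le> y / sqrt n}
      \<le> prob (below (cutoff (y + e) (y - sqrt n * r + e)) p) + prob (space M - typical c t)"
    by (simp add: S_def)
  have "below (cutoff (y - e) (y - sqrt n * r - e)) p \<subseteq> S \<union> (space M - typical c t)"
  proof
    fix x assume xb: "x \<in> below (cutoff (y - e) (y - sqrt n * r - e)) p"
    show "x \<in> S \<union> (space M - typical c t)"
    proof (cases "x \<in> typical c t")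
      case True
      have "rho_hat n (\<lambda>k i. Y k i x) i j \<le> y / sqrt n" if "i < j" "j < p" for i j
      proof -
        have "proj i j x \<le> cutoff (y - e) (y - sqrt n * r - e) i j" using xb that by (auto simp: below_def)
        then show ?thesis
          using app[OF True that] unfolding rho_le by (auto simp: cutoff_def abs_le_iff split: if_splits)
      qed
      then show ?thesis using xb by (auto simp: Seq below_def)
    qed (use xb in \<open>auto simp: below_def\<close>)
  qed
  then have "prob (below (cutoff (y - e) (y - sqrt n * r - e)) p) \<le> prob (S \<union> (space M - typical c t))"
    using S T by (intro finite_measure_mono) auto
  also have "\<dots> \<le> prob S + prob (space M - typical c t)" by (rule measure_Un_le[OF S T(2)])
  finally show "prob (below (cutoff (y - e) (y - sqrt n * r - e)) p) - prob (space M - typical c t)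
      \<le> prob {x\<in>space M. L_stat n p (\<lambda>k i. Y k i x) \<le> y / sqrt n}"
    by (simp add: S_def)
qed

end

section \<open>Limits in the growth regime\<close>

text \<open>The total of the \<pi> j tends to \<alpha> + \<beta> while each one is at most b, which
  vanishes, so \<open>prod_one_minus_bounds\<close> pins the product. The limit in \<open>l1\<close>
  is 2 \<alpha> because p^2 counts every pair twice.\<close>

lemma poisson_product_tendsto:
  fixes p :: "nat \<Rightarrow> nat" and q1 q2 :: "nat \<Rightarrow> real"
  assumes p: "filterlim p at_top sequentially"
    and q: "\<And>n. 0 \<le> q1 n" "\<And>n. 0 \<le> q2 n"
    and l1: "(\<lambda>n. (real (p n))\<^sup>2 * q1 n) \<longlonglongrightarrow> 2 * \<alpha>" and l2: "(\<lambda>n. real (p n) * q2 n) \<longlonglongrightarrow> \<beta>"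
  shows "(\<lambda>n. \<Prod>j<p n. 1 - (if j = 0 then 0 else real (j - 1) * q1 n + q2 n)) \<longlonglongrightarrow> exp (- \<alpha> - \<beta>)"
    and "(\<lambda>n. real (p n) * q1 n + q2 n) \<longlonglongrightarrow> 0"
proof -
  have pr: "filterlim (\<lambda>n. real (p n)) at_top sequentially"
    by (rule filterlim_compose[OF filterlim_real_sequentially p])
  have ip: "(\<lambda>n. 1 / real (p n)) \<longlonglongrightarrow> 0"
    by (intro tendsto_divide_0[OF tendsto_const] filterlim_at_top_imp_at_infinity pr)
  have p1: "\<forall>\<^sub>F n in sequentially. 1 \<le> p n" using p by (simp add: filterlim_at_top)
  define b where "b = (\<lambda>n. real (p n) * q1 n + q2 n)"
  have "(\<lambda>n. (real (p n))\<^sup>2 * q1 n * (1 / real (p n)) + real (p n) * q2 n * (1 / real (p n))) \<longlonglongrightarrow> 2 * \<alpha> * 0 + \<beta> * 0"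
    by (intro tendsto_intros l1 l2 ip)
  moreover have "\<forall>\<^sub>F n in sequentially. (real (p n))\<^sup>2 * q1 n * (1 / real (p n)) + real (p n) * q2 n * (1 / real (p n)) = b n"
    using p1 by eventually_elim (auto simp: b_def power2_eq_square)
  ultimately have b: "b \<longlonglongrightarrow> 2 * \<alpha> * 0 + \<beta> * 0" by (rule Lim_transform_eventually)
  then show "(\<lambda>n. real (p n) * q1 n + q2 n) \<longlonglongrightarrow> 0" by (simp add: b_def)
  define \<pi> where "\<pi> = (\<lambda>n j. if j = 0 then 0 else real (j - 1) * q1 n + q2 n)"
  \<comment> \<open>For p = m + 1 columns there are m (m - 1) / 2 distant and m adjacent
    pairs.\<close>
  have sumSuc: "(\<Sum>j<Suc m. \<pi> n j) = real m * (real m - 1) / 2 * q1 n + real m * q2 n" for m n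
    by (induction m) (auto simp: \<pi>_def field_simps)
  define \<Lambda> where "\<Lambda> = (\<lambda>n. \<Sum>j<p n. \<pi> n j)"
  have "(\<lambda>n. (real (p n))\<^sup>2 * q1 n * ((1 - 1 / real (p n)) * (1 - 2 * (1 / real (p n))) / 2) + real (p n) * q2 n * (1 - 1 / real (p n)))
     \<longlonglongrightarrow> 2 * \<alpha> * ((1 - 0) * (1 - 2 * 0) / 2) + \<beta> * (1 - 0)"
    by (intro tendsto_intros l1 l2 ip) auto
  moreover have "\<forall>\<^sub>F n in sequentially. (real (p n))\<^sup>2 * q1 n * ((1 - 1 / real (p n)) * (1 - 2 * (1 / real (p n))) / 2) + real (p n) * q2 n * (1 - 1 / real (p n)) = \<Lambda> n"
    using p1
  proof eventually_elim
    case (elim n)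
    then obtain m where m: "p n = Suc m" by (cases "p n") auto
    have "x\<^sup>2 * q1 n * ((1 - 1 / x) * (1 - 2 * (1 / x)) / 2) + x * q2 n * (1 - 1 / x)
      = (x - 1) * (x - 1 - 1) / 2 * q1 n + (x - 1) * q2 n" if "0 < x" for x
      using that by (simp add: field_simps power2_eq_square)
    from this[of "real (p n)"] show ?case unfolding \<Lambda>_def m sumSuc by simp
  qed
  ultimately have L: "\<Lambda> \<longlonglongrightarrow> 2 * \<alpha> * ((1 - 0) * (1 - 2 * 0) / 2) + \<beta> * (1 - 0)" by (rule Lim_transform_eventually)
  then have L: "\<Lambda> \<longlonglongrightarrow> \<alpha> + \<beta>" by simp
  have "\<forall>\<^sub>F n in sequentially. b n < 1 / 2" using b by (intro order_tendstoD) auto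
  then have bounds: "\<forall>\<^sub>F n in sequentially. (\<Prod>j<p n. 1 - \<pi> n j) \<le> exp (- \<Lambda> n) \<and> exp (- ((1 + 2 * b n) * \<Lambda> n)) \<le> (\<Prod>j<p n. 1 - \<pi> n j)"
  proof eventually_elim
    case (elim n)
    have "0 \<le> \<pi> n j \<and> \<pi> n j \<le> b n" if "j < p n" for j
    proof -
      have "real (j - 1) * q1 n \<le> real (p n) * q1 n" using that q by (intro mult_right_mono) auto
      then show ?thesis using q by (auto simp: \<pi>_def b_def)
    qed
    then show ?case unfolding \<Lambda>_def using prod_one_minus_bounds[of "p n" "\<pi> n" "b n"] elim by auto
  qed
  have "(\<lambda>n. \<Prod>j<p n. 1 - \<pi> n j) \<longlonglongrightarrow> exp (- (\<alpha> + \<beta>))"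
  proof (rule tendsto_sandwich)
    show "\<forall>\<^sub>F n in sequentially. exp (- ((1 + 2 * b n) * \<Lambda> n)) \<le> (\<Prod>j<p n. 1 - \<pi> n j)"
      using bounds by eventually_elim simp
    show "\<forall>\<^sub>F n in sequentially. (\<Prod>j<p n. 1 - \<pi> n j) \<le> exp (- \<Lambda> n)"
      using bounds by eventually_elim simp
    show "(\<lambda>n. exp (- \<Lambda> n)) \<longlonglongrightarrow> exp (- (\<alpha> + \<beta>))" by (intro tendsto_intros L)
    have "(\<lambda>n. exp (- ((1 + 2 * b n) * \<Lambda> n))) \<longlonglongrightarrow> exp (- ((1 + 2 * (2 * \<alpha> * 0 + \<beta> * 0)) * (\<alpha> + \<beta>)))"
      by (intro tendsto_intros L b)
    then show "(\<lambda>n. exp (- ((1 + 2 * b n) * \<Lambda> n))) \<longlonglongrightarrow> exp (- (\<alpha> + \<beta>))" by simp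
  qed
  then show "(\<lambda>n. \<Prod>j<p n. 1 - (if j = 0 then 0 else real (j - 1) * q1 n + q2 n)) \<longlonglongrightarrow> exp (- \<alpha> - \<beta>)"
    by (simp add: \<pi>_def)
qed

lemma exp_mult_tendsto_0:
  fixes f g :: "nat \<Rightarrow> real"
  assumes "filterlim f at_top sequentially" "g \<longlonglongrightarrow> l" "l < 0"
  shows "(\<lambda>n. exp (g n * f n)) \<longlonglongrightarrow> 0"
  by (rule filterlim_compose[OF exp_at_bot filterlim_tendsto_neg_mult_at_bot[OF assms(2,3,1)]])

locale growth_regime =
  fixes p :: "nat \<Rightarrow> nat"
  assumes p_lim: "filterlim p at_top sequentially"
    and logp: "(\<lambda>n. ln (real (p n)) / real n powr (1/5)) \<longlonglongrightarrow> 0"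
begin

definition "L (n::nat) = ln (real (p n))"

definition "rate (n::nat) = sqrt (L n / real n)"

text \<open>The factor 16 serves three purposes: n * radius^2 / 16 = 16 L makes a norm failure cost
  about p^(-16) per column; r is eventually below, since r / rate tends to 2 - sqrt 2; and 2 * level
  \<le> sqrt n * radius.\<close>

definition "radius (n::nat) = 16 * rate n"

text \<open>At this height the Gaussian tail is at most p^(-8), enough against p^3 triples.\<close>

definition "level (n::nat) = 4 * sqrt (L n)"

text \<open>The error e of \<open>L_stat_sandwich\<close> at c = radius, of order L / sqrt
  n.\<close>

definition "slack (n::nat) = 26 * sqrt (real n) * (radius n)\<^sup>2"

lemma L_at_top: "filterlim L at_top sequentially"
  unfolding L_def
  by (rule filterlim_compose[OF ln_at_top filterlim_compose[OF filterlim_real_sequentially p_lim]])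

lemma L_gt: "\<forall>\<^sub>F n in sequentially. c < L n"
  using L_at_top by (simp add: filterlim_at_top_dense)

lemma p_ge: "\<forall>\<^sub>F n in sequentially. m \<le> p n"
  using p_lim by (simp add: filterlim_at_top)

lemma p_exp: "\<forall>\<^sub>F n in sequentially. real (p n) = exp (L n)"
  using p_ge[of 1] by eventually_elim (auto simp: L_def)

lemma L_over_n: "(\<lambda>n. L n / real n) \<longlonglongrightarrow> 0"
proof -
  have "(\<lambda>n. real n powr (-4/5)) \<longlonglongrightarrow> 0" by real_asymp
  from tendsto_mult[OF logp this]
  have "(\<lambda>n. L n / real n powr (1/5) * real n powr (-4/5)) \<longlonglongrightarrow> 0" by (simp add: L_def)
  moreover have "\<forall>\<^sub>F n in sequentially. L n / real n powr (1/5) * real n powr (-4/5) = L n / real n"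
    using eventually_gt_at_top[of 0]
  proof eventually_elim
    case (elim n)
    have "real n powr (1/5) * real n powr (4/5) = real n" using elim by (simp add: powr_add[symmetric])
    then show ?case using elim by (simp add: powr_minus field_simps)
  qed
  ultimately show ?thesis by (rule Lim_transform_eventually)
qed

lemma rate_tendsto: "rate \<longlonglongrightarrow> 0"
  using tendsto_real_sqrt[OF L_over_n] by (simp add: rate_def[abs_def])

lemma radius_tendsto: "radius \<longlonglongrightarrow> 0"
  using tendsto_mult[OF tendsto_const rate_tendsto, of 16] by (simp add: radius_def[abs_def])

lemma slack_tendsto: "(\<lambda>n. slack n * sqrt (L n)) \<longlonglongrightarrow> 0"
proof -
  have "(\<lambda>n. (ln (real (p n)) / real n powr (1/5)) powr (3/2)) \<longlonglongrightarrow> 0 powr (3/2)"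
    using L_gt[of 0] by (intro tendsto_powr2 logp tendsto_const) (auto simp: L_def elim: eventually_mono)
  then have "(\<lambda>n. (L n / real n powr (1/5)) powr (3/2)) \<longlonglongrightarrow> 0" by (simp add: L_def)
  moreover have "(\<lambda>n. real n powr (-1/5)) \<longlonglongrightarrow> 0" by real_asymp
  ultimately have "(\<lambda>n. 26 * 256 * ((L n / real n powr (1/5)) powr (3/2) * real n powr (-1/5))) \<longlonglongrightarrow> 26 * 256 * (0 * 0)"
    by (intro tendsto_mult tendsto_const)
  \<comment> \<open>Here 256 = 16^2, and L^(3/2) n^(-1/2) splits as (L / n^(1/5))^(3/2) n^(-1/5)
    because 3/10 + 1/5 = 1/2.\<close>
  moreover have "\<forall>\<^sub>F n in sequentially. 26 * 256 * ((L n / real n powr (1/5)) powr (3/2) * real n powr (-1/5)) = slack n * sqrt (L n)"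
    using L_gt[of 0] eventually_gt_at_top[of 0]
  proof eventually_elim
    case (elim n)
    have "(radius n)\<^sup>2 = 256 * (L n / real n)"
      using elim by (simp add: radius_def rate_def power_mult_distrib)
    then have "slack n * sqrt (L n) = 26 * 256 * (L n * sqrt (L n) * (sqrt (real n) / real n))"
      by (simp add: slack_def)
    also have "L n * sqrt (L n) = L n powr (3/2)"
      using elim by (simp add: powr_half_sqrt[symmetric] powr_mult_base)
    also have "sqrt (real n) / real n = real n powr (-1/2)"
    proof -
      have "real n powr (-1/2) = 1 / sqrt (real n)"
        using elim powr_minus_divide[of "real n" "1/2"] by (simp add: powr_half_sqrt)
      moreover have "s / (s * s) = 1 / s" for s :: real by simp
      from this[of "sqrt (real n)"] have "sqrt (real n) / real n = 1 / sqrt (real n)" by (simp only: real_sqrt_mult_self abs_of_nat)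
      ultimately show ?thesis by simp
    qed
    also have "L n powr (3/2) * real n powr (-1/2) = (L n / real n powr (1/5)) powr (3/2) * real n powr (-1/5)"
      using elim by (simp add: powr_divide powr_powr powr_minus powr_add[symmetric] field_simps)
    finally show ?case by simp
  qed
  ultimately have "(\<lambda>n. slack n * sqrt (L n)) \<longlonglongrightarrow> 26 * 256 * (0 * 0)" by (rule Lim_transform_eventually)
  then show ?thesis by simp
qed

lemma not_typical_tendsto:
  "(\<lambda>n. real (p n) * (2 * exp (- (real n * (radius n)\<^sup>2 / 16))) + (real (p n))\<^sup>2 * (2 * gauss_tail (level n))) \<longlonglongrightarrow> 0" (is "?E \<longlonglongrightarrow> 0")
proof (rule tendsto_sandwich[OF _ _ tendsto_const])
  show "\<forall>\<^sub>F n in sequentially. 0 \<le> ?E n"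
    by (auto simp: gauss_tail_nonneg)
  show "\<forall>\<^sub>F n in sequentially. ?E n
    \<le> 2 * exp (-15 * L n) + 2 * exp (-6 * L n)"
    using L_gt[of 1] p_exp eventually_gt_at_top[of 0]
  proof eventually_elim
    case (elim n)
    have 1: "real n * (radius n)\<^sup>2 / 16 = 16 * L n"
      using elim by (simp add: radius_def rate_def power_mult_distrib)
    have "1 \<le> level n" using order_trans[OF _ mult_left_mono[OF real_sqrt_ge_one[of "L n"], of 4], of 1] elim by (simp add: level_def)
    then have "gauss_tail (level n) \<le> exp (- (level n)\<^sup>2 / 2)" by (rule gauss_tail_exp_bound)
    also have "- (level n)\<^sup>2 / 2 = - 8 * L n" using elim by (simp add: level_def power_mult_distrib)
    finally have "(real (p n))\<^sup>2 * (2 * gauss_tail (level n)) \<le> (real (p n))\<^sup>2 * (2 * exp (- 8 * L n))"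
      by (intro mult_left_mono) auto
    also have "\<dots> = 2 * exp (- 6 * L n)"
      unfolding elim(2) by (simp add: power2_eq_square exp_add[symmetric])
    finally have "(real (p n))\<^sup>2 * (2 * gauss_tail (level n)) \<le> 2 * exp (- 6 * L n)" .
    moreover have "exp (L n) * (2 * exp (- (16 * L n))) = 2 * exp (- 15 * L n)" by (simp add: exp_add[symmetric])
    ultimately show ?case unfolding 1 elim(2) by linarith
  qed
  have "((\<lambda>z::real. 2 * exp (-15 * z) + 2 * exp (-6 * z)) \<longlongrightarrow> 0) at_top" by real_asymp
  from filterlim_compose[OF this L_at_top] show "(\<lambda>n. 2 * exp (-15 * L n) + 2 * exp (-6 * L n)) \<longlonglongrightarrow> 0" .
qed

text \<open>In powers of p the exponents tend to 3 - 8 for the level, 3 - 4 for two distant pairs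
  and 2 - 3 for a mixed pair; the norm term is exponentially small in n since L / n vanishes. Each
  term is written as exp(g f) with g tending to a negative limit and f to infinity.\<close>

lemma pair_error_tendsto:
  assumes y1: "(\<lambda>n. y1 n / sqrt (L n)) \<longlonglongrightarrow> 2" and y2: "(\<lambda>n. y2 n / sqrt (L n)) \<longlonglongrightarrow> sqrt 2"
  defines "\<delta> \<equiv> \<lambda>n. 2 * level n / sqrt (real n)"
  shows "(\<lambda>n. real (p n) ^ 3 * (2 * gauss_tail (level n) + exp (- (9 / 128 * real n)) + exp (- ((y1 n)\<^sup>2 / (1 + \<delta> n))))
      + real (p n) ^ 2 * exp (- (((y1 n)\<^sup>2 + (y2 n)\<^sup>2) / (2 * (1 + \<delta> n))))) \<longlonglongrightarrow> 0" (is "?E \<longlonglongrightarrow> 0")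
    and "\<delta> \<longlonglongrightarrow> 0"
proof -
  have "\<delta> = (\<lambda>n. 8 * rate n)" by (simp add: \<delta>_def level_def rate_def real_sqrt_divide)
  then show d: "\<delta> \<longlonglongrightarrow> 0" using tendsto_mult[OF tendsto_const rate_tendsto, of 8] by simp
  have d0: "\<forall>\<^sub>F n in sequentially. 0 \<le> \<delta> n"
    using L_gt[of 0] by eventually_elim (simp add: \<delta>_def level_def)
  have n: "filterlim (\<lambda>n. real n) at_top sequentially" by (rule filterlim_real_sequentially)
  have e1: "(\<lambda>n. exp ((-5) * L n)) \<longlonglongrightarrow> 0"
    by (rule exp_mult_tendsto_0[OF L_at_top tendsto_const]) simp
  have e2: "(\<lambda>n. exp ((3 * (L n / real n) - 9 / 128) * real n)) \<longlonglongrightarrow> 0"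
  proof (rule exp_mult_tendsto_0[OF n])
    show "(\<lambda>n. 3 * (L n / real n) - 9 / 128) \<longlonglongrightarrow> 3 * 0 - 9 / 128" by (intro tendsto_intros L_over_n)
  qed simp
  have e3: "(\<lambda>n. exp ((3 - (y1 n / sqrt (L n))\<^sup>2 / (1 + \<delta> n)) * L n)) \<longlonglongrightarrow> 0"
  proof (rule exp_mult_tendsto_0[OF L_at_top])
    show "(\<lambda>n. 3 - (y1 n / sqrt (L n))\<^sup>2 / (1 + \<delta> n)) \<longlonglongrightarrow> 3 - 2\<^sup>2 / (1 + 0)" by (intro tendsto_intros y1 d) simp
  qed simp
  have e4: "(\<lambda>n. exp ((2 - ((y1 n / sqrt (L n))\<^sup>2 + (y2 n / sqrt (L n))\<^sup>2) / (2 * (1 + \<delta> n))) * L n)) \<longlonglongrightarrow> 0"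
  proof (rule exp_mult_tendsto_0[OF L_at_top])
    show "(\<lambda>n. 2 - ((y1 n / sqrt (L n))\<^sup>2 + (y2 n / sqrt (L n))\<^sup>2) / (2 * (1 + \<delta> n))) \<longlonglongrightarrow> 2 - (2\<^sup>2 + (sqrt 2)\<^sup>2) / (2 * (1 + 0))"
      by (intro tendsto_intros y1 y2 d) simp
  qed simp
  let ?B = "\<lambda>n. 2 * exp ((-5) * L n) + exp ((3 * (L n / real n) - 9 / 128) * real n) + exp ((3 - (y1 n / sqrt (L n))\<^sup>2 / (1 + \<delta> n)) * L n)
      + exp ((2 - ((y1 n / sqrt (L n))\<^sup>2 + (y2 n / sqrt (L n))\<^sup>2) / (2 * (1 + \<delta> n))) * L n)"
  show "?E \<longlonglongrightarrow> 0"
  proof (rule tendsto_sandwich[OF _ _ tendsto_const])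
    show "\<forall>\<^sub>F n in sequentially. 0 \<le> ?E n"
      by (intro always_eventually allI add_nonneg_nonneg mult_nonneg_nonneg) (auto simp: gauss_tail_nonneg)
    show "?B \<longlonglongrightarrow> 0"
      using tendsto_add[OF tendsto_add[OF tendsto_add[OF tendsto_mult[OF tendsto_const[of 2] e1] e2] e3] e4] by simp
    show "\<forall>\<^sub>F n in sequentially. ?E n \<le> ?B n"
      using L_gt[of 1] p_exp eventually_gt_at_top[of 0] d0
    proof eventually_elim
      case (elim n)
      have p3: "real (p n) ^ 3 = exp (3 * L n)" "real (p n) ^ 2 = exp (2 * L n)"
        unfolding elim(2) by (simp_all add: exp_of_nat_mult[symmetric])
      have "1 \<le> level n" using order_trans[OF _ mult_left_mono[OF real_sqrt_ge_one[of "L n"], of 4], of 1] elim by (simp add: level_def)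
      then have "gauss_tail (level n) \<le> exp (- (level n)\<^sup>2 / 2)" by (rule gauss_tail_exp_bound)
      also have "- (level n)\<^sup>2 / 2 = - 8 * L n" using elim by (simp add: level_def power_mult_distrib)
      finally have "exp (3 * L n) * (2 * gauss_tail (level n)) \<le> exp (3 * L n) * (2 * exp (- 8 * L n))"
        by (intro mult_left_mono) auto
      also have "\<dots> = 2 * exp ((-5) * L n)" by (simp add: exp_add[symmetric])
      finally have 1: "exp (3 * L n) * (2 * gauss_tail (level n)) \<le> 2 * exp ((-5) * L n)" .
      have 2: "exp (3 * L n) * exp (- (9 / 128 * real n)) = exp ((3 * (L n / real n) - 9 / 128) * real n)"
        using elim by (simp add: exp_add[symmetric] left_diff_distrib)
      have sq: "(y / sqrt (L n))\<^sup>2 = y\<^sup>2 / L n" for y using elim by (simp add: power_divide)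
      have 3: "exp (3 * L n) * exp (- ((y1 n)\<^sup>2 / (1 + \<delta> n))) = exp ((3 - (y1 n / sqrt (L n))\<^sup>2 / (1 + \<delta> n)) * L n)"
        using elim by (simp add: exp_add[symmetric] left_diff_distrib sq)
      have 4: "exp (2 * L n) * exp (- (((y1 n)\<^sup>2 + (y2 n)\<^sup>2) / (2 * (1 + \<delta> n)))) =
        exp ((2 - ((y1 n / sqrt (L n))\<^sup>2 + (y2 n / sqrt (L n))\<^sup>2) / (2 * (1 + \<delta> n))) * L n)"
        using elim by (simp add: exp_add[symmetric] left_diff_distrib sq add_divide_distrib[symmetric])
      have "exp (3 * L n) * (u + v + w) = exp (3 * L n) * u + exp (3 * L n) * v + exp (3 * L n) * w" for u v w
        by (simp add: distrib_left)
      then show ?case unfolding p3 4 using 1 2 3 by simp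
    qed
  qed
qed

end

locale critical_regime = growth_regime p for p :: "nat \<Rightarrow> nat" +
  fixes M :: "nat \<Rightarrow> 'a measure" and X :: "nat \<Rightarrow> nat \<Rightarrow> nat \<Rightarrow> 'a \<Rightarrow> real" and r :: "nat \<Rightarrow> real"
  assumes prob: "\<And>n. prob_space (M n)"
    and gauss: "\<And>n k. k < n \<Longrightarrow> centered_gaussian_vector (M n) (p n) (ar_cov (r n)) (X n k)"
    and indep: "\<And>n. prob_space.indep_vars (M n) (\<lambda>_. PiM {..<p n} (\<lambda>_. borel))
                   (\<lambda>k \<omega>. \<lambda>i\<in>{..<p n}. X n k i \<omega>) {..<n}"
    and r_range: "\<And>n. 0 \<le> r n \<and> r n < 1"
    and r_crit: "(\<lambda>n. r n * sqrt (real n) / sqrt (ln (real (p n)))) \<longlonglongrightarrow> 2 - sqrt 2"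
begin

abbreviation L_prob :: "nat \<Rightarrow> real \<Rightarrow> real" where
  "L_prob n v \<equiv> measure (M n) {\<omega>\<in>space (M n). L_stat n (p n) (\<lambda>k i. X n k i \<omega>) \<le> v}"

abbreviation L_cdf :: "nat \<Rightarrow> real \<Rightarrow> real \<Rightarrow> real \<Rightarrow> real" where
  "L_cdf n A D \<equiv> cdf (distr (M n) borel (\<lambda>\<omega>. A * L_stat n (p n) (\<lambda>k i. X n k i \<omega>) - D))"

lemma X_measurable:
  assumes "k < n" "i < p n"
  shows "X n k i \<in> borel_measurable (M n)"
  using gauss[OF assms(1)] assms(2) by (auto simp: centered_gaussian_vector_def)

lemma innovations:
  assumes "0 < n"
  shows "gaussian_array (M n) n (p n) (\<lambda>k. innovation (r n) (X n k))"
proof -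
  interpret prob_space "M n" by (rule prob)
  show ?thesis
  proof unfold_locales
    fix k i assume ki: "k < n" "i < p n"
    have [measurable]: "X n k 0 \<in> borel_measurable (M n)" "X n k i \<in> borel_measurable (M n)" "X n k (i - 1) \<in> borel_measurable (M n)"
      using ki by (auto intro: X_measurable)
    show "innovation (r n) (X n k) i \<in> borel_measurable (M n)" unfolding innovation_def by measurable
  next
    fix a
    show "(LINT x|M n. iexp (\<Sum>(k, i)\<in>{..<n} \<times> {..<p n}. a (k, i) * innovation (r n) (X n k) i x))
        = of_real (exp (- (\<Sum>z\<in>{..<n} \<times> {..<p n}. (a z)\<^sup>2) / 2))"
      using r_range[of n] by (intro char_innovation_array gauss indep) auto
  qed (rule assms)
qed

lemma r_over_rate: "(\<lambda>n. r n / rate n) \<longlonglongrightarrow> 2 - sqrt 2"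
  using r_crit by (simp add: rate_def L_def real_sqrt_divide)

lemma r_le_radius: "\<forall>\<^sub>F n in sequentially. r n \<le> radius n"
proof -
  have "0 \<le> sqrt (2 :: real)" by simp
  then have "2 - sqrt 2 < (16 :: real)" by linarith
  then have "\<forall>\<^sub>F n in sequentially. r n / rate n < 16" using r_over_rate by (intro order_tendstoD) auto
  with L_gt[of 0] eventually_gt_at_top[of 0] show ?thesis
  proof eventually_elim
    case (elim n)
    then have "0 < rate n" by (simp add: rate_def)
    then show ?case using elim by (simp add: radius_def divide_less_eq)
  qed
qed

lemma below_tendsto:
  assumes q1: "(\<lambda>n. (real (p n))\<^sup>2 * gauss_tail (y1 n)) \<longlonglongrightarrow> 2 * \<alpha>" and q2: "(\<lambda>n. real (p n) * gauss_tail (y2 n)) \<longlonglongrightarrow> \<beta>"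
    and s1: "(\<lambda>n. y1 n / sqrt (L n)) \<longlonglongrightarrow> 2" and s2: "(\<lambda>n. y2 n / sqrt (L n)) \<longlonglongrightarrow> sqrt 2"
  shows "(\<lambda>n. measure (M n) (gaussian_array.below (M n) n (\<lambda>k. innovation (r n) (X n k)) (cutoff (y1 n) (y2 n)) (p n))) \<longlonglongrightarrow> exp (- \<alpha> - \<beta>)"
proof -
  let ?b = "\<lambda>n. measure (M n) (gaussian_array.below (M n) n (\<lambda>k. innovation (r n) (X n k)) (cutoff (y1 n) (y2 n)) (p n))"
  define P where "P = (\<lambda>n. \<Prod>j<p n. 1 - (if j = 0 then 0 else real (j - 1) * gauss_tail (y1 n) + gauss_tail (y2 n)))"
  define \<delta> where "\<delta> = (\<lambda>n. 2 * level n / sqrt (real n))"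
  define err where "err = (\<lambda>n. real (p n) ^ 3 * (2 * gauss_tail (level n) + exp (- (9 / 128 * real n)) + exp (- ((y1 n)\<^sup>2 / (1 + \<delta> n))))
      + real (p n) ^ 2 * exp (- (((y1 n)\<^sup>2 + (y2 n)\<^sup>2) / (2 * (1 + \<delta> n)))))"
  have err: "err \<longlonglongrightarrow> 0" and d: "\<delta> \<longlonglongrightarrow> 0" using pair_error_tendsto[OF s1 s2] by (simp_all add: err_def \<delta>_def)
  have P: "P \<longlonglongrightarrow> exp (- \<alpha> - \<beta>)" and b: "(\<lambda>n. real (p n) * gauss_tail (y1 n) + gauss_tail (y2 n)) \<longlonglongrightarrow> 0"
    unfolding P_def using poisson_product_tendsto[OF p_lim gauss_tail_nonneg gauss_tail_nonneg q1 q2] by auto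
  have ge1: "\<forall>\<^sub>F n in sequentially. 1 \<le> y n" if "(\<lambda>n. y n / sqrt (L n)) \<longlonglongrightarrow> c" "1 < c" for y c
  proof -
    have "\<forall>\<^sub>F n in sequentially. 1 < y n / sqrt (L n)" using that by (intro order_tendstoD) auto
    with L_gt[of 1] show ?thesis
    proof eventually_elim
      case (elim n)
      then have "1 \<le> sqrt (L n)" by simp
      moreover have "sqrt (L n) < y n" using elim by (simp add: less_divide_eq)
      ultimately show ?case by linarith
    qed
  qed
  have y1: "\<forall>\<^sub>F n in sequentially. 1 \<le> y1 n" by (rule ge1[OF s1]) simp
  have y2: "\<forall>\<^sub>F n in sequentially. 1 \<le> y2 n" by (rule ge1[OF s2]) simp
  have "\<forall>\<^sub>F n in sequentially. \<bar>?b n - P n\<bar> \<le> err n"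
    using y1 y2 L_gt[of 0] eventually_gt_at_top[of 0] order_tendstoD(2)[OF d, of 1, simplified] order_tendstoD(2)[OF b, of 1, simplified]
  proof eventually_elim
    case (elim n)
    interpret gaussian_array "M n" n "p n" "\<lambda>k. innovation (r n) (X n k)" by (rule innovations) fact
    show ?case unfolding P_def err_def \<delta>_def
      using elim by (intro prob_below_cutoff) (auto simp: level_def \<delta>_def)
  qed
  then have "(\<lambda>n. ?b n - P n) \<longlonglongrightarrow> 0"
    by (intro Lim_null_comparison[OF _ err]) (auto simp: real_norm_def)
  from tendsto_add[OF this P] show ?thesis by simp
qed

text \<open>The sign \<sigma> selects the side of the sandwich. Both sides are required to have the
  same tail limits, which is where the negligibility of \<open>slack\<close> enters.\<close>

lemma L_stat_tendsto:
  assumes q1: "\<And>\<sigma>. \<bar>\<sigma>\<bar> = 1 \<Longrightarrow> (\<lambda>n. (real (p n))\<^sup>2 * gauss_tail (y n + \<sigma> * slack n)) \<longlonglongrightarrow> 2 * \<alpha>"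
    and q2: "\<And>\<sigma>. \<bar>\<sigma>\<bar> = 1 \<Longrightarrow> (\<lambda>n. real (p n) * gauss_tail (y n - sqrt (real n) * r n + \<sigma> * slack n)) \<longlonglongrightarrow> \<beta>"
    and s1: "\<And>\<sigma>. \<bar>\<sigma>\<bar> = 1 \<Longrightarrow> (\<lambda>n. (y n + \<sigma> * slack n) / sqrt (L n)) \<longlonglongrightarrow> 2"
    and s2: "\<And>\<sigma>. \<bar>\<sigma>\<bar> = 1 \<Longrightarrow> (\<lambda>n. (y n - sqrt (real n) * r n + \<sigma> * slack n) / sqrt (L n)) \<longlonglongrightarrow> sqrt 2"
  shows "(\<lambda>n. L_prob n (y n / sqrt (real n))) \<longlonglongrightarrow> exp (- \<alpha> - \<beta>)"
proof -
  let ?b = "\<lambda>\<sigma> n. measure (M n) (gaussian_array.below (M n) n (\<lambda>k. innovation (r n) (X n k))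
      (cutoff (y n + \<sigma> * slack n) (y n - sqrt (real n) * r n + \<sigma> * slack n)) (p n))"
  define \<nu> where "\<nu> = (\<lambda>n. real (p n) * (2 * exp (- (real n * (radius n)\<^sup>2 / 16))) + (real (p n))\<^sup>2 * (2 * gauss_tail (level n)))"
  have \<nu>: "\<nu> \<longlonglongrightarrow> 0" unfolding \<nu>_def by (rule not_typical_tendsto)
  have b: "?b \<sigma> \<longlonglongrightarrow> exp (- \<alpha> - \<beta>)" if "\<bar>\<sigma>\<bar> = 1" for \<sigma>
    by (rule below_tendsto[OF q1[OF that] q2[OF that] s1[OF that] s2[OF that]])
  have "\<forall>\<^sub>F n in sequentially. radius n < 1 / 8" using radius_tendsto by (intro order_tendstoD) auto
  with p_ge[of 2] L_gt[of 0] eventually_gt_at_top[of 0] r_le_radius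
  have sandwich: "\<forall>\<^sub>F n in sequentially. ?b (- 1) n - \<nu> n \<le> L_prob n (y n / sqrt (real n))
    \<and> L_prob n (y n / sqrt (real n)) \<le> ?b 1 n + \<nu> n"
  proof eventually_elim
    case (elim n)
    interpret gaussian_array "M n" n "p n" "\<lambda>k. innovation (r n) (X n k)" by (rule innovations) fact
    have rad: "0 < radius n" using elim by (simp add: radius_def rate_def)
    have sn: "0 < sqrt (real n)" using elim by simp
    have lev: "2 * level n \<le> sqrt (real n) * radius n"
      using elim by (simp add: level_def radius_def rate_def real_sqrt_divide)
    have "r n * r n < 1" using mult_strict_mono'[of "r n" 1 "r n" 1] r_range[of n] by simp
    then have s: "sqrt (1 - (r n)\<^sup>2) \<noteq> 0" by (simp add: power2_eq_square)
    have bad: "prob (space (M n) - typical (radius n) (level n)) \<le> \<nu> n"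
      unfolding \<nu>_def using elim rad by (intro prob_not_typical) auto
    have rec: "X n k (Suc i) x = r n * X n k i x + sqrt (1 - (r n)\<^sup>2) * innovation (r n) (X n k) (Suc i) x" for k i x
      using s by (simp add: innovation_def)
    have start: "X n k 0 x = innovation (r n) (X n k) 0 x" for k x by (simp add: innovation_def)
    have rad8: "radius n \<le> 1 / 8" using elim by simp
    have r0: "0 \<le> r n" using r_range by simp
    note sw = L_stat_sandwich[OF elim(1) rad rad8 lev r0 elim(4), where Y="X n" and y="y n", OF start rec X_measurable]
    have "L_prob n (y n / sqrt (real n))
      \<le> ?b 1 n + prob (space (M n) - typical (radius n) (level n))"
      using sw(1) by (simp add: slack_def)
    moreover have "?b (- 1) n - prob (space (M n) - typical (radius n) (level n))
      \<le> L_prob n (y n / sqrt (real n))"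
      using sw(2) by (simp add: slack_def)
    ultimately show ?case using bad by linarith
  qed
  show ?thesis
  proof (rule tendsto_sandwich)
    show "\<forall>\<^sub>F n in sequentially. ?b (- 1) n - \<nu> n \<le> L_prob n (y n / sqrt (real n))"
      using sandwich by eventually_elim simp
    show "\<forall>\<^sub>F n in sequentially. L_prob n (y n / sqrt (real n)) \<le> ?b 1 n + \<nu> n"
      using sandwich by eventually_elim simp
    show "(\<lambda>n. ?b (- 1) n - \<nu> n) \<longlonglongrightarrow> exp (- \<alpha> - \<beta>)" using tendsto_diff[OF b \<nu>, of "- 1"] by simp
    show "(\<lambda>n. ?b 1 n + \<nu> n) \<longlonglongrightarrow> exp (- \<alpha> - \<beta>)" using tendsto_add[OF b \<nu>, of 1] by simp
  qed
qed

lemma L_stat_measurable: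
  assumes "2 \<le> p n"
  shows "(\<lambda>\<omega>. L_stat n (p n) (\<lambda>k i. X n k i \<omega>)) \<in> borel_measurable (M n)"
  by (rule borel_measurableI_le) (rule L_stat_le_event[OF X_measurable assms])

lemma cdf_affine_L_stat:
  assumes "2 \<le> p n" "0 < A"
  shows "L_cdf n A D x
    = L_prob n ((D + x) / A)"
proof -
  note [measurable] = L_stat_measurable[OF assms(1)]
  have "L_cdf n A D x
    = measure (M n) ((\<lambda>\<omega>. A * L_stat n (p n) (\<lambda>k i. X n k i \<omega>) - D) -` {..x} \<inter> space (M n))"
    unfolding cdf_def by (rule measure_distr) measurable
  also have "(\<lambda>\<omega>. A * L_stat n (p n) (\<lambda>k i. X n k i \<omega>) - D) -` {..x} \<inter> space (M n)
    = {\<omega>\<in>space (M n). L_stat n (p n) (\<lambda>k i. X n k i \<omega>) \<le> (D + x) / A}"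
    using assms(2) by (auto simp: field_simps)
  finally show ?thesis .
qed

end

section \<open>The three regimes\<close>

lemma filterlim_at_bot_le:
  fixes f g :: "nat \<Rightarrow> real"
  assumes "filterlim g at_bot sequentially" "\<forall>\<^sub>F n in sequentially. f n \<le> g n"
  shows "filterlim f at_bot sequentially"
  unfolding filterlim_at_bot
proof
  fix c
  have "\<forall>\<^sub>F n in sequentially. g n \<le> c" using assms(1) by (simp add: filterlim_at_bot)
  with assms(2) show "\<forall>\<^sub>F n in sequentially. f n \<le> c" by eventually_elim simp
qed

context critical_regime
begin

definition "kap (n::nat) = kappa_n n (p n) (r n)"

definition "lam (n::nat) = lambda_n n (p n) (r n)"

text \<open>The negated coefficient of log log p in \<open>lambda_n\<close>; also K2 = gap * ln(4
  pi).\<close>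

definition "gap = 1 / 2 - 1 / sqrt (8 :: real)"

lemma sqrt8: "1 / sqrt 8 = sqrt 2 / (4 :: real)" "sqrt 8 = 2 * sqrt (2::real)"
proof -
  have "sqrt 8 = sqrt (4 * 2 :: real)" by simp
  then show *: "sqrt 8 = 2 * sqrt (2::real)" unfolding real_sqrt_mult by simp
  show "1 / sqrt 8 = sqrt 2 / (4 :: real)" unfolding * by (simp add: field_simps)
qed

lemma ln_constants:
  "ln (4 * pi) = 2 * ln 2 + ln pi" "ln (2 * pi) = ln 2 + ln pi" "ln (sqrt 2) = ln 2 / (2 :: real)"
proof -
  have "ln (2 * (2 * pi)) = ln 2 + (ln 2 + ln pi)" by (simp only: ln_mult) (simp add: ln_mult)
  then show "ln (4 * pi) = 2 * ln 2 + ln pi" by simp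
qed (simp_all add: ln_mult ln_sqrt)

lemma divide_sqrt_2: "z / sqrt 2 = sqrt 2 * z / (2 :: real)"
  by (simp add: field_simps)

lemma kap_eq: "kap n = r n * sqrt (real n) / sqrt (L n) - (2 - sqrt 2)"
  by (simp add: kap_def kappa_n_def L_def)

lemma lam_eq: "lam n = sqrt 2 * L n * kap n - gap * ln (L n)"
  by (simp add: lam_def lambda_n_def L_def kap_def gap_def algebra_simps)

lemma kap_L: "kap n * L n = (lam n + gap * ln (L n)) / sqrt 2"
  by (simp add: lam_eq field_simps)

lemma kap_tendsto: "kap \<longlonglongrightarrow> 0"
  using tendsto_diff[OF r_crit tendsto_const[of "2 - sqrt 2"]] by (simp add: kap_eq[abs_def] L_def)

lemma sqrt_n_r: "\<forall>\<^sub>F n in sequentially. sqrt (real n) * r n = (2 - sqrt 2 + kap n) * sqrt (L n)"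
  using L_gt[of 0] by eventually_elim (simp add: kap_eq)

lemma log_ratios:
  "(\<lambda>n. ln (L n) / L n) \<longlonglongrightarrow> 0" "(\<lambda>n. (ln (L n))\<^sup>2 / L n) \<longlonglongrightarrow> 0"
proof -
  have "((\<lambda>z::real. ln z / z) \<longlongrightarrow> 0) at_top" by real_asymp
  then show "(\<lambda>n. ln (L n) / L n) \<longlonglongrightarrow> 0" using L_at_top by (rule filterlim_compose)
  have "((\<lambda>z::real. (ln z)\<^sup>2 / z) \<longlongrightarrow> 0) at_top" by real_asymp
  then show "(\<lambda>n. (ln (L n))\<^sup>2 / L n) \<longlonglongrightarrow> 0" using L_at_top by (rule filterlim_compose)
qed

text \<open>Writing \<kappa> ln L as (\<kappa> L)(ln L / L) expresses it as o(1) times \<lambda>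
  plus o(1). It can therefore be absorbed into \<lambda> even when \<lambda> is unbounded.\<close>

lemma kap_log: "\<forall>\<^sub>F n in sequentially. kap n * ln (L n) = lam n * (ln (L n) / L n) / sqrt 2 + gap * ((ln (L n))\<^sup>2 / L n) / sqrt 2"
  using L_gt[of 0]
proof eventually_elim
  case (elim n)
  then have "kap n * ln (L n) = (kap n * L n) * (ln (L n) / L n)" by simp
  moreover have "(l + g * z) / w * (z / x) = l * (z / x) / w + g * (z\<^sup>2 / x) / w" for l g z w x :: real
    by (simp add: power2_eq_square add_divide_distrib algebra_simps)
  ultimately show ?case unfolding kap_L by simp
qed

section \<open>Thresholds under the two normalizations\<close>

definition "centre (x::real) = x - ln (4 * pi) / 2"

text \<open>This is sqrt n (b_n + x) / a_n, and the primed version is sqrt n (d_n + x) / c_n, so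
  that the normalized event at x reads \<open>L_stat\<close> \<le> threshold / sqrt n.\<close>

definition "threshold (x::real) n = 2 * sqrt (L n) + (centre x - ln (L n) / 2) / (2 * sqrt (L n))"

definition "threshold' (x::real) n = sqrt (real n) * r n
  + (1 - (r n)\<^sup>2) * (sqrt 2 * sqrt (L n) + (centre x - ln (L n) / 2) / (sqrt 2 * sqrt (L n)))"

abbreviation "adjacent_threshold x \<sigma> \<equiv> \<lambda>n. threshold x n - sqrt (real n) * r n + \<sigma> * slack n"

abbreviation "adjacent_threshold' x \<sigma> \<equiv> \<lambda>n. threshold' x n - sqrt (real n) * r n + \<sigma> * slack n"

lemma sign_slack: "\<bar>\<sigma>\<bar> = 1 \<Longrightarrow> (\<lambda>n. \<sigma> * slack n * sqrt (L n)) \<longlonglongrightarrow> 0"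
  using tendsto_mult[OF tendsto_const slack_tendsto, of \<sigma>] by (simp add: mult.assoc)

lemma distant: 
  assumes "\<bar>\<sigma>\<bar> = 1"
  shows "threshold_expansion L (\<lambda>_. 0) (\<lambda>n. \<sigma> * slack n) (\<lambda>n. threshold x n + \<sigma> * slack n) 2 2 (centre x)"
  using sign_slack[OF assms] L_at_top by unfold_locales (auto simp: threshold_def)

text \<open>Subtracting sqrt n r = (2 - sqrt 2 + \<kappa>) sqrt L from 2 sqrt L leaves the leading
  coefficient sqrt 2 and the drift -\<kappa>.\<close>

lemma adjacent:
  assumes "\<bar>\<sigma>\<bar> = 1"
  shows "threshold_expansion L (\<lambda>n. - kap n) (\<lambda>n. \<sigma> * slack n)
    (adjacent_threshold x \<sigma>) (sqrt 2) 2 (centre x)"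
proof unfold_locales
  show "(\<lambda>n. - kap n) \<longlonglongrightarrow> 0" using tendsto_minus[OF kap_tendsto] by simp
  show "\<forall>\<^sub>F n in sequentially. threshold x n - sqrt (real n) * r n + \<sigma> * slack n =
    (sqrt 2 + - kap n) * sqrt (L n) + (centre x - ln (L n) / 2) / (2 * sqrt (L n)) + \<sigma> * slack n"
    using sqrt_n_r by eventually_elim (simp add: threshold_def algebra_simps)
qed (use sign_slack[OF assms] L_at_top in auto)

text \<open>The contribution of -r^2 in the factor 1 - r^2; it is treated as part of
  \<epsilon>.\<close>

definition "shrink x n = - (r n)\<^sup>2 * (sqrt 2 * sqrt (L n) + (centre x - ln (L n) / 2) / (sqrt 2 * sqrt (L n)))"

lemma shrink_tendsto: "(\<lambda>n. shrink x n * sqrt (L n)) \<longlonglongrightarrow> 0"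
proof -
  have r2L: "(\<lambda>n. (r n)\<^sup>2 * L n) \<longlonglongrightarrow> 0"
  proof -
    \<comment> \<open>Since r^2 is of order L / n, r^2 L is of order L^2 / n = (L / n^(1/5))^2
      n^(-3/5).\<close>
    have "(\<lambda>n. real n powr (-3/5)) \<longlonglongrightarrow> 0" by real_asymp
    then have "(\<lambda>n. (r n / rate n)\<^sup>2 * ((ln (real (p n)) / real n powr (1/5))\<^sup>2 * real n powr (-3/5))) \<longlonglongrightarrow> (2 - sqrt 2)\<^sup>2 * (0\<^sup>2 * 0)"
      by (intro tendsto_intros r_over_rate logp)
    moreover have "\<forall>\<^sub>F n in sequentially. (r n / rate n)\<^sup>2 * ((ln (real (p n)) / real n powr (1/5))\<^sup>2 * real n powr (-3/5)) = (r n)\<^sup>2 * L n"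
      using L_gt[of 0] eventually_gt_at_top[of 0]
    proof eventually_elim
      case (elim n)
      have "(real n powr (1/5))\<^sup>2 * real n powr (3/5) = real n"
        using elim by (simp add: power2_eq_square powr_add[symmetric])
      then have "(L n / real n powr (1/5))\<^sup>2 * real n powr (-3/5) = (L n)\<^sup>2 / real n"
        using elim by (simp add: power_divide powr_minus_divide[of "real n" "3/5", simplified])
      moreover have "(r n / rate n)\<^sup>2 = (r n)\<^sup>2 * (real n / L n)" using elim by (simp add: rate_def power_divide)
      ultimately show ?case using elim by (simp add: L_def[symmetric] power2_eq_square)
    qed
    ultimately have "(\<lambda>n. (r n)\<^sup>2 * L n) \<longlonglongrightarrow> (2 - sqrt 2)\<^sup>2 * (0\<^sup>2 * 0)" by (rule Lim_transform_eventually)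
    then show ?thesis by simp
  qed
  have "((\<lambda>z::real. (centre x - ln z / 2) / z) \<longlongrightarrow> 0) at_top" by real_asymp
  then have B: "(\<lambda>n. (centre x - ln (L n) / 2) / L n) \<longlonglongrightarrow> 0" using L_at_top by (rule filterlim_compose)
  have "(\<lambda>n. - (((r n)\<^sup>2 * L n) * (sqrt 2 + (centre x - ln (L n) / 2) / L n / sqrt 2))) \<longlonglongrightarrow> - (0 * (sqrt 2 + 0 / sqrt 2))"
    by (intro tendsto_intros r2L B) auto
  moreover have "\<forall>\<^sub>F n in sequentially. - (((r n)\<^sup>2 * L n) * (sqrt 2 + (centre x - ln (L n) / 2) / L n / sqrt 2)) = shrink x n * sqrt (L n)"
    using L_gt[of 0]
  proof eventually_elim
    case (elim n)
    define s where "s = sqrt (L n)"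
    have s: "L n = s * s" "0 < s" using elim by (auto simp: s_def)
    have "- (((r n)\<^sup>2 * (s * s)) * (sqrt 2 + c / (s * s) / sqrt 2)) = - (r n)\<^sup>2 * (sqrt 2 * s + c / (sqrt 2 * s)) * s" for c
      using s(2) by (simp add: field_simps)
    from this[of "centre x - ln (L n) / 2"] show ?case unfolding shrink_def s_def[symmetric] s(1)[symmetric] .
  qed
  ultimately have "(\<lambda>n. shrink x n * sqrt (L n)) \<longlonglongrightarrow> - (0 * (sqrt 2 + 0 / sqrt 2))" by (rule Lim_transform_eventually)
  then show ?thesis by simp
qed

lemma shrink_slack:
  assumes "\<bar>\<sigma>\<bar> = 1"
  shows "(\<lambda>n. (shrink x n + \<sigma> * slack n) * sqrt (L n)) \<longlonglongrightarrow> 0"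
  using tendsto_add[OF shrink_tendsto sign_slack[OF assms]] by (simp add: distrib_right)

lemma threshold'_eq: "threshold' x n = sqrt (real n) * r n
  + (sqrt 2 * sqrt (L n) + (centre x - ln (L n) / 2) / (sqrt 2 * sqrt (L n))) + shrink x n"
proof -
  have "q + (1 - \<rho>) * Q = q + Q + - \<rho> * Q" for q \<rho> Q :: real by (simp add: algebra_simps)
  then show ?thesis unfolding threshold'_def shrink_def .
qed

lemma adjacent':
  assumes "\<bar>\<sigma>\<bar> = 1"
  shows "threshold_expansion L (\<lambda>_. 0) (\<lambda>n. shrink x n + \<sigma> * slack n)
    (adjacent_threshold' x \<sigma>) (sqrt 2) (sqrt 2) (centre x)"
  using shrink_slack[OF assms] L_at_top
  by unfold_locales (auto simp: threshold'_eq)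

text \<open>The second normalization is centred at the adjacent pairs, so the drift moves to the
  distant ones: sqrt n r + sqrt 2 sqrt L = (2 + \<kappa>) sqrt L.\<close>

lemma distant':
  assumes "\<bar>\<sigma>\<bar> = 1"
  shows "threshold_expansion L kap (\<lambda>n. shrink x n + \<sigma> * slack n)
    (\<lambda>n. threshold' x n + \<sigma> * slack n) 2 (sqrt 2) (centre x)"
proof unfold_locales
  show "\<forall>\<^sub>F n in sequentially. threshold' x n + \<sigma> * slack n =
    (2 + kap n) * sqrt (L n) + (centre x - ln (L n) / 2) / (sqrt 2 * sqrt (L n)) + (shrink x n + \<sigma> * slack n)"
    using sqrt_n_r by eventually_elim (simp add: threshold'_eq distrib_right left_diff_distrib)
qed (use shrink_slack[OF assms] L_at_top kap_tendsto in auto)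

lemma scaled_threshold:
  "\<forall>\<^sub>F n in sequentially. 0 < a_n n (p n) \<and> (b_n (p n) + x) / a_n n (p n) = threshold x n / sqrt (real n)"
  using L_gt[of 0] eventually_gt_at_top[of 0]
proof eventually_elim
  case (elim n)
  define s where "s = sqrt (L n)"
  define q where "q = sqrt (real n)"
  have s: "L n = s * s" "0 < s" "0 < q" using elim by (auto simp: s_def q_def)
  have a: "a_n n (p n) = 2 * (q * s)" by (simp add: a_n_def L_def[symmetric] s_def q_def real_sqrt_mult)
  have b: "b_n (p n) + x = 4 * (s * s) + (centre x - ln (L n) / 2)"
    by (simp add: b_n_def centre_def L_def[symmetric] s(1)[symmetric] add_divide_distrib)
  have "(4 * (s * s) + c) / (2 * (q * s)) = (2 * s + c / (2 * s)) / q" for c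
    using s(2,3) by (simp add: field_simps)
  then show ?case unfolding a b threshold_def s_def[symmetric] q_def[symmetric] using s by simp
qed

lemma scaled_threshold':
  "\<forall>\<^sub>F n in sequentially. 0 < c_n n (p n) (r n) \<and> (d_n n (p n) (r n) + x) / c_n n (p n) (r n) = threshold' x n / sqrt (real n)"
  using L_gt[of 0] eventually_gt_at_top[of 0]
proof eventually_elim
  case (elim n)
  define s where "s = sqrt (L n)"
  define q where "q = sqrt (real n)"
  define v where "v = 1 - (r n)\<^sup>2"
  have "r n * r n < 1" using mult_strict_mono'[of "r n" 1 "r n" 1] r_range[of n] by simp
  then have v: "0 < v" by (simp add: v_def power2_eq_square)
  have s: "L n = s * s" "0 < s" "0 < q" using elim by (auto simp: s_def q_def)
  have sq: "sqrt (2 * real n * L n) = sqrt 2 * q * s" by (simp add: real_sqrt_mult s_def q_def)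
  have c: "c_n n (p n) (r n) = sqrt 2 * q * s / v" by (simp add: c_n_def L_def[symmetric] sq v_def)
  have d: "d_n n (p n) (r n) + x = r n * (sqrt 2 * q * s) / v + 2 * (s * s) + (centre x - ln (L n) / 2)"
    by (simp add: d_n_def centre_def L_def[symmetric] sq v_def s(1)[symmetric] add_divide_distrib)
  have "(r n * (w * q * s) / v + (w * w) * (s * s) + b) / (w * q * s / v) = (q * r n + v * (w * s + b / (w * s))) / q" if "0 < w" for b w
    using s(2,3) v that by (simp add: field_simps)
  from this[of "sqrt 2"] show ?case unfolding c d threshold'_def s_def[symmetric] q_def[symmetric] v_def[symmetric] using s v by simp
qed

section \<open>Limits of the expected numbers of exceedances\<close>

lemma p_square: "\<forall>\<^sub>F n in sequentially. exp (2\<^sup>2 / 2 * L n) * t n = (real (p n))\<^sup>2 * t n"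
  using p_exp by eventually_elim (simp add: exp_double)

lemma p_linear: "\<forall>\<^sub>F n in sequentially. exp ((sqrt 2)\<^sup>2 / 2 * L n) * t n = real (p n) * t n"
  using p_exp by eventually_elim simp

text \<open>For a = b = 2 without drift the logarithms of L cancel and the excess is constant. The
  constants combine to ln(4 pi)/2 - ln 2 - ln(2 pi)/2 = -ln 2 / 2, and 1 / sqrt 2 = 2 K1.\<close>

lemma distant_tail:
  assumes "\<bar>\<sigma>\<bar> = 1"
  shows "(\<lambda>n. (real (p n))\<^sup>2 * gauss_tail (threshold x n + \<sigma> * slack n)) \<longlonglongrightarrow> 2 * (K1 * exp (- x))"
proof -
  interpret T: threshold_expansion L "\<lambda>_. 0" "\<lambda>n. \<sigma> * slack n" "\<lambda>n. threshold x n + \<sigma> * slack n" 2 2 "centre x"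
    by (rule distant[OF assms])
  have "T.excess = (\<lambda>n. - centre x)" by (simp add: T.excess_def fun_eq_iff diff_divide_distrib)
  then have "T.excess \<longlonglongrightarrow> - centre x" by simp
  from Lim_transform_eventually[OF T.tail_tendsto[OF this] p_square]
  have "(\<lambda>n. (real (p n))\<^sup>2 * gauss_tail (threshold x n + \<sigma> * slack n)) \<longlonglongrightarrow> exp (- centre x - ln 2 - ln (2 * pi) / 2)" .
  also have "- centre x - ln 2 - ln (2 * pi) / 2 = - x - ln (sqrt 2)"
    using ln_constants unfolding centre_def by argo
  also have "exp (- x - ln (sqrt 2)) = 2 * (K1 * exp (- x))"
    by (simp add: exp_diff K1_def)
  finally show ?thesis .
qed

text \<open>The origin of \<open>lambda_n\<close>: the drift gives sqrt 2 \<kappa> L, and the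
  logarithms leave (sqrt 2 / 4 - 1/2) ln L.\<close>

lemma adjacent_excess:
  "threshold_expansion.excess L (\<lambda>n. - kap n) (sqrt 2) 2 (centre x) n
    = lam n - kap n * (kap n * L n) / 2 - kap n * ln (L n) / 4 - (sqrt 2 - kap n) * centre x / 2"
proof -
  interpret T: threshold_expansion L "\<lambda>n. - kap n" "\<lambda>n. 1 * slack n" "adjacent_threshold x 1" "sqrt 2" 2 "centre x"
    by (rule adjacent) simp
  show ?thesis by (simp add: T.excess_def lam_eq gap_def sqrt8(1) power2_eq_square algebra_simps add_divide_distrib diff_divide_distrib)
qed

text \<open>Convergence of \<lambda> makes \<kappa> ln L vanish, then also \<kappa>^2 L, since
  \<kappa> (\<kappa> L) is a combination of \<kappa> \<lambda> and \<kappa> ln L. The excess tends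
  to l - centre x / sqrt 2, whose constants produce K2.\<close>

lemma adjacent_tail:
  assumes "\<bar>\<sigma>\<bar> = 1" and lam: "lam \<longlonglongrightarrow> l"
  shows "(\<lambda>n. real (p n) * gauss_tail (adjacent_threshold x \<sigma> n)) \<longlonglongrightarrow> exp (- x / sqrt 2 - K2 + l)"
proof -
  interpret T: threshold_expansion L "\<lambda>n. - kap n" "\<lambda>n. \<sigma> * slack n" "adjacent_threshold x \<sigma>" "sqrt 2" 2 "centre x"
    by (rule adjacent[OF assms(1)])
  have "(\<lambda>n. lam n * (ln (L n) / L n) / sqrt 2 + gap * ((ln (L n))\<^sup>2 / L n) / sqrt 2) \<longlonglongrightarrow> l * 0 / sqrt 2 + gap * 0 / sqrt 2"
    by (intro tendsto_intros lam log_ratios) auto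
  from Lim_transform_eventually[OF this eventually_mono[OF kap_log]]
  have kl: "(\<lambda>n. kap n * ln (L n)) \<longlonglongrightarrow> 0" by simp
  have "(\<lambda>n. (kap n * lam n + gap * (kap n * ln (L n))) / sqrt 2) \<longlonglongrightarrow> (0 * l + gap * 0) / sqrt 2"
    by (intro tendsto_intros kap_tendsto lam kl) auto
  moreover have "(\<lambda>n. (kap n * lam n + gap * (kap n * ln (L n))) / sqrt 2) = (\<lambda>n. kap n * (kap n * L n))"
    unfolding kap_L by (simp add: fun_eq_iff algebra_simps)
  ultimately have kk: "(\<lambda>n. kap n * (kap n * L n)) \<longlonglongrightarrow> 0" by simp
  have "(\<lambda>n. lam n - kap n * (kap n * L n) / 2 - kap n * ln (L n) / 4 - (sqrt 2 - kap n) * centre x / 2)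
    \<longlonglongrightarrow> l - 0 / 2 - 0 / 4 - (sqrt 2 - 0) * centre x / 2"
    by (intro tendsto_intros lam kk kl kap_tendsto) auto
  then have "T.excess \<longlonglongrightarrow> l - sqrt 2 * centre x / 2" unfolding adjacent_excess[abs_def] by simp
  from Lim_transform_eventually[OF T.tail_tendsto[OF this] p_linear]
  have "(\<lambda>n. real (p n) * gauss_tail (adjacent_threshold x \<sigma> n))
    \<longlonglongrightarrow> exp (l - sqrt 2 * centre x / 2 - ln (sqrt 2) - ln (2 * pi) / 2)" .
  also have "l - sqrt 2 * centre x / 2 - ln (sqrt 2) - ln (2 * pi) / 2 = - x / sqrt 2 - K2 + l"
  proof -
    have "sqrt 2 * (x - ln (4 * pi) / 2) / 2 = sqrt 2 * x / 2 - sqrt 2 * ln (4 * pi) / 4"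
      by (simp add: right_diff_distrib diff_divide_distrib)
    moreover have "K2 = ln (4 * pi) / 2 - sqrt 2 * ln (4 * pi) / 4"
      by (simp add: K2_def sqrt8(1) left_diff_distrib)
    moreover have "- x / sqrt 2 = - (sqrt 2 * x / 2)" by (simp add: divide_sqrt_2)
    ultimately show ?thesis using ln_constants unfolding centre_def by argo
  qed
  finally show ?thesis .
qed

lemma adjacent_tail_0:
  assumes "\<bar>\<sigma>\<bar> = 1" and lam: "filterlim lam at_bot sequentially"
  shows "(\<lambda>n. real (p n) * gauss_tail (adjacent_threshold x \<sigma> n)) \<longlonglongrightarrow> 0"
proof -
  interpret T: threshold_expansion L "\<lambda>n. - kap n" "\<lambda>n. \<sigma> * slack n" "adjacent_threshold x \<sigma>" "sqrt 2" 2 "centre x"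
    by (rule adjacent[OF assms(1)])
  have c: "(\<lambda>n. 1 - ln (L n) / L n / sqrt 2 / 4) \<longlonglongrightarrow> 1 - 0 / sqrt 2 / 4" by (intro tendsto_intros log_ratios) auto
  have main: "filterlim (\<lambda>n. (1 - ln (L n) / L n / sqrt 2 / 4) * lam n) at_bot sequentially"
    by (rule filterlim_tendsto_pos_mult_at_bot[OF c _ lam]) simp
  have rest: "(\<lambda>n. - (gap * ((ln (L n))\<^sup>2 / L n) / sqrt 2) / 4 - (sqrt 2 - kap n) * centre x / 2) \<longlonglongrightarrow> - (gap * 0 / sqrt 2) / 4 - (sqrt 2 - 0) * centre x / 2"
    by (intro tendsto_intros log_ratios kap_tendsto) auto
  have "filterlim T.excess at_bot sequentially"
  proof (rule filterlim_at_bot_le)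
    show "filterlim (\<lambda>n. (- (gap * ((ln (L n))\<^sup>2 / L n) / sqrt 2) / 4 - (sqrt 2 - kap n) * centre x / 2) + (1 - ln (L n) / L n / sqrt 2 / 4) * lam n) at_bot sequentially"
      by (rule filterlim_tendsto_add_at_bot_iff[OF rest, THEN iffD2, OF main])
    show "\<forall>\<^sub>F n in sequentially. T.excess n \<le> (- (gap * ((ln (L n))\<^sup>2 / L n) / sqrt 2) / 4 - (sqrt 2 - kap n) * centre x / 2) + (1 - ln (L n) / L n / sqrt 2 / 4) * lam n"
      using kap_log L_gt[of 0]
    proof eventually_elim
      case (elim n)
      have "0 \<le> (kap n)\<^sup>2 * L n" using elim by simp
      then have "0 \<le> kap n * (kap n * L n)" by (simp add: power2_eq_square mult.assoc)
      moreover have "(1 - u / sqrt 2 / 4) * l = l - l * u / sqrt 2 / 4" for u l :: real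
        by (simp add: left_diff_distrib)
      ultimately show ?case unfolding adjacent_excess elim(1) by argo
    qed
  qed
  from Lim_transform_eventually[OF T.tail_tendsto_0[OF this] p_linear] show ?thesis .
qed

text \<open>Here a = b = sqrt 2 without drift, and ln(4 pi)/2 - ln 2 / 2 - ln(2 pi)/2 = 0, so
  \<open>d_n\<close> yields the standard Gumbel tail with constant 1.\<close>

lemma adjacent'_tail:
  assumes "\<bar>\<sigma>\<bar> = 1"
  shows "(\<lambda>n. real (p n) * gauss_tail (adjacent_threshold' x \<sigma> n)) \<longlonglongrightarrow> exp (- x)"
proof -
  interpret T: threshold_expansion L "\<lambda>_. 0" "\<lambda>n. shrink x n + \<sigma> * slack n" "adjacent_threshold' x \<sigma>" "sqrt 2" "sqrt 2" "centre x"
    by (rule adjacent'[OF assms])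
  have "T.excess = (\<lambda>n. - centre x)" by (simp add: T.excess_def fun_eq_iff diff_divide_distrib)
  then have "T.excess \<longlonglongrightarrow> - centre x" by simp
  from Lim_transform_eventually[OF T.tail_tendsto[OF this] p_linear]
  have "(\<lambda>n. real (p n) * gauss_tail (adjacent_threshold' x \<sigma> n)) \<longlonglongrightarrow> exp (- centre x - ln (sqrt 2) - ln (2 * pi) / 2)" .
  also have "- centre x - ln (sqrt 2) - ln (2 * pi) / 2 = - x"
    using ln_constants unfolding centre_def by argo
  finally show ?thesis .
qed

text \<open>Relative to the adjacent pairs the distant ones have excess -sqrt 2 \<lambda> plus
  lower-order terms. The term -\<kappa>^2 L / 2 has the favourable sign again, so divergence of
  \<lambda> makes the distant pairs disappear.\<close>

lemma distant'_tail:
  assumes "\<bar>\<sigma>\<bar> = 1" and lam: "filterlim lam at_top sequentially"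
  shows "(\<lambda>n. (real (p n))\<^sup>2 * gauss_tail (threshold' x n + \<sigma> * slack n)) \<longlonglongrightarrow> 2 * 0"
proof -
  interpret T: threshold_expansion L kap "\<lambda>n. shrink x n + \<sigma> * slack n" "\<lambda>n. threshold' x n + \<sigma> * slack n" 2 "sqrt 2" "centre x"
    by (rule distant'[OF assms(1)])
  have ex: "T.excess n = - sqrt 2 * lam n - kap n * (kap n * L n) / 2 + sqrt 2 / 4 * (kap n * ln (L n)) - (2 + kap n) * centre x / sqrt 2" for n
  proof -
    have "T.excess n = - 2 * (kap n * L n) - kap n * (kap n * L n) / 2 - (2 + kap n) * (centre x - ln (L n) / 2) / sqrt 2 - ln (L n) / 2"
      by (simp add: T.excess_def power2_eq_square)
    moreover have "(2 + kap n) * (centre x - ln (L n) / 2) / sqrt 2 = (2 + kap n) * centre x / sqrt 2 - sqrt 2 / 2 * ln (L n) - sqrt 2 / 4 * (kap n * ln (L n))"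
      unfolding divide_sqrt_2 by (simp add: algebra_simps add_divide_distrib diff_divide_distrib)
    moreover have "sqrt 2 * lam n = 2 * (kap n * L n) - sqrt 2 / 2 * ln (L n) + ln (L n) / 2"
    proof -
      have "w * (w * l * k - (1 / 2 - w / 4) * z) = (w * w) * (k * l) - w / 2 * z + (w * w) / 4 * z" for w l k z :: real
        by (simp add: algebra_simps)
      from this[of "sqrt 2"] show ?thesis unfolding lam_eq gap_def sqrt8(1) by simp
    qed
    ultimately show ?thesis by linarith
  qed
  have c: "(\<lambda>n. - sqrt 2 + ln (L n) / L n / 4) \<longlonglongrightarrow> - sqrt 2 + 0 / 4" by (intro tendsto_intros log_ratios) auto
  have main: "filterlim (\<lambda>n. (- sqrt 2 + ln (L n) / L n / 4) * lam n) at_bot sequentially"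
    by (rule filterlim_tendsto_neg_mult_at_bot[OF c _ lam]) simp
  have rest: "(\<lambda>n. gap * ((ln (L n))\<^sup>2 / L n) / 4 - (2 + kap n) * centre x / sqrt 2) \<longlonglongrightarrow> gap * 0 / 4 - (2 + 0) * centre x / sqrt 2"
    by (intro tendsto_intros log_ratios kap_tendsto) auto
  have "filterlim T.excess at_bot sequentially"
  proof (rule filterlim_at_bot_le)
    show "filterlim (\<lambda>n. (gap * ((ln (L n))\<^sup>2 / L n) / 4 - (2 + kap n) * centre x / sqrt 2) + (- sqrt 2 + ln (L n) / L n / 4) * lam n) at_bot sequentially"
      by (rule filterlim_tendsto_add_at_bot_iff[OF rest, THEN iffD2, OF main])
    show "\<forall>\<^sub>F n in sequentially. T.excess n \<le> (gap * ((ln (L n))\<^sup>2 / L n) / 4 - (2 + kap n) * centre x / sqrt 2) + (- sqrt 2 + ln (L n) / L n / 4) * lam n"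
      using kap_log L_gt[of 0]
    proof eventually_elim
      case (elim n)
      have "0 \<le> (kap n)\<^sup>2 * L n" using elim by simp
      then have "0 \<le> kap n * (kap n * L n)" by (simp add: power2_eq_square mult.assoc)
      moreover have "sqrt 2 / 4 * (kap n * ln (L n)) = lam n * (ln (L n) / L n) / 4 + gap * ((ln (L n))\<^sup>2 / L n) / 4"
        unfolding elim(1) by (simp add: distrib_left)
      moreover have "(- sqrt 2 + u / 4) * l = - sqrt 2 * l + l * u / 4" for u l :: real
        by (simp add: algebra_simps)
      ultimately show ?case unfolding ex by argo
    qed
  qed
  from Lim_transform_eventually[OF T.tail_tendsto_0[OF this] p_square] show ?thesis by simp
qed

text \<open>Serves the first two regimes at once: \<beta> is the limiting number of adjacent
  exceedances, zero in one and positive in the other. Convergence is shown at every x, not only at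
  continuity points.\<close>

lemma weak_conv_critical:
  assumes adj: "\<And>x \<sigma>. \<bar>\<sigma>\<bar> = 1 \<Longrightarrow> (\<lambda>n. real (p n) * gauss_tail (adjacent_threshold x \<sigma> n)) \<longlonglongrightarrow> \<beta> x"
  shows "weak_conv (\<lambda>n. L_cdf n (a_n n (p n)) (b_n (p n)))
    (\<lambda>x. exp (- K1 * exp (- x)) * exp (- \<beta> x))"
  unfolding weak_conv_def
proof (intro allI impI)
  fix x
  have "(\<lambda>n. L_prob n (threshold x n / sqrt (real n)))
    \<longlonglongrightarrow> exp (- (K1 * exp (- x)) - \<beta> x)"
    by (intro L_stat_tendsto distant_tail adj threshold_expansion.ratio[OF distant] threshold_expansion.ratio[OF adjacent])
  moreover have "\<forall>\<^sub>F n in sequentially. L_prob n (threshold x n / sqrt (real n))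
    = L_cdf n (a_n n (p n)) (b_n (p n)) x"
    using scaled_threshold[of x] p_ge[of 2] by eventually_elim (simp add: cdf_affine_L_stat)
  ultimately have "(\<lambda>n. L_cdf n (a_n n (p n)) (b_n (p n)) x)
    \<longlonglongrightarrow> exp (- (K1 * exp (- x)) - \<beta> x)" by (rule Lim_transform_eventually)
  then show "(\<lambda>n. L_cdf n (a_n n (p n)) (b_n (p n)) x)
    \<longlonglongrightarrow> exp (- K1 * exp (- x)) * exp (- \<beta> x)" by (simp add: exp_diff exp_minus divide_inverse)
qed

text \<open>The product limit with \<alpha> = 0 from the distant pairs and \<beta> = exp(-x) from
  the adjacent ones.\<close>

lemma weak_conv_supercritical:
  assumes lam: "filterlim lam at_top sequentially"
  shows "weak_conv (\<lambda>n. L_cdf n (c_n n (p n) (r n)) (d_n n (p n) (r n)))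
    (\<lambda>x. exp (- exp (- x)))"
  unfolding weak_conv_def
proof (intro allI impI)
  fix x
  have "(\<lambda>n. L_prob n (threshold' x n / sqrt (real n)))
    \<longlonglongrightarrow> exp (- 0 - exp (- x))"
    by (intro L_stat_tendsto distant'_tail lam adjacent'_tail threshold_expansion.ratio[OF distant'] threshold_expansion.ratio[OF adjacent'])
  moreover have "\<forall>\<^sub>F n in sequentially. L_prob n (threshold' x n / sqrt (real n))
    = L_cdf n (c_n n (p n) (r n)) (d_n n (p n) (r n)) x"
    using scaled_threshold'[of x] p_ge[of 2] by eventually_elim (simp add: cdf_affine_L_stat)
  ultimately have "(\<lambda>n. L_cdf n (c_n n (p n) (r n)) (d_n n (p n) (r n)) x)
    \<longlonglongrightarrow> exp (- 0 - exp (- x))" by (rule Lim_transform_eventually)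
  then show "(\<lambda>n. L_cdf n (c_n n (p n) (r n)) (d_n n (p n) (r n)) x)
    \<longlonglongrightarrow> exp (- exp (- x))" by simp
qed

end

theorem theorem2:
  fixes M :: "nat \<Rightarrow> 'a measure"
    and X :: "nat \<Rightarrow> nat \<Rightarrow> nat \<Rightarrow> 'a \<Rightarrow> real"
    and p :: "nat \<Rightarrow> nat"
    and r :: "nat \<Rightarrow> real"
  assumes prob: "\<And>n. prob_space (M n)"
    and gauss: "\<And>n k. k < n \<Longrightarrow> centered_gaussian_vector (M n) (p n) (ar_cov (r n)) (X n k)"
    and indep: "\<And>n. prob_space.indep_vars (M n) (\<lambda>_. PiM {..<p n} (\<lambda>_. borel))
                   (\<lambda>k \<omega>. \<lambda>i\<in>{..<p n}. X n k i \<omega>) {..<n}"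
    and r_range: "\<And>n. 0 \<le> r n \<and> r n < 1"
    and p_lim: "filterlim p at_top sequentially"
    and logp: "(\<lambda>n. ln (real (p n)) / real n powr (1/5)) \<longlonglongrightarrow> 0"
    and r_limsup: "limsup (\<lambda>n. ereal (r n)) < 1"
    and r_crit: "(\<lambda>n. r n * sqrt (real n) / sqrt (ln (real (p n)))) \<longlonglongrightarrow> 2 - sqrt 2"
  shows
    "(filterlim (\<lambda>n. lambda_n n (p n) (r n)) at_bot sequentially \<longrightarrow>
        weak_conv (\<lambda>n. cdf (distr (M n) borel
                     (\<lambda>\<omega>. a_n n (p n) * L_stat n (p n) (\<lambda>k i. X n k i \<omega>) - b_n (p n))))
                  (\<lambda>x. exp (- K1 * exp (- x))))
   \<and> (\<forall>lam::real. (\<lambda>n. lambda_n n (p n) (r n)) \<longlonglongrightarrow> lam \<longrightarrow>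
        weak_conv (\<lambda>n. cdf (distr (M n) borel
                     (\<lambda>\<omega>. a_n n (p n) * L_stat n (p n) (\<lambda>k i. X n k i \<omega>) - b_n (p n))))
                  (\<lambda>x. exp (- K1 * exp (- x)) * exp (- exp (- x / sqrt 2 - K2 + lam))))
   \<and> (filterlim (\<lambda>n. lambda_n n (p n) (r n)) at_top sequentially \<longrightarrow>
        weak_conv (\<lambda>n. cdf (distr (M n) borel
                     (\<lambda>\<omega>. c_n n (p n) (r n) * L_stat n (p n) (\<lambda>k i. X n k i \<omega>) - d_n n (p n) (r n))))
                  (\<lambda>x. exp (- exp (- x))))"
proof -
  interpret critical_regime p M X r
    by (intro critical_regime.intro growth_regime.intro critical_regime_axioms.intro)
      (fact p_lim logp prob gauss indep r_range r_crit)+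
  have lam: "lam = (\<lambda>n. lambda_n n (p n) (r n))" by (simp add: lam_def fun_eq_iff)
  show ?thesis
  proof (intro conjI impI allI)
    assume "filterlim (\<lambda>n. lambda_n n (p n) (r n)) at_bot sequentially"
    then have "filterlim lam at_bot sequentially" by (simp add: lam)
    from weak_conv_critical[OF adjacent_tail_0[OF _ this]]
    show "weak_conv (\<lambda>n. cdf (distr (M n) borel
                     (\<lambda>\<omega>. a_n n (p n) * L_stat n (p n) (\<lambda>k i. X n k i \<omega>) - b_n (p n))))
                  (\<lambda>x. exp (- K1 * exp (- x)))" by simp
  next
    fix l assume "(\<lambda>n. lambda_n n (p n) (r n)) \<longlonglongrightarrow> l"
    then have "lam \<longlonglongrightarrow> l" by (simp add: lam)
    from weak_conv_critical[OF adjacent_tail[OF _ this]]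
    show "weak_conv (\<lambda>n. cdf (distr (M n) borel
                     (\<lambda>\<omega>. a_n n (p n) * L_stat n (p n) (\<lambda>k i. X n k i \<omega>) - b_n (p n))))
                  (\<lambda>x. exp (- K1 * exp (- x)) * exp (- exp (- x / sqrt 2 - K2 + l)))" by simp
  next
    assume "filterlim (\<lambda>n. lambda_n n (p n) (r n)) at_top sequentially"
    then have "filterlim lam at_top sequentially" by (simp add: lam)
    then show "weak_conv (\<lambda>n. cdf (distr (M n) borel
                     (\<lambda>\<omega>. c_n n (p n) (r n) * L_stat n (p n) (\<lambda>k i. X n k i \<omega>) - d_n n (p n) (r n))))
                  (\<lambda>x. exp (- exp (- x)))" by (rule weak_conv_supercritical)
  qed
qed

end
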